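(* Let $S$ be a finite inherently nonfinitely based ai-semiring, and let $\top=\sum_{s\in S}s$ (its additively greatest element). Then the additive order of $S$ has width at least two and height at least three. If $S$ has a multiplicative identity, that identity is neither the greatest nor the least element of the additive order. Every multiplicative subgroup of $S$ is an antichain in the additive order.
   Context: An ai-semiring is an algebra $(S,+,\cdot)$ with two binary operations and no designated constants, such that $(S,+)$ is a commutative idempotent semigroup, $(S,\cdot)$ is a semigroup, and $\cdot$ distributes over $+$ on both sides. Its additive order is $a\le b\iff a+b=b$. The height of a finite poset is the greatest number of elements in a chain, and its width is the greatest number of elements in an antichain. A multiplicative subgroup is a subsemigroup of $(S,\cdot)$ that is a group. Varieties are in the signature $\{+,\cdot\}$. A variety is locally finite if all finitely generated members are finite, and finitely based if it is axiomatized by finitely many identities. A locally finite variety is inherently nonfinitely based if it is contained in no finitely based locally finite variety of the same signature; an algebra is inherently nonfinitely based if the variety it generates is. *)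

theory Defs
  imports "HOL-Algebra.Group" "HOL-Library.Countable_Set"
begin

section \<open>Algebras with two binary operations\<close>

text \<open>The operations are only meaningful on the carrier. All notions below ignore their values
  elsewhere.\<close>

record 'a binalg = "'a partial_object" +
  splus :: "'a \<Rightarrow> 'a \<Rightarrow> 'a" (infixl \<open>\<boxplus>\<index>\<close> 65)
  stimes :: "'a \<Rightarrow> 'a \<Rightarrow> 'a" (infixl \<open>\<boxdot>\<index>\<close> 70)

definition binalgebra :: "'a binalg \<Rightarrow> bool" where
  "binalgebra A \<longleftrightarrow> carrier A \<noteq> {} \<and>
     (\<forall>x\<in>carrier A. \<forall>y\<in>carrier A. x \<boxplus>\<^bsub>A\<^esub> y \<in> carrier A \<and> x \<boxdot>\<^bsub>A\<^esub> y \<in> carrier A)"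

inductive_set generated :: "'a binalg \<Rightarrow> 'a set \<Rightarrow> 'a set" for A X where
  base: "x \<in> X \<Longrightarrow> x \<in> generated A X"
| plus: "x \<in> generated A X \<Longrightarrow> y \<in> generated A X \<Longrightarrow> x \<boxplus>\<^bsub>A\<^esub> y \<in> generated A X"
| times: "x \<in> generated A X \<Longrightarrow> y \<in> generated A X \<Longrightarrow> x \<boxdot>\<^bsub>A\<^esub> y \<in> generated A X"

definition finitely_generated :: "'a binalg \<Rightarrow> bool" where
  "finitely_generated A \<longleftrightarrow> (\<exists>X. finite X \<and> X \<subseteq> carrier A \<and> generated A X = carrier A)"


section \<open>Identities and varieties\<close>

datatype tm = Var nat | Plus tm tm | Times tm tm

primrec eval :: "'a binalg \<Rightarrow> (nat \<Rightarrow> 'a) \<Rightarrow> tm \<Rightarrow> 'a" where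
  "eval A \<rho> (Var n) = \<rho> n"
| "eval A \<rho> (Plus s t) = eval A \<rho> s \<boxplus>\<^bsub>A\<^esub> eval A \<rho> t"
| "eval A \<rho> (Times s t) = eval A \<rho> s \<boxdot>\<^bsub>A\<^esub> eval A \<rho> t"

type_synonym identity = "tm \<times> tm"

definition satisfies :: "'a binalg \<Rightarrow> identity \<Rightarrow> bool" where
  "satisfies A e \<longleftrightarrow> (\<forall>\<rho>. range \<rho> \<subseteq> carrier A \<longrightarrow> eval A \<rho> (fst e) = eval A \<rho> (snd e))"

text \<open>A variety is the class of all algebras satisfying some set of identities. Classes are
  rendered as sets of algebras whose carriers are subsets of a fixed type \<open>'u\<close>.\<close>

definition models :: "identity set \<Rightarrow> 'u binalg set" where
  "models \<Sigma> = {A. binalgebra A \<and> (\<forall>e\<in>\<Sigma>. satisfies A e)}"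

definition variety :: "'u binalg set \<Rightarrow> bool" where
  "variety V \<longleftrightarrow> (\<exists>\<Sigma>. V = models \<Sigma>)"

definition locally_finite :: "'u binalg set \<Rightarrow> bool" where
  "locally_finite V \<longleftrightarrow> (\<forall>A\<in>V. finitely_generated A \<longrightarrow> finite (carrier A))"

definition finitely_based :: "'u binalg set \<Rightarrow> bool" where
  "finitely_based V \<longleftrightarrow> (\<exists>\<Sigma>. finite \<Sigma> \<and> V = models \<Sigma>)"

definition inherently_nonfinitely_based_variety :: "'u binalg set \<Rightarrow> bool" where
  "inherently_nonfinitely_based_variety V \<longleftrightarrow> variety V \<and> locally_finite V \<and>
     \<not> (\<exists>W. variety W \<and> finitely_based W \<and> locally_finite W \<and> V \<subseteq> W)"

text \<open>The smallest variety containing \<open>S\<close>, with its members taken over the type \<open>'u\<close>, which may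
  differ from the type of elements of \<open>S\<close>; see \<open>generated_variety_least\<close> below.\<close>

definition generated_variety :: "'a binalg \<Rightarrow> 'u binalg set" where
  "generated_variety S = models {e. satisfies S e}"

text \<open>Members are taken over \<^typ>\<open>nat\<close>. This loses nothing: identities involve finitely many
  variables and finitely generated algebras are countable, so local finiteness of a variety and
  inclusion between varieties are decided by the members with carriers in \<^typ>\<open>nat\<close>; see
  \<open>locally_finite_nat\<close> and \<open>models_subset_nat\<close> below.\<close>

definition inherently_nonfinitely_based :: "'a binalg \<Rightarrow> bool" where
  "inherently_nonfinitely_based S \<longleftrightarrow>
     inherently_nonfinitely_based_variety (generated_variety S :: nat binalg set)"

lemma generated_variety_least:
  assumes "binalgebra S"
  shows "generated_variety S = \<Inter>{V. variety V \<and> S \<in> V}"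
  using assms unfolding generated_variety_def variety_def models_def by blast

lemma generated_subset:
  assumes "binalgebra A" "X \<subseteq> carrier A"
  shows "generated A X \<subseteq> carrier A"
proof
  fix x assume "x \<in> generated A X"
  then show "x \<in> carrier A"
    by induction (use assms in \<open>auto simp: binalgebra_def\<close>)
qed

lemma generated_eq_eval:
  assumes "range \<rho> = X"
  shows "generated A X = range (eval A \<rho>)"
proof
  show "generated A X \<subseteq> range (eval A \<rho>)"
  proof
    fix x assume "x \<in> generated A X"
    then show "x \<in> range (eval A \<rho>)"
    proof induction
      case (base x)
      then obtain n where "x = \<rho> n" using assms by auto
      then have "x = eval A \<rho> (Var n)" by simp
      then show ?case by blast
    next
      case (plus x y)
      then obtain s t where "x = eval A \<rho> s" "y = eval A \<rho> t" by auto
      then have "x \<boxplus>\<^bsub>A\<^esub> y = eval A \<rho> (Plus s t)" by simp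
      then show ?case by blast
    next
      case (times x y)
      then obtain s t where "x = eval A \<rho> s" "y = eval A \<rho> t" by auto
      then have "x \<boxdot>\<^bsub>A\<^esub> y = eval A \<rho> (Times s t)" by simp
      then show ?case by blast
    qed
  qed
  have "eval A \<rho> t \<in> generated A X" for t
    by (induction t) (use assms in \<open>auto intro: generated.intros\<close>)
  then show "range (eval A \<rho>) \<subseteq> generated A X" by auto
qed

instance tm :: countable by countable_datatype

lemma countable_generated:
  assumes "countable X"
  shows "countable (generated A X)"
proof (cases "X = {}")
  case True
  have "x \<in> generated A {} \<Longrightarrow> False" for x by (induction rule: generated.induct) auto
  with True have "generated A X = {}" by blast
  then show ?thesis by simp
next
  case False
  then have "range (from_nat_into X) = X" by (simp add: assms)
  from generated_eq_eval[OF this] show ?thesis by simp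
qed

text \<open>The isomorphic copy of \<open>A\<close> along a map \<open>f\<close> that is injective on the carrier.\<close>

definition transport :: "('a \<Rightarrow> 'b) \<Rightarrow> 'a binalg \<Rightarrow> 'b binalg" where
  "transport f A = (let g = inv_into (carrier A) f in
     \<lparr> carrier = f ` carrier A,
       splus = \<lambda>x y. f (g x \<boxplus>\<^bsub>A\<^esub> g y),
       stimes = \<lambda>x y. f (g x \<boxdot>\<^bsub>A\<^esub> g y) \<rparr>)"

lemma transport_sel:
  "carrier (transport f A) = f ` carrier A"
  "inj_on f (carrier A) \<Longrightarrow> x \<in> carrier A \<Longrightarrow> y \<in> carrier A \<Longrightarrow>
     f x \<boxplus>\<^bsub>transport f A\<^esub> f y = f (x \<boxplus>\<^bsub>A\<^esub> y)"
  "inj_on f (carrier A) \<Longrightarrow> x \<in> carrier A \<Longrightarrow> y \<in> carrier A \<Longrightarrow>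
     f x \<boxdot>\<^bsub>transport f A\<^esub> f y = f (x \<boxdot>\<^bsub>A\<^esub> y)"
  by (simp_all add: transport_def Let_def)

lemma eval_carrier:
  "binalgebra A \<Longrightarrow> range \<rho> \<subseteq> carrier A \<Longrightarrow> eval A \<rho> t \<in> carrier A"
  by (induction t) (auto simp: binalgebra_def)

lemma eval_transport:
  assumes "binalgebra A" "inj_on f (carrier A)" "range \<rho> \<subseteq> carrier A"
  shows "eval (transport f A) (f \<circ> \<rho>) t = f (eval A \<rho> t)"
  by (induction t) (simp_all add: transport_sel eval_carrier assms)

lemma binalgebra_transport:
  assumes "binalgebra A" "inj_on f (carrier A)"
  shows "binalgebra (transport f A)"
  using assms by (auto simp: binalgebra_def transport_sel)

lemma satisfies_transport:
  assumes "binalgebra A" "inj_on f (carrier A)"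
  shows "satisfies (transport f A) e \<longleftrightarrow> satisfies A e"
proof
  assume *: "satisfies (transport f A) e"
  show "satisfies A e"
    unfolding satisfies_def
  proof (intro allI impI)
    fix \<rho> :: "nat \<Rightarrow> 'a" assume r: "range \<rho> \<subseteq> carrier A"
    then have "range (f \<circ> \<rho>) \<subseteq> carrier (transport f A)" by (auto simp: transport_sel)
    with * have "f (eval A \<rho> (fst e)) = f (eval A \<rho> (snd e))"
      using eval_transport[OF assms r] by (metis satisfies_def)
    then show "eval A \<rho> (fst e) = eval A \<rho> (snd e)"
      using assms r by (meson eval_carrier inj_on_eq_iff)
  qed
next
  assume *: "satisfies A e"
  show "satisfies (transport f A) e"
    unfolding satisfies_def
  proof (intro allI impI)
    fix \<sigma> :: "nat \<Rightarrow> 'b" assume s: "range \<sigma> \<subseteq> carrier (transport f A)"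
    define \<rho> where "\<rho> = inv_into (carrier A) f \<circ> \<sigma>"
    have r: "range \<rho> \<subseteq> carrier A"
      using s by (auto simp: \<rho>_def transport_sel intro!: inv_into_into)
    have fr: "f \<circ> \<rho> = \<sigma>"
      using s by (auto simp: fun_eq_iff \<rho>_def transport_sel f_inv_into_f image_subset_iff)
    show "eval (transport f A) \<sigma> (fst e) = eval (transport f A) \<sigma> (snd e)"
      using eval_transport[OF assms r] * r by (simp add: fr satisfies_def)
  qed
qed

lemma generated_transport:
  assumes "binalgebra A" "inj_on f (carrier A)" "X \<subseteq> carrier A"
  shows "f ` generated A X \<subseteq> generated (transport f A) (f ` X)"
proof
  fix z assume "z \<in> f ` generated A X"
  then obtain x where "x \<in> generated A X" "z = f x" by blast
  from this(1) have "f x \<in> generated (transport f A) (f ` X)"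
  proof induction
    case (base x)
    then show ?case by (auto intro: generated.base)
  next
    case (plus x y)
    then show ?case
      using generated_subset[OF assms(1,3)] generated.plus[OF plus.IH]
      by (metis assms(2) subsetD transport_sel(2))
  next
    case (times x y)
    then show ?case
      using generated_subset[OF assms(1,3)] generated.times[OF times.IH]
      by (metis assms(2) subsetD transport_sel(3))
  qed
  with \<open>z = f x\<close> show "z \<in> generated (transport f A) (f ` X)" by simp
qed

lemma models_transport:
  assumes "A \<in> models \<Sigma>" "inj_on f (carrier A)"
  shows "transport f A \<in> models \<Sigma>"
  using assms by (auto simp: models_def binalgebra_transport satisfies_transport)

lemma locally_finite_nat:
  assumes "locally_finite (models \<Sigma> :: nat binalg set)"
  shows "locally_finite (models \<Sigma> :: 'b binalg set)"
  unfolding locally_finite_def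
proof (intro ballI impI)
  fix A :: "'b binalg" assume A: "A \<in> models \<Sigma>" and "finitely_generated A"
  then obtain X where X: "finite X" "X \<subseteq> carrier A" "generated A X = carrier A"
    by (auto simp: finitely_generated_def)
  from A have alg: "binalgebra A" by (simp add: models_def)
  obtain f :: "'b \<Rightarrow> nat" where f: "inj_on f (carrier A)"
    using countable_generated[OF countable_finite[OF X(1)], of A] X(3) by (auto simp: countable_def)
  have "generated (transport f A) (f ` X) = carrier (transport f A)"
  proof
    show "generated (transport f A) (f ` X) \<subseteq> carrier (transport f A)"
      using X by (intro generated_subset binalgebra_transport alg f) (auto simp: transport_sel)
    show "carrier (transport f A) \<subseteq> generated (transport f A) (f ` X)"
      using generated_transport[OF alg f X(2)] X(3) by (simp add: transport_sel)
  qed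
  then have "finitely_generated (transport f A)"
    using X by (auto simp: finitely_generated_def transport_sel intro!: exI[of _ "f ` X"])
  then have "finite (f ` carrier A)"
    using assms models_transport[OF A f] by (force simp: locally_finite_def transport_sel)
  then show "finite (carrier A)" using f by (simp add: finite_image_iff)
qed

lemma models_subset_nat:
  assumes "(models \<Sigma> :: nat binalg set) \<subseteq> models \<Delta>"
  shows "(models \<Sigma> :: 'b binalg set) \<subseteq> models \<Delta>"
proof
  fix A :: "'b binalg" assume A: "A \<in> models \<Sigma>"
  then have alg: "binalgebra A" by (simp add: models_def)
  have "satisfies A e" if e: "e \<in> \<Delta>" for e
    unfolding satisfies_def
  proof (intro allI impI)
    fix \<rho> :: "nat \<Rightarrow> 'b" assume r: "range \<rho> \<subseteq> carrier A"
    define B where "B = A\<lparr>carrier := generated A (range \<rho>)\<rparr>"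
    have cB: "carrier B = generated A (range \<rho>)" by (simp add: B_def)
    have ev: "eval B \<sigma> t = eval A \<sigma> t" for \<sigma> t
      by (induction t) (simp_all add: B_def)
    have "binalgebra B"
      by (auto simp: binalgebra_def B_def intro: generated.intros)
    moreover have "satisfies B d" if "satisfies A d" for d
      using that generated_subset[OF alg r] unfolding satisfies_def ev cB by blast
    ultimately have B: "B \<in> models \<Sigma>" using A by (simp add: models_def)
    have "countable (carrier B)" using countable_generated[of "range \<rho>"] by (simp add: cB)
    then obtain f :: "'b \<Rightarrow> nat" where f: "inj_on f (carrier B)" by (auto simp: countable_def)
    from models_transport[OF B f] assms have "transport f B \<in> models \<Delta>" by blast
    then have "satisfies B e"
      using satisfies_transport[OF \<open>binalgebra B\<close> f] e by (simp add: models_def)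
    moreover have "range \<rho> \<subseteq> carrier B" by (auto simp: cB intro: generated.base)
    ultimately show "eval A \<rho> (fst e) = eval A \<rho> (snd e)"
      by (simp add: satisfies_def ev)
  qed
  with alg show "A \<in> models \<Delta>" by (simp add: models_def)
qed


section \<open>Ai-semirings\<close>

locale ai_semiring =
  fixes S :: "'a binalg" (structure)
  assumes algebra: "binalgebra S"
    and plus_assoc: "\<lbrakk>x \<in> carrier S; y \<in> carrier S; z \<in> carrier S\<rbrakk> \<Longrightarrow>
      (x \<boxplus> y) \<boxplus> z = x \<boxplus> (y \<boxplus> z)"
    and plus_comm: "\<lbrakk>x \<in> carrier S; y \<in> carrier S\<rbrakk> \<Longrightarrow> x \<boxplus> y = y \<boxplus> x"
    and plus_idem: "x \<in> carrier S \<Longrightarrow> x \<boxplus> x = x"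
    and times_assoc: "\<lbrakk>x \<in> carrier S; y \<in> carrier S; z \<in> carrier S\<rbrakk> \<Longrightarrow>
      (x \<boxdot> y) \<boxdot> z = x \<boxdot> (y \<boxdot> z)"
    and distrib_right: "\<lbrakk>x \<in> carrier S; y \<in> carrier S; z \<in> carrier S\<rbrakk> \<Longrightarrow>
      (x \<boxplus> y) \<boxdot> z = (x \<boxdot> z) \<boxplus> (y \<boxdot> z)"
    and distrib_left: "\<lbrakk>x \<in> carrier S; y \<in> carrier S; z \<in> carrier S\<rbrakk> \<Longrightarrow>
      x \<boxdot> (y \<boxplus> z) = (x \<boxdot> y) \<boxplus> (x \<boxdot> z)"

definition additive_order :: "'a binalg \<Rightarrow> 'a gorder" where
  "additive_order S = \<lparr> carrier = carrier S, eq = (=), le = (\<lambda>a b. a \<boxplus>\<^bsub>S\<^esub> b = b) \<rparr>"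

text \<open>The sum of all elements of a finite ai-semiring. As there is no zero, the fold starts from
  some element of the carrier, which idempotency absorbs.\<close>

definition total_sum :: "'a binalg \<Rightarrow> 'a" where
  "total_sum S = Finite_Set.fold (splus S) (SOME s. s \<in> carrier S) (carrier S)"

definition mult_identity :: "'a binalg \<Rightarrow> 'a \<Rightarrow> bool" where
  "mult_identity S e \<longleftrightarrow>
     e \<in> carrier S \<and> (\<forall>x\<in>carrier S. e \<boxdot>\<^bsub>S\<^esub> x = x \<and> x \<boxdot>\<^bsub>S\<^esub> e = x)"

definition mult_subgroup :: "'a binalg \<Rightarrow> 'a set \<Rightarrow> bool" where
  "mult_subgroup S G \<longleftrightarrow> G \<subseteq> carrier S \<and>
     (\<exists>e. group \<lparr> carrier = G, monoid.mult = stimes S, one = e \<rparr>)"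


section \<open>Chains and antichains\<close>

definition order_chain :: "'a gorder \<Rightarrow> 'a set \<Rightarrow> bool" where
  "order_chain L C \<longleftrightarrow> C \<subseteq> carrier L \<and> (\<forall>x\<in>C. \<forall>y\<in>C. x \<sqsubseteq>\<^bsub>L\<^esub> y \<or> y \<sqsubseteq>\<^bsub>L\<^esub> x)"

definition order_antichain :: "'a gorder \<Rightarrow> 'a set \<Rightarrow> bool" where
  "order_antichain L C \<longleftrightarrow> C \<subseteq> carrier L \<and> (\<forall>x\<in>C. \<forall>y\<in>C. x \<sqsubseteq>\<^bsub>L\<^esub> y \<longrightarrow> x = y)"

text \<open>Meaningful for finite carriers only.\<close>

definition height :: "'a gorder \<Rightarrow> nat" where
  "height L = Max {card C | C. order_chain L C}"

definition width :: "'a gorder \<Rightarrow> nat" where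
  "width L = Max {card C | C. order_antichain L C}"

end

theory Submission
  imports Defs "HOL-Algebra.Generated_Groups"
begin

text \<open>A finitely generated ai-semiring is finite as soon as its generators generate a finite
  multiplicative semigroup. If they do not, then by compactness there is an infinite, uniformly
  recurrent language of geodesic words, and it contains instances of the nested patterns
  \<open>Y\<^sub>n\<^sub>+\<^sub>1 = Y\<^sub>n b\<^sub>n Y\<^sub>n c\<^sub>n Y\<^sub>n\<close> over any of its words \<open>Y\<^sub>0\<close>. So it suffices to find finitely many semigroup
  identities of \<open>S\<close> that are incompatible with such a language.

  If the additive order is a chain, or has a multiplicative identity as an extreme element, then \<open>S\<close>
  satisfies an identity that shortens \<open>Y\<^sub>n\<close>: deleting a factor between two occurrences of the
  same letter in the middle of \<open>Y\<^sub>n\<close> does not change its value.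

  If the height is at most two, then \<open>x + y = \<top>\<close> for \<open>x \<noteq> y\<close>, so a translation that is not constant is
  cancellative off \<open>\<top>\<close>. Inside a nested pattern the words leading from one occurrence of a letter to
  another act as elements of a multiplicative subgroup, and finitely many identities say
  so, together with the laws of the groups of order at most \<open>|S|\<close> that are needed. Hence the return words to a letter
  of the language generate a group of finite exponent that satisfies the chief centralizer
  law. Such a group is finite: in an infinite one, the law fails modulo a maximal
  normal subgroup of infinite index. This bounds the lengths of the geodesics.\<close>

section \<open>Groups of finite exponent satisfying a chief centralizer law\<close>

text \<open>The signature has no constant, so a variable of an identity can only stand for a
  nonempty word. This is behind powers with exponent \<open>n + 1\<close>, the letters kept on both
  sides of a pattern and the trivial but nonempty factors inserted into words. The identities also
  have to hold in \<open>S\<close> under every assignment, whereas in the flat case only letters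
  that act cancellatively are under control; a frame \<open>C\<close> at both ends neutralises the
  other assignments. The depth of a nested pattern is \<open>card (carrier S)\<close> because then
  two of its levels have the same value \<open>A\<close>, and \<open>A = A s A t A\<close> makes
  \<open>A\<close> regular. Two separators per level, instead of the one of Zimin words, leave an
  untouched copy on either side of the middle one, in which the change takes place. Exponent alone
  would not do for the group of return words: infinite finitely generated groups of finite exponent
  exist. The chief centralizer law is one explicit law that closes this gap, so neither a finite
  basis for the laws of a finite group nor the restricted Burnside problem enters.\<close>

definition finite_index :: "('a,'b) monoid_scheme \<Rightarrow> 'a set \<Rightarrow> bool" where
  "finite_index G H \<longleftrightarrow> (\<exists>T. finite T \<and> T \<subseteq> carrier G \<and>
     (\<forall>g\<in>carrier G. \<exists>t\<in>T. g \<otimes>\<^bsub>G\<^esub> inv\<^bsub>G\<^esub> t \<in> H))"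

definition commutator :: "('a,'b) monoid_scheme \<Rightarrow> 'a \<Rightarrow> 'a \<Rightarrow> 'a" where
  "commutator G g c = g \<otimes>\<^bsub>G\<^esub> c \<otimes>\<^bsub>G\<^esub> inv\<^bsub>G\<^esub> g \<otimes>\<^bsub>G\<^esub> inv\<^bsub>G\<^esub> c"

definition centralizer_mod :: "('a,'b) monoid_scheme \<Rightarrow> 'a set \<Rightarrow> 'a set \<Rightarrow> 'a set" where
  "centralizer_mod G N D = {g \<in> carrier G. \<forall>c\<in>D. commutator G g c \<in> N}"

definition conjugates :: "('a,'b) monoid_scheme \<Rightarrow> 'a \<Rightarrow> 'a set" where
  "conjugates G d = (\<lambda>y. y \<otimes>\<^bsub>G\<^esub> d \<otimes>\<^bsub>G\<^esub> inv\<^bsub>G\<^esub> y) ` carrier G"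

text \<open>Words are written for an arbitrary binary operation \<open>f\<close>, so that the same definition serves for terms, lists,
  semirings and groups. There is no neutral element: \<open>spow f x n\<close> is the power with exponent \<open>n + 1\<close>.
  The words below are meant for groups whose exponent divides \<open>e + 2\<close>, where \<open>spow f x e\<close> is the
  inverse of \<open>x\<close>.\<close>

primrec spow :: "('a \<Rightarrow> 'a \<Rightarrow> 'a) \<Rightarrow> 'a \<Rightarrow> nat \<Rightarrow> 'a" where
  "spow f x 0 = x"
| "spow f x (Suc n) = f (spow f x n) x"

definition conj_word :: "('a \<Rightarrow> 'a \<Rightarrow> 'a) \<Rightarrow> nat \<Rightarrow> 'a \<Rightarrow> 'a \<Rightarrow> 'a" where
  "conj_word f e y d = f (f y d) (spow f y e)"

definition comm_word :: "('a \<Rightarrow> 'a \<Rightarrow> 'a) \<Rightarrow> nat \<Rightarrow> 'a \<Rightarrow> 'a \<Rightarrow> 'a" where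
  "comm_word f e g c = f (f (f g c) (spow f g e)) (spow f c e)"

primrec iterated_comm :: "('a \<Rightarrow> 'a \<Rightarrow> 'a) \<Rightarrow> nat \<Rightarrow> 'a \<Rightarrow> 'a list \<Rightarrow> 'a" where
  "iterated_comm f e g [] = g"
| "iterated_comm f e g (c # cs) = iterated_comm f e (comm_word f e g c) cs"

definition pairs :: "nat \<Rightarrow> (nat \<times> nat) list" where
  "pairs n = [(i, j). j \<leftarrow> [0..<Suc n], i \<leftarrow> [0..<j]]"

definition quotients :: "('a \<Rightarrow> 'a \<Rightarrow> 'a) \<Rightarrow> nat \<Rightarrow> (nat \<Rightarrow> 'a) \<Rightarrow> nat \<Rightarrow> 'a list" where
  "quotients f e X n = map (\<lambda>(i, j). f (X j) (spow f (X i) e)) (pairs n)"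

text \<open>The chief centralizer law of Kovacs and Newman: an iterated commutator of conjugates of all
  quotients of \<open>X\<^sub>0, \<dots>, X\<^sub>n\<close>. In a group of order at most \<open>n\<close> one of the quotients is trivial.\<close>

definition chief_word :: "('a \<Rightarrow> 'a \<Rightarrow> 'a) \<Rightarrow> nat \<Rightarrow> nat \<Rightarrow> (nat \<Rightarrow> 'a) \<Rightarrow> (nat \<Rightarrow> 'a) \<Rightarrow> 'a" where
  "chief_word f e n X Y = iterated_comm f e (hd (quotients f e X n))
     (map (\<lambda>(k, c). conj_word f e (Y k) c) (List.enumerate 0 (tl (quotients f e X n))))"

section \<open>Centralizers modulo a normal subgroup, finite index, and the chief centralizer
  law\<close>

context group
begin

lemma inv_cancel [simp]:
  "x \<in> carrier G \<Longrightarrow> y \<in> carrier G \<Longrightarrow> x \<otimes> (inv x \<otimes> y) = y"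
  "x \<in> carrier G \<Longrightarrow> y \<in> carrier G \<Longrightarrow> inv x \<otimes> (x \<otimes> y) = y"
  by (simp_all flip: m_assoc)

lemma commutator_closed [simp]:
  "g \<in> carrier G \<Longrightarrow> c \<in> carrier G \<Longrightarrow> commutator G g c \<in> carrier G"
  by (simp add: commutator_def)

lemma normal_conj: "N \<lhd> G \<Longrightarrow> x \<in> carrier G \<Longrightarrow> h \<in> N \<Longrightarrow> x \<otimes> h \<otimes> inv x \<in> N"
  by (simp add: normal_inv_iff)

lemma normal_conj': "N \<lhd> G \<Longrightarrow> x \<in> carrier G \<Longrightarrow> h \<in> N \<Longrightarrow> inv x \<otimes> h \<otimes> x \<in> N"
  using normal_conj[of N "inv x" h] by simp

lemma normal_sub: "N \<lhd> G \<Longrightarrow> subgroup N G"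
  by (simp add: normal_inv_iff)

lemma commutator_sym:
  assumes "subgroup N G" "g \<in> carrier G" "c \<in> carrier G" "commutator G g c \<in> N"
  shows "commutator G c g \<in> N"
proof -
  have "inv (commutator G g c) = commutator G c g"
    using assms by (simp add: commutator_def inv_mult_group m_assoc)
  then show ?thesis using assms subgroup.m_inv_closed by metis
qed

text \<open>With [g, c] for the commutator, the closure properties come from [gh, c] = g [h, c] g^-1
  [g, c], from [g^-1, c] = g^-1 [c, g] g and from [z g z^-1, c] = z [g, z^-1 c z] z^-1.\<close>

lemma normal_centralizer_mod:
  assumes N: "N \<lhd> G" and D: "D \<subseteq> carrier G"
    and conj: "\<And>x c. x \<in> carrier G \<Longrightarrow> c \<in> D \<Longrightarrow> x \<otimes> c \<otimes> inv x \<in> D"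
  shows "centralizer_mod G N D \<lhd> G"
  unfolding normal_inv_iff
proof (intro conjI subgroupI ballI)
  note sN = normal_sub[OF N]
  show "centralizer_mod G N D \<subseteq> carrier G" by (auto simp: centralizer_mod_def)
  have "commutator G \<one> c = \<one>" if "c \<in> D" for c
    using that D by (auto simp: commutator_def)
  then have "\<one> \<in> centralizer_mod G N D"
    using subgroup.one_closed[OF sN] by (auto simp: centralizer_mod_def)
  then show "centralizer_mod G N D \<noteq> {}" by blast
  fix g assume "g \<in> centralizer_mod G N D"
  then have g: "g \<in> carrier G" "\<And>c. c \<in> D \<Longrightarrow> commutator G g c \<in> N"
    by (auto simp: centralizer_mod_def)
  have "commutator G (inv g) c \<in> N" if c: "c \<in> D" for c
  proof -
    have cG: "c \<in> carrier G" using c D by blast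
    have "commutator G (inv g) c = inv g \<otimes> commutator G c g \<otimes> g"
      using g(1) cG by (simp add: commutator_def m_assoc)
    then show ?thesis
      using normal_conj'[OF N g(1)] commutator_sym[OF sN g(1) cG g(2)[OF c]] by simp
  qed
  then show "inv g \<in> centralizer_mod G N D" using g by (simp add: centralizer_mod_def)
  show "g \<otimes> h \<in> centralizer_mod G N D" if "h \<in> centralizer_mod G N D" for h
  proof -
    from that have h: "h \<in> carrier G" "\<And>c. c \<in> D \<Longrightarrow> commutator G h c \<in> N"
      by (auto simp: centralizer_mod_def)
    have "commutator G (g \<otimes> h) c \<in> N" if c: "c \<in> D" for c
    proof -
      have cG: "c \<in> carrier G" using c D by blast
      have "commutator G (g \<otimes> h) c = (g \<otimes> commutator G h c \<otimes> inv g) \<otimes> commutator G g c"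
        using g(1) h(1) cG by (simp add: commutator_def m_assoc inv_mult_group)
      then show ?thesis
        using normal_conj[OF N g(1) h(2)[OF c]] g(2)[OF c] subgroup.m_closed[OF sN] by simp
    qed
    then show ?thesis using g h by (simp add: centralizer_mod_def)
  qed
  fix z assume z: "z \<in> carrier G"
  have "commutator G (z \<otimes> g \<otimes> inv z) c \<in> N" if c: "c \<in> D" for c
  proof -
    have cG: "c \<in> carrier G" using c D by blast
    have c': "inv z \<otimes> c \<otimes> z \<in> D" using conj[of "inv z" c] z c by simp
    have "commutator G (z \<otimes> g \<otimes> inv z) c = z \<otimes> commutator G g (inv z \<otimes> c \<otimes> z) \<otimes> inv z"
      using g(1) z cG by (simp add: commutator_def m_assoc inv_mult_group)
    then show ?thesis using normal_conj[OF N z g(2)[OF c']] by simp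
  qed
  then show "z \<otimes> g \<otimes> inv z \<in> centralizer_mod G N D" using g z by (simp add: centralizer_mod_def)
qed

lemma subset_centralizer_mod:
  assumes N: "N \<lhd> G" and D: "D \<subseteq> carrier G"
  shows "N \<subseteq> centralizer_mod G N D"
proof
  fix g assume g: "g \<in> N"
  note sN = normal_sub[OF N]
  have gG: "g \<in> carrier G" using g sN subgroup.mem_carrier by metis
  have "commutator G g c \<in> N" if c: "c \<in> D" for c
  proof -
    have cG: "c \<in> carrier G" using c D by blast
    have "commutator G g c = g \<otimes> (c \<otimes> inv g \<otimes> inv c)"
      using gG cG by (simp add: commutator_def m_assoc)
    then show ?thesis
      using normal_conj[OF N cG] g subgroup.m_inv_closed[OF sN g] subgroup.m_closed[OF sN] by simp
  qed
  then show "g \<in> centralizer_mod G N D" using gG by (simp add: centralizer_mod_def)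
qed

lemma conjugates_subset: "d \<in> carrier G \<Longrightarrow> conjugates G d \<subseteq> carrier G"
  by (auto simp: conjugates_def)

lemma conjugates_conj:
  assumes "d \<in> carrier G" "x \<in> carrier G" "c \<in> conjugates G d"
  shows "x \<otimes> c \<otimes> inv x \<in> conjugates G d"
proof -
  from assms(3) obtain y where y: "y \<in> carrier G" "c = y \<otimes> d \<otimes> inv y"
    by (auto simp: conjugates_def)
  have "x \<otimes> c \<otimes> inv x = (x \<otimes> y) \<otimes> d \<otimes> inv (x \<otimes> y)"
    using assms y by (simp add: m_assoc inv_mult_group)
  then show ?thesis using assms y by (auto simp: conjugates_def)
qed

text \<open>A nonempty intersection of right cosets \<open>H s\<close> and \<open>K t\<close> is a
  coset of \<open>H \<inter> K\<close>, represented by any of its elements; \<open>U\<close> picks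
  one for each such pair.\<close>

lemma finite_index_Int:
  assumes H: "subgroup H G" "finite_index G H" and K: "subgroup K G" "finite_index G K"
  shows "finite_index G (H \<inter> K)"
proof -
  from H obtain S where S: "finite S" "S \<subseteq> carrier G"
    "\<And>g. g \<in> carrier G \<Longrightarrow> \<exists>t\<in>S. g \<otimes> inv t \<in> H" by (auto simp: finite_index_def)
  from K obtain T where T: "finite T" "T \<subseteq> carrier G"
    "\<And>g. g \<in> carrier G \<Longrightarrow> \<exists>t\<in>T. g \<otimes> inv t \<in> K" by (auto simp: finite_index_def)
  define Q where "Q s t g \<longleftrightarrow> g \<in> carrier G \<and> g \<otimes> inv s \<in> H \<and> g \<otimes> inv t \<in> K" for s t g
  define U where "U = (\<lambda>(s,t). SOME g. Q s t g) ` {(s,t). s \<in> S \<and> t \<in> T \<and> (\<exists>g. Q s t g)}"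
  have fin: "finite U"
  proof -
    have "finite {(s,t). s \<in> S \<and> t \<in> T \<and> (\<exists>g. Q s t g)}"
      by (rule finite_subset[of _ "S \<times> T"]) (use S T in auto)
    then show ?thesis by (simp add: U_def)
  qed
  have sub: "U \<subseteq> carrier G"
  proof
    fix u assume "u \<in> U"
    then obtain s t where "u = (SOME g. Q s t g)" "\<exists>g. Q s t g" by (auto simp: U_def)
    then have "Q s t u" by (metis someI_ex)
    then show "u \<in> carrier G" by (simp add: Q_def)
  qed
  have "\<exists>u\<in>U. g \<otimes> inv u \<in> H \<inter> K" if g: "g \<in> carrier G" for g
  proof -
    from S(3)[OF g] T(3)[OF g] obtain s t where st: "s \<in> S" "t \<in> T" "Q s t g"
      using g by (auto simp: Q_def)
    define u where "u = (SOME g. Q s t g)"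
    have u: "Q s t u" using st(3) unfolding u_def by (rule someI)
    have *: "g \<otimes> inv u = (g \<otimes> inv r) \<otimes> inv (u \<otimes> inv r)" if "r \<in> carrier G" for r
      using that g u by (simp add: Q_def inv_mult_group m_assoc)
    have "g \<otimes> inv u \<in> H" using *[of s] st u S(2)
        subgroup.m_closed[OF H(1), OF _ subgroup.m_inv_closed[OF H(1)]] by (auto simp: Q_def)
    moreover have "g \<otimes> inv u \<in> K" using *[of t] st u T(2)
        subgroup.m_closed[OF K(1), OF _ subgroup.m_inv_closed[OF K(1)]] by (auto simp: Q_def)
    moreover have "u \<in> U" using st by (auto simp: U_def u_def intro!: image_eqI[of _ _ "(s,t)"])
    ultimately show ?thesis by blast
  qed
  then show ?thesis using fin sub by (auto simp: finite_index_def)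
qed

text \<open>Schreier's lemma. The representatives that lie in \<open>H\<close> are added to the
  Schreier generators, since a coset may have several representatives.\<close>

lemma finite_index_finitely_generated:
  assumes S: "finite S" "S \<subseteq> carrier G" "generate G S = carrier G"
    and H: "subgroup H G" "finite_index G H"
  shows "\<exists>Y. finite Y \<and> Y \<subseteq> H \<and> generate G Y = H"
proof -
  from H obtain T0 where T0: "finite T0" "T0 \<subseteq> carrier G"
    "\<And>g. g \<in> carrier G \<Longrightarrow> \<exists>t\<in>T0. g \<otimes> inv t \<in> H" by (auto simp: finite_index_def)
  define T where "T = insert \<one> T0"
  have T: "finite T" "T \<subseteq> carrier G" "\<one> \<in> T"
    "\<And>g. g \<in> carrier G \<Longrightarrow> \<exists>t\<in>T. g \<otimes> inv t \<in> H" using T0 by (auto simp: T_def)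
  define Y where "Y = H \<inter> (T \<union> (\<lambda>(t,s,t'). t \<otimes> s \<otimes> inv t') ` (T \<times> (S \<union> (\<lambda>s. inv s) ` S) \<times> T))"
  have finY: "finite Y" and YH: "Y \<subseteq> H" using S T by (auto simp: Y_def)
  have HG: "H \<subseteq> carrier G" using H subgroup.subset by auto
  have YG: "Y \<subseteq> carrier G" using YH HG by blast
  \<comment> \<open>\<open>B\<close> is the union of the cosets of \<open>generate G Y\<close> with
    representatives in \<open>T\<close>. It contains the identity and is closed under right
    multiplication by generators and their inverses, hence it is all of \<open>G\<close>.\<close>
  define B where "B = {h \<in> carrier G. \<exists>t\<in>T. h \<otimes> inv t \<in> generate G Y}"
  have step: "h \<otimes> s \<in> B" if h: "h \<in> B" and s: "s \<in> S \<union> (\<lambda>s. inv s) ` S" for h s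
  proof -
    from h obtain t where t: "h \<in> carrier G" "t \<in> T" "h \<otimes> inv t \<in> generate G Y"
      by (auto simp: B_def)
    have sG: "s \<in> carrier G" using s S by auto
    have tG: "t \<in> carrier G" using t T by auto
    obtain t' where t': "t' \<in> T" "t \<otimes> s \<otimes> inv t' \<in> H" using T(4)[of "t \<otimes> s"] tG sG by auto
    have t'G: "t' \<in> carrier G" using t' T by auto
    have "t \<otimes> s \<otimes> inv t' \<in> Y" using t' t s unfolding Y_def
      by (auto intro!: image_eqI[of _ _ "(t,s,t')"])
    then have "(h \<otimes> inv t) \<otimes> (t \<otimes> s \<otimes> inv t') \<in> generate G Y"
      using t(3) by (blast intro: generate.eng generate.incl)
    also have "(h \<otimes> inv t) \<otimes> (t \<otimes> s \<otimes> inv t') = h \<otimes> s \<otimes> inv t'"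
      using t(1) tG sG t'G by (simp add: m_assoc)
    finally show ?thesis using t' t(1) sG by (auto simp: B_def)
  qed
  have "g \<in> generate G S \<Longrightarrow> \<forall>h\<in>B. h \<otimes> g \<in> B" for g
  proof (induction rule: generate.induct)
    case one then show ?case by (auto simp: B_def)
  next
    case (incl h) then show ?case using step by blast
  next
    case (inv h) then show ?case using step by blast
  next
    case (eng h1 h2)
    have "h1 \<in> carrier G" "h2 \<in> carrier G" using eng(1,2) S by auto
    then show ?case using eng by (auto simp: B_def simp flip: m_assoc)
  qed
  moreover have "\<one> \<in> B" using T(3) generate.one[of G Y] by (auto simp: B_def intro!: bexI[of _ \<one>])
  ultimately have all: "g \<in> B" if "g \<in> carrier G" for g using that S(3)
    by (metis l_one)
  have "H \<subseteq> generate G Y"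
  proof
    fix h assume h: "h \<in> H"
    then obtain t where t: "t \<in> T" "h \<otimes> inv t \<in> generate G Y" using all HG by (auto simp: B_def)
    have tG: "t \<in> carrier G" using t T by auto
    have hG: "h \<in> carrier G" using h HG by auto
    have "h \<otimes> inv t \<in> H"
      using t(2) generate_subgroup_incl[OF YH H(1)] by blast
    then have "inv h \<otimes> (h \<otimes> inv t) \<in> H" using h H(1)
      by (meson subgroup.m_closed subgroup.m_inv_closed)
    then have "inv t \<in> H" using hG tG by simp
    then have "t \<in> H" using H(1) tG by (metis inv_inv subgroup.m_inv_closed)
    then have "t \<in> generate G Y" using t by (auto simp: Y_def intro: generate.incl)
    with t(2) have "(h \<otimes> inv t) \<otimes> t \<in> generate G Y" by (rule generate.eng)
    then show "h \<in> generate G Y" using hG tG by (simp add: m_assoc)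
  qed
  then show ?thesis using finY YH generate_subgroup_incl[OF YH H(1)] by blast
qed


lemma spow_eq_pow: "x \<in> carrier G \<Longrightarrow> spow (\<otimes>) x n = x [^] Suc n"
  by (induction n) auto

lemma spow_eq_inv:
  assumes "x \<in> carrier G" "spow (\<otimes>) x (Suc e) = \<one>"
  shows "spow (\<otimes>) x e = inv x"
  using assms by (intro inv_equality[symmetric]) (auto simp: spow_eq_pow)

text \<open>Modulo \<open>N\<close> the subgroup \<open>H\<close> is abelian, finitely generated by
  Schreier's lemma and of finite exponent, hence finite. Since \<open>N\<close> may fail to lie in
  \<open>H\<close>, cosets are replaced by the congruence \<open>\<approx>\<close> on the whole
  group.\<close>

lemma finite_index_abelian_mod:
  assumes S: "finite S" "S \<subseteq> carrier G" "generate G S = carrier G"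
    and ex: "\<And>x. x \<in> carrier G \<Longrightarrow> spow (\<otimes>) x (Suc e) = \<one>"
    and N: "N \<lhd> G" and H: "subgroup H G" "finite_index G H"
    and comm: "\<And>a b. a \<in> H \<Longrightarrow> b \<in> H \<Longrightarrow> commutator G a b \<in> N"
  shows "finite_index G N"
proof -
  note sN = normal_sub[OF N]
  have HG: "H \<subseteq> carrier G" using H subgroup.subset by auto
  define eqN (infix "\<approx>" 50) where "a \<approx> b \<longleftrightarrow> a \<otimes> inv b \<in> N" for a b
  have refl: "a \<approx> a" if "a \<in> carrier G" for a
    using that subgroup.one_closed[OF sN] by (simp add: eqN_def)
  have trans: "a \<approx> c" if "a \<in> carrier G" "b \<in> carrier G" "c \<in> carrier G" "a \<approx> b" "b \<approx> c" for a b c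
  proof -
    have "a \<otimes> inv c = (a \<otimes> inv b) \<otimes> (b \<otimes> inv c)" using that by (simp add: m_assoc)
    then show ?thesis using that subgroup.m_closed[OF sN] by (simp add: eqN_def)
  qed
  have mult: "a \<otimes> b \<approx> c \<otimes> d"
    if "a \<in> carrier G" "b \<in> carrier G" "c \<in> carrier G" "d \<in> carrier G" "a \<approx> c" "b \<approx> d" for a b c d
  proof -
    have "(a \<otimes> b) \<otimes> inv (c \<otimes> d) = (a \<otimes> (b \<otimes> inv d) \<otimes> inv a) \<otimes> (a \<otimes> inv c)"
      using that by (simp add: m_assoc inv_mult_group)
    then show ?thesis using that subgroup.m_closed[OF sN] normal_conj[OF N] by (simp add: eqN_def)
  qed
  have swap: "a \<otimes> b \<approx> b \<otimes> a" if "a \<in> H" "b \<in> H" for a b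
  proof -
    have "(a \<otimes> b) \<otimes> inv (b \<otimes> a) = commutator G a b"
      using that HG by (simp add: commutator_def inv_mult_group m_assoc subset_iff)
    then show ?thesis using comm that by (simp add: eqN_def)
  qed
  \<comment> \<open>Induction over the generators: modulo \<open>N\<close> a new generator
    \<open>y\<close> can be collected on the right, so it multiplies the number of classes by at
    most \<open>e + 2\<close>.\<close>
  have "\<exists>T. finite T \<and> T \<subseteq> H \<and> (\<forall>h\<in>generate G Y. \<exists>t\<in>T. h \<approx> t)" if "finite Y" "Y \<subseteq> H" for Y
    using that
  proof (induction Y rule: finite_induct)
    case empty
    then show ?case using refl subgroup.one_closed[OF H(1)]
      by (intro exI[of _ "{\<one>}"]) (auto simp: generate_empty)
  next
    case (insert y Y)
    then obtain T where T: "finite T" "T \<subseteq> H" "\<And>h. h \<in> generate G Y \<Longrightarrow> \<exists>t\<in>T. h \<approx> t" by auto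
    have y: "y \<in> H" "y \<in> carrier G" and Y: "Y \<subseteq> H" using insert HG by auto
    have genH: "generate G Y \<subseteq> H" using generate_subgroup_incl[OF Y H(1)] .
    have powH: "y [^] i \<in> H" for i :: nat
      by (induction i) (use y H(1) in \<open>auto intro: subgroup.m_closed subgroup.one_closed\<close>)
    have gen: "h \<in> H \<and> (\<exists>k\<in>generate G Y. \<exists>i::nat. h \<approx> k \<otimes> y [^] i)" if "h \<in> generate G (insert y Y)" for h
      using that
    proof (induction rule: generate.induct)
      case one
      then show ?case using refl[of \<one>] subgroup.one_closed[OF H(1)]
        by (intro conjI bexI[of _ \<one>] exI[of _ 0]) (auto intro: generate.one)
    next
      case (incl h)
      show ?case
      proof (cases "h = y")
        case True
        then show ?thesis using y refl[of y]
          by (intro conjI bexI[of _ \<one>] exI[of _ 1]) (auto intro: generate.one)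
      next
        case False
        then have "h \<in> Y" using incl by auto
        then show ?thesis using Y HG refl[of h]
          by (intro conjI bexI[of _ h] exI[of _ 0]) (auto intro: generate.incl)
      qed
    next
      case (inv h)
      show ?case
      proof (cases "h = y")
        case True
        \<comment> \<open>Inverses are positive powers, so natural exponents of \<open>y\<close>
          suffice.\<close>
        have iy: "inv y = y [^] Suc e" using spow_eq_inv[OF y(2) ex] spow_eq_pow y by metis
        then have "inv y \<in> H" using powH by metis
        moreover have "inv y \<approx> \<one> \<otimes> y [^] Suc e" using refl[of "inv y"] y by (simp add: iy del: nat_pow_Suc)
        ultimately show ?thesis using True generate.one by (intro conjI bexI[of _ \<one>] exI[of _ "Suc e"]) auto
      next
        case False
        then have "h \<in> Y" using inv by auto
        then show ?thesis using Y HG refl[of "inv h"] H(1)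
          by (intro conjI bexI[of _ "inv h"] exI[of _ 0]) (auto intro: generate.inv subgroup.m_inv_closed)
      qed
    next
      case (eng h1 h2)
      from eng.IH(1) obtain k1 i where k1: "k1 \<in> generate G Y" "h1 \<approx> k1 \<otimes> y [^] (i::nat)" "h1 \<in> H"
        by (elim conjE bexE exE)
      from eng.IH(2) obtain k2 j where k2: "k2 \<in> generate G Y" "h2 \<approx> k2 \<otimes> y [^] (j::nat)" "h2 \<in> H"
        by (elim conjE bexE exE)
      note k = k1 k2
      have kH: "k1 \<in> H" "k2 \<in> H" using k genH by auto
      have c: "k1 \<in> carrier G" "k2 \<in> carrier G" "h1 \<in> carrier G" "h2 \<in> carrier G"
        using kH k HG by auto
      have "h1 \<otimes> h2 \<approx> (k1 \<otimes> y [^] i) \<otimes> (k2 \<otimes> y [^] j)"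
        using k c y by (intro mult) auto
      also have "(k1 \<otimes> y [^] i) \<otimes> (k2 \<otimes> y [^] j) = k1 \<otimes> ((y [^] i \<otimes> k2) \<otimes> y [^] j)"
        using c y by (simp add: m_assoc)
      finally have 1: "h1 \<otimes> h2 \<approx> k1 \<otimes> ((y [^] i \<otimes> k2) \<otimes> y [^] j)" .
      have "k1 \<otimes> ((y [^] i \<otimes> k2) \<otimes> y [^] j) \<approx> k1 \<otimes> ((k2 \<otimes> y [^] i) \<otimes> y [^] j)"
        using c y kH powH by (intro mult refl swap) auto
      also have "k1 \<otimes> ((k2 \<otimes> y [^] i) \<otimes> y [^] j) = (k1 \<otimes> k2) \<otimes> y [^] (i + j)"
        using c y by (simp add: m_assoc nat_pow_mult)
      finally have 2: "k1 \<otimes> ((y [^] i \<otimes> k2) \<otimes> y [^] j) \<approx> (k1 \<otimes> k2) \<otimes> y [^] (i + j)" .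
      have "h1 \<otimes> h2 \<approx> (k1 \<otimes> k2) \<otimes> y [^] (i + j)"
        using trans[OF _ _ _ 1 2] c y by simp
      moreover have "h1 \<otimes> h2 \<in> H" using k H(1) by (simp add: subgroup.m_closed)
      ultimately show ?case using generate.eng[OF k1(1) k2(1)]
        by (intro conjI bexI[of _ "k1 \<otimes> k2"] exI[of _ "i + j"])
    qed
    define T' where "T' = (\<lambda>(t,i). t \<otimes> y [^] i) ` (T \<times> {..<Suc (Suc e)})"
    have "\<exists>t\<in>T'. h \<approx> t" if h: "h \<in> generate G (insert y Y)" for h
    proof -
      from gen[OF h] obtain k i where k: "h \<in> H" "k \<in> generate G Y" "h \<approx> k \<otimes> y [^] (i::nat)" by (elim conjE bexE exE)
      obtain t where t: "t \<in> T" "k \<approx> t" using T k by blast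
      have c: "k \<in> carrier G" "t \<in> carrier G" "h \<in> carrier G" using k t T genH HG by auto
      have "y [^] Suc (Suc e) = \<one>" using ex[OF y(2)] spow_eq_pow[OF y(2)] by metis
      then have "y [^] (Suc (Suc e) * (i div Suc (Suc e))) = \<one>"
        using y(2) by (metis nat_pow_pow nat_pow_one)
      then have "y [^] i = y [^] (i mod Suc (Suc e))"
        using y(2) nat_pow_mult[of y "Suc (Suc e) * (i div Suc (Suc e))" "i mod Suc (Suc e)"]
        by (simp del: mult_Suc nat_pow_Suc)
      moreover have "k \<otimes> y [^] i \<approx> t \<otimes> y [^] i" using c t y by (intro mult refl) auto
      ultimately have "h \<approx> t \<otimes> y [^] (i mod Suc (Suc e))"
        using trans[OF c(3) _ _ k(3)] c y by auto
      then show ?thesis using t by (force simp: T'_def)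
    qed
    moreover have "finite T'" "T' \<subseteq> H"
      using T powH H(1) by (auto simp: T'_def intro: subgroup.m_closed)
    ultimately show ?case by blast
  qed
  moreover obtain Y where Y: "finite Y" "Y \<subseteq> H" "generate G Y = H"
    using finite_index_finitely_generated[OF S H] by blast
  ultimately obtain T where T: "finite T" "T \<subseteq> H" "\<And>h. h \<in> H \<Longrightarrow> \<exists>t\<in>T. h \<approx> t" by metis
  from H obtain T0 where T0: "finite T0" "T0 \<subseteq> carrier G"
    "\<And>g. g \<in> carrier G \<Longrightarrow> \<exists>t\<in>T0. g \<otimes> inv t \<in> H" by (auto simp: finite_index_def)
  define U where "U = (\<lambda>(t,s). t \<otimes> s) ` (T \<times> T0)"
  have "\<exists>u\<in>U. g \<otimes> inv u \<in> N" if g: "g \<in> carrier G" for g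
  proof -
    obtain s where s: "s \<in> T0" "g \<otimes> inv s \<in> H" using T0 g by blast
    obtain t where t: "t \<in> T" "(g \<otimes> inv s) \<approx> t" using T s by blast
    have "g \<otimes> inv (t \<otimes> s) = (g \<otimes> inv s) \<otimes> inv t"
      using g s t T T0 HG by (simp add: inv_mult_group m_assoc subset_iff)
    then show ?thesis using s t by (force simp: U_def eqN_def)
  qed
  moreover have "finite U" using T T0 by (simp add: U_def)
  moreover have "U \<subseteq> carrier G" using T(2) T0(2) HG by (auto simp: U_def subset_iff)
  ultimately show ?thesis by (auto simp: finite_index_def)
qed

text \<open>Zorn's lemma. The union of a chain cannot acquire finite index: it would be finitely
  generated by Schreier's lemma, and its generators would already lie in one member of the
  chain.\<close>

lemma maximal_infinite_index:
  assumes S: "finite S" "S \<subseteq> carrier G" "generate G S = carrier G"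
    and inf: "infinite (carrier G)"
  shows "\<exists>N. N \<lhd> G \<and> \<not> finite_index G N \<and> (\<forall>K. K \<lhd> G \<longrightarrow> N \<subset> K \<longrightarrow> finite_index G K)"
proof -
  define F where "F = {N. N \<lhd> G \<and> \<not> finite_index G N}"
  have "\<exists>M\<in>F. \<forall>X\<in>F. M \<subseteq> X \<longrightarrow> X = M"
  proof (rule subset_Zorn_nonempty)
    have "\<not> finite_index G {\<one>}"
    proof
      assume "finite_index G {\<one>}"
      then obtain T where T: "finite T" "T \<subseteq> carrier G" "\<And>g. g \<in> carrier G \<Longrightarrow> \<exists>t\<in>T. g \<otimes> inv t = \<one>"
        by (auto simp: finite_index_def)
      have "carrier G \<subseteq> T"
      proof
        fix g assume g: "g \<in> carrier G"
        then obtain t where t: "t \<in> T" "g \<otimes> inv t = \<one>" using T by blast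
        then have "g = t" using g T(2) by (metis inv_closed inv_equality inv_inv subsetD)
        then show "g \<in> T" using t by simp
      qed
      then show False using T inf finite_subset by blast
    qed
    then show "F \<noteq> {}" using one_is_normal by (auto simp: F_def)
    fix C assume C: "C \<noteq> {}" "subset.chain F C"
    then have CF: "C \<subseteq> F" and tot: "\<And>A B. A \<in> C \<Longrightarrow> B \<in> C \<Longrightarrow> A \<subseteq> B \<or> B \<subseteq> A"
      by (auto simp: subset_chain_def)
    have nor: "N \<lhd> G" if "N \<in> C" for N using that CF by (auto simp: F_def)
    have normal: "\<Union> C \<lhd> G"
      unfolding normal_inv_iff
    proof (intro conjI subgroupI ballI)
      show "\<Union> C \<subseteq> carrier G" using nor normal_sub subgroup.subset by (intro Union_least) blast
      obtain A0 where "A0 \<in> C" using C by blast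
      then have "\<one> \<in> \<Union> C" using subgroup.one_closed[OF normal_sub[OF nor]] by (intro UnionI)
      then show "\<Union> C \<noteq> {}" by blast
      fix a assume "a \<in> \<Union> C"
      then obtain A where A: "A \<in> C" "a \<in> A" by blast
      have "inv a \<in> A" using subgroup.m_inv_closed[OF normal_sub[OF nor[OF A(1)]] A(2)] .
      then show "inv a \<in> \<Union> C" using A(1) by (rule UnionI[rotated])
      show "x \<otimes> a \<otimes> inv x \<in> \<Union> C" if "x \<in> carrier G" for x
        using A normal_conj[OF nor[OF A(1)] that A(2)] by blast
      show "a \<otimes> b \<in> \<Union> C" if "b \<in> \<Union> C" for b
      proof -
        from that obtain B where B: "B \<in> C" "b \<in> B" by blast
        define D where "D = A \<union> B"
        have "D \<in> C" "a \<in> D" "b \<in> D" using tot[OF A(1) B(1)] A B by (auto simp: D_def Un_absorb1 Un_absorb2)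
        then have "a \<otimes> b \<in> D" by (intro subgroup.m_closed[OF normal_sub[OF nor]])
        then show ?thesis using \<open>D \<in> C\<close> by (rule UnionI[rotated])
      qed
    qed
    have "\<not> finite_index G (\<Union> C)"
    proof
      assume fi: "finite_index G (\<Union> C)"
      obtain Y where Y: "finite Y" "Y \<subseteq> \<Union> C" "generate G Y = \<Union> C"
        using finite_index_finitely_generated[OF S normal_sub[OF normal] fi] by blast
      obtain A where A: "A \<in> C" "Y \<subseteq> A"
        using finite_subset_Union_chain[OF Y(1,2) C(1) C(2)] by blast
      have "\<Union> C \<subseteq> A" using generate_subgroup_incl[OF A(2) normal_sub[OF nor[OF A(1)]]] Y by simp
      then have "finite_index G A" using fi A(1) by (metis Union_upper subset_antisym)
      then show False using CF A by (auto simp: F_def)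
    qed
    then show "\<Union> C \<in> F" using normal by (simp add: F_def)
  qed
  then show ?thesis unfolding F_def by blast
qed


text \<open>Membership of \<open>g\<close> says that the iterated commutators of \<open>g\<close>
  with arbitrary conjugates of the entries, taken in the order of the list, lie in \<open>N\<close>.
  This turns a commutator law into a statement about centralizers.\<close>

primrec centralizer_tower :: "'a set \<Rightarrow> 'a list \<Rightarrow> 'a set" where
  "centralizer_tower N [] = N"
| "centralizer_tower N (d # ds) = centralizer_mod G (centralizer_tower N ds) (conjugates G d)"

lemma normal_centralizer_tower:
  assumes "N \<lhd> G" "set ds \<subseteq> carrier G"
  shows "centralizer_tower N ds \<lhd> G \<and> N \<subseteq> centralizer_tower N ds"
  using assms(2)
proof (induction ds)
  case (Cons d ds)
  then have d: "d \<in> carrier G" and IH: "centralizer_tower N ds \<lhd> G" "N \<subseteq> centralizer_tower N ds"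
    by auto
  have "centralizer_mod G (centralizer_tower N ds) (conjugates G d) \<lhd> G"
    by (rule normal_centralizer_mod[OF IH(1) conjugates_subset[OF d] conjugates_conj[OF d]])
  moreover have "centralizer_tower N ds \<subseteq> centralizer_mod G (centralizer_tower N ds) (conjugates G d)"
    by (rule subset_centralizer_mod[OF IH(1) conjugates_subset[OF d]])
  ultimately show ?case using IH by auto
qed (use assms in simp)

lemma conj_word_eq:
  assumes "y \<in> carrier G" "d \<in> carrier G" "spow (\<otimes>) y (Suc e) = \<one>"
  shows "conj_word (\<otimes>) e y d = y \<otimes> d \<otimes> inv y"
  using spow_eq_inv[OF assms(1,3)] by (simp add: conj_word_def)

lemma comm_word_eq:
  assumes "g \<in> carrier G" "c \<in> carrier G" "spow (\<otimes>) g (Suc e) = \<one>" "spow (\<otimes>) c (Suc e) = \<one>"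
  shows "comm_word (\<otimes>) e g c = commutator G g c"
  using spow_eq_inv[OF assms(1,3)] spow_eq_inv[OF assms(2,4)] by (simp add: comm_word_def commutator_def)

text \<open>Every entry has a conjugating variable of its own, so the conjugators can be chosen one
  after the other.\<close>

lemma mem_centralizer_tower:
  assumes ex: "\<And>x. x \<in> carrier G \<Longrightarrow> spow (\<otimes>) x (Suc e) = \<one>"
    and g: "g \<in> carrier G" and ds: "set ds \<subseteq> carrier G"
    and law: "\<And>Y. range Y \<subseteq> carrier G \<Longrightarrow>
      iterated_comm (\<otimes>) e g (map (\<lambda>(k, c). conj_word (\<otimes>) e (Y k) c) (List.enumerate a ds)) \<in> N"
  shows "g \<in> centralizer_tower N ds"
  using g ds law
proof (induction ds arbitrary: g a)
  case Nil
  have "range (\<lambda>_::nat. \<one>) \<subseteq> carrier G" by auto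
  from Nil(3)[OF this] show ?case by simp
next
  case (Cons d ds)
  have "commutator G g c \<in> centralizer_tower N ds" if c: "c \<in> conjugates G d" for c
  proof (rule Cons.IH[where a = "Suc a"])
    obtain y where y: "y \<in> carrier G" "c = y \<otimes> d \<otimes> inv y" using c by (auto simp: conjugates_def)
    have cG: "c \<in> carrier G" using y Cons.prems by auto
    show "commutator G g c \<in> carrier G" using Cons.prems cG by simp
    show "set ds \<subseteq> carrier G" using Cons.prems by simp
    fix Y :: "nat \<Rightarrow> 'a" assume Y: "range Y \<subseteq> carrier G"
    \<comment> \<open>Assigning \<open>y\<close> to the index \<open>a\<close> does not disturb the
      tail, whose indices start at \<open>Suc a\<close>.\<close>
    have r: "range (Y(a := y)) \<subseteq> carrier G" using Y y by auto
    have eq: "map (\<lambda>(k, c). conj_word (\<otimes>) e ((Y(a := y)) k) c) (List.enumerate (Suc a) ds)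
        = map (\<lambda>(k, c). conj_word (\<otimes>) e (Y k) c) (List.enumerate (Suc a) ds)"
      by (rule map_cong) (auto simp: in_set_enumerate_eq)
    have "conj_word (\<otimes>) e y d = c" using y Cons.prems ex by (simp add: conj_word_eq)
    moreover have "comm_word (\<otimes>) e g c = commutator G g c" using cG Cons.prems ex by (simp add: comm_word_eq)
    ultimately show "iterated_comm (\<otimes>) e (commutator G g c)
        (map (\<lambda>(k, c). conj_word (\<otimes>) e (Y k) c) (List.enumerate (Suc a) ds)) \<in> N"
      using Cons.prems(3)[OF r] unfolding enumerate_simps list.map eq by simp
  qed
  then show ?case using Cons.prems(1) by (simp add: centralizer_mod_def)
qed

text \<open>If \<open>N\<close> is maximal among the normal subgroups of infinite index, then the centralizer of any
  \<open>d \<notin> N\<close> modulo a larger normal subgroup \<open>Q\<close> has infinite index unless \<open>Q\<close> has finite index: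
  for \<open>Q = N\<close>, the centralizer \<open>P\<close> and the centralizer of \<open>P\<close> modulo \<open>N\<close> would meet in a subgroup
  of finite index that is abelian modulo \<open>N\<close>.\<close>

lemma finite_index_centralizer_mod:
  assumes S: "finite S" "S \<subseteq> carrier G" "generate G S = carrier G"
    and ex: "\<And>x. x \<in> carrier G \<Longrightarrow> spow (\<otimes>) x (Suc e) = \<one>"
    and N: "N \<lhd> G" and max: "\<And>K. K \<lhd> G \<Longrightarrow> N \<subset> K \<Longrightarrow> finite_index G K"
    and d: "d \<in> carrier G" "d \<notin> N" and Q: "Q \<lhd> G" "N \<subseteq> Q"
    and fi: "finite_index G (centralizer_mod G Q (conjugates G d))"
  shows "finite_index G Q"
proof (cases "Q = N")
  case True
  define P where "P = centralizer_mod G N (conjugates G d)"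
  define K where "K = centralizer_mod G N P"
  have P: "P \<lhd> G" unfolding P_def
    by (rule normal_centralizer_mod[OF N conjugates_subset[OF d(1)] conjugates_conj[OF d(1)]])
  have PG: "P \<subseteq> carrier G" by (auto simp: P_def centralizer_mod_def)
  have K: "K \<lhd> G" unfolding K_def by (rule normal_centralizer_mod[OF N PG normal_conj[OF P]])
  have "\<one> \<otimes> d \<otimes> inv \<one> \<in> conjugates G d" unfolding conjugates_def by (rule imageI) simp
  then have "d \<in> conjugates G d" using d by simp
  then have "commutator G g d \<in> N" if "g \<in> P" for g
    using that by (auto simp: P_def centralizer_mod_def)
  then have "d \<in> K" using d commutator_sym[OF normal_sub[OF N]] PG
    by (auto simp: K_def centralizer_mod_def)
  \<comment> \<open>Here \<open>d \<notin> N\<close> makes \<open>K\<close> strictly larger than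
    \<open>N\<close>, so that maximality applies to it.\<close>
  then have "N \<subset> K" using d(2) subset_centralizer_mod[OF N PG] by (auto simp: K_def)
  then have "finite_index G K" using max K by blast
  moreover have "finite_index G P" using fi True by (simp add: P_def)
  ultimately have "finite_index G (P \<inter> K)" using P K by (simp add: finite_index_Int normal_sub)
  moreover have "commutator G a b \<in> N" if "a \<in> P \<inter> K" "b \<in> P \<inter> K" for a b
    using that by (auto simp: K_def centralizer_mod_def)
  moreover have "subgroup (P \<inter> K) G" using P K normal_sub subgroups_Inter_pair by blast
  ultimately have "finite_index G N" using finite_index_abelian_mod[OF S ex N, of "P \<inter> K"] by blast
  then show ?thesis using True by simp
next
  case False
  then show ?thesis using max Q by blast
qed

text \<open>Greedy choice: finitely many cosets of \<open>N\<close> never cover the group.\<close>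

lemma infinite_index_separated:
  assumes "subgroup N G" "\<not> finite_index G N"
  shows "\<exists>X::nat \<Rightarrow> 'a. range X \<subseteq> carrier G \<and> (\<forall>j\<le>n. \<forall>i<j. X j \<otimes> inv (X i) \<notin> N)"
proof (induction n)
  case 0
  show ?case by (intro exI[of _ "\<lambda>_. \<one>"]) auto
next
  case (Suc n)
  then obtain X :: "nat \<Rightarrow> 'a" where X: "range X \<subseteq> carrier G" "\<forall>j\<le>n. \<forall>i<j. X j \<otimes> inv (X i) \<notin> N"
    by blast
  have "finite (X ` {..n})" "X ` {..n} \<subseteq> carrier G" using X by auto
  then obtain g where g: "g \<in> carrier G" "\<forall>t\<in>X ` {..n}. g \<otimes> inv t \<notin> N"
    using assms(2) unfolding finite_index_def by metis
  have "range (X(Suc n := g)) \<subseteq> carrier G" using X g by auto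
  moreover have "\<forall>j\<le>Suc n. \<forall>i<j. (X(Suc n := g)) j \<otimes> inv ((X(Suc n := g)) i) \<notin> N"
    using X(2) g(2) by (auto simp: le_Suc_eq)
  ultimately show ?case by blast
qed

lemma set_pairs: "set (pairs n) = {(i, j). i < j \<and> j \<le> n}"
  by (force simp: pairs_def simp del: upt_Suc)

text \<open>For \<open>X\<close> in distinct cosets of the maximal \<open>N\<close>, no quotient
  lies in \<open>N\<close>. The law puts the first quotient into the centralizer tower of the
  others, which is thus strictly larger than \<open>N\<close> and of finite index. Removing the
  centralizers one by one brings finite index down to \<open>N\<close>, a contradiction.\<close>

theorem finite_of_chief_law:
  assumes S: "finite S" "S \<subseteq> carrier G" "generate G S = carrier G" and n: "0 < n"
    and ex: "\<And>x. x \<in> carrier G \<Longrightarrow> spow (\<otimes>) x (Suc e) = \<one>"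
    and law: "\<And>X Y. range X \<subseteq> carrier G \<Longrightarrow> range Y \<subseteq> carrier G \<Longrightarrow> chief_word (\<otimes>) e n X Y = \<one>"
  shows "finite (carrier G)"
proof (rule ccontr)
  assume "infinite (carrier G)"
  then obtain N where N: "N \<lhd> G" "\<not> finite_index G N"
    and max: "\<And>K. K \<lhd> G \<Longrightarrow> N \<subset> K \<Longrightarrow> finite_index G K"
    using maximal_infinite_index[OF S] by metis
  obtain X :: "nat \<Rightarrow> 'a" where X: "range X \<subseteq> carrier G" "\<forall>j\<le>n. \<forall>i<j. X j \<otimes> inv (X i) \<notin> N"
    using infinite_index_separated[OF normal_sub[OF N(1)] N(2)] by metis
  have XG: "X i \<in> carrier G" for i using X(1) by auto
  define ds where "ds = quotients (\<otimes>) e X n"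
  have ds: "d \<in> carrier G \<and> d \<notin> N" if "d \<in> set ds" for d
  proof -
    from that obtain i j where ij: "i < j" "j \<le> n" "d = X j \<otimes> spow (\<otimes>) (X i) e"
      by (auto simp: ds_def quotients_def set_pairs)
    have "spow (\<otimes>) (X i) e = inv (X i)" using XG ex by (simp add: spow_eq_inv)
    then show ?thesis using ij X(2) XG by auto
  qed
  have "(0, 1) \<in> set (pairs n)" using n by (auto simp: set_pairs)
  then have "ds \<noteq> []" by (auto simp: ds_def quotients_def)
  then obtain d0 ds' where dd: "ds = d0 # ds'" by (cases ds) auto
  have d0: "d0 \<in> carrier G" "d0 \<notin> N" and sub: "set ds' \<subseteq> carrier G" using ds dd by auto
  have "d0 \<in> centralizer_tower N ds'"
  proof (rule mem_centralizer_tower[OF ex d0(1) sub])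
    fix Y :: "nat \<Rightarrow> 'a" assume "range Y \<subseteq> carrier G"
    then show "iterated_comm (\<otimes>) e d0 (map (\<lambda>(k, c). conj_word (\<otimes>) e (Y k) c) (List.enumerate 0 ds')) \<in> N"
      using law[OF X(1)] dd subgroup.one_closed[OF normal_sub[OF N(1)]] by (simp add: chief_word_def flip: ds_def)
  qed
  then have "N \<subset> centralizer_tower N ds'" using normal_centralizer_tower[OF N(1) sub] d0 by auto
  then have "finite_index G (centralizer_tower N ds')" using max normal_centralizer_tower[OF N(1) sub] by blast
  moreover have "finite_index G (centralizer_tower N cs) \<Longrightarrow> set cs \<subseteq> set ds \<Longrightarrow> finite_index G N" for cs
  proof (induction cs)
    case (Cons c cs)
    have c: "c \<in> carrier G" "c \<notin> N" and cs: "set cs \<subseteq> carrier G" using ds Cons.prems by auto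
    have "finite_index G (centralizer_tower N cs)"
    proof (rule finite_index_centralizer_mod[OF S ex N(1) max c])
      show "centralizer_tower N cs \<lhd> G" "N \<subseteq> centralizer_tower N cs"
        using normal_centralizer_tower[OF N(1) cs] by auto
      show "finite_index G (centralizer_mod G (centralizer_tower N cs) (conjugates G c))"
        using Cons.prems(1) by simp
    qed
    then show ?case using Cons by simp
  qed simp
  ultimately show False using N(2) dd by auto
qed

end


section \<open>Recurrent languages\<close>

definition factorial_language :: "'a list set \<Rightarrow> bool" where
  "factorial_language L \<longleftrightarrow> (\<forall>p u s. p @ u @ s \<in> L \<longrightarrow> u \<in> L)"

definition unbounded_language :: "'a list set \<Rightarrow> bool" where
  "unbounded_language L \<longleftrightarrow> (\<forall>n. \<exists>w\<in>L. n \<le> length w)"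

text \<open>Uniform recurrence, as in the language of a minimal subshift.\<close>

definition recurrent_language :: "'a list set \<Rightarrow> bool" where
  "recurrent_language L \<longleftrightarrow> factorial_language L \<and> unbounded_language L \<and>
     (\<forall>u\<in>L. \<exists>n. \<forall>w\<in>L. n \<le> length w \<longrightarrow> (\<exists>p s. w = p @ u @ s))"

lemma factorialD: "factorial_language L \<Longrightarrow> p @ u @ s \<in> L \<Longrightarrow> u \<in> L"
  unfolding factorial_language_def by blast

lemma unbounded_length:
  assumes "factorial_language L" "unbounded_language L"
  shows "\<exists>w\<in>L. length w = n"
proof -
  from assms(2) obtain w where w: "w \<in> L" "n \<le> length w" by (auto simp: unbounded_language_def)
  have "take n w \<in> L" using factorialD[OF assms(1), of "[]" "take n w" "drop n w"] w by simp
  then show ?thesis using w by (intro bexI[of _ "take n w"]) auto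
qed

text \<open>A minimal factorial unbounded sublanguage is recurrent: if arbitrarily long words
  avoided one of its words \<open>u\<close>, the words that avoid \<open>u\<close> would form a
  smaller sublanguage.\<close>

lemma exists_recurrent_language:
  assumes "finite X" "L0 \<subseteq> lists X" "factorial_language L0" "unbounded_language L0"
  shows "\<exists>L\<subseteq>L0. recurrent_language L"
proof -
  define F where "F = {L. L \<subseteq> L0 \<and> factorial_language L \<and> unbounded_language L}"
  \<comment> \<open>Complements turn the search for a minimal language into one for a maximal
    set.\<close>
  have "\<exists>M\<in>uminus ` F. \<forall>X\<in>uminus ` F. M \<subseteq> X \<longrightarrow> X = M"
  proof (rule subset_Zorn_nonempty)
    show "uminus ` F \<noteq> {}" using assms by (auto simp: F_def)
    fix C assume C: "C \<noteq> {}" "subset.chain (uminus ` F) C"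
    define D where "D = uminus ` C"
    have DF: "D \<subseteq> F" using C(2) by (force simp: D_def subset.chain_def)
    have Dne: "D \<noteq> {}" using C by (simp add: D_def)
    have tot: "L \<subseteq> L' \<or> L' \<subseteq> L" if "L \<in> D" "L' \<in> D" for L L'
    proof -
      from that obtain K K' where K: "K \<in> C" "L = - K" "K' \<in> C" "L' = - K'" by (auto simp: D_def)
      then have "K \<subseteq> K' \<or> K' \<subseteq> K" using C(2) by (auto simp only: subset_chain_def)
      then show ?thesis using K by blast
    qed
    have UC: "\<Union> C = - \<Inter> D" by (auto simp: D_def)
    have fact: "factorial_language (\<Inter> D)"
      using DF unfolding factorial_language_def F_def by blast
    have "\<exists>w\<in>\<Inter> D. n \<le> length w" for n
    proof -
      \<comment> \<open>Compactness over a finite alphabet: some member of the chain has the fewest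
        words of length \<open>n\<close>, and these words then belong to every member.\<close>
      define k where "k L = card {w \<in> L. length w = n}" for L :: "'a list set"
      have fin: "finite {w \<in> L. length w = n}" if "L \<in> D" for L
        by (rule finite_subset[OF _ finite_lists_length_eq[OF assms(1), of n]])
          (use that DF assms(2) in \<open>auto simp: F_def\<close>)
      obtain L where L: "L \<in> D" "\<And>L'. L' \<in> D \<Longrightarrow> k L \<le> k L'"
        using ex_has_least_nat[of "\<lambda>L. L \<in> D" _ k] Dne by blast
      obtain w where w: "w \<in> L" "length w = n"
        using unbounded_length[of L n] L(1) DF by (auto simp: F_def)
      have "w \<in> L'" if L': "L' \<in> D" for L'
      proof (cases "L \<subseteq> L'")
        case False
        then have "L' \<subseteq> L" using tot L L' by blast
        then have "{w \<in> L'. length w = n} \<subseteq> {w \<in> L. length w = n}" by blast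
        then have "{w \<in> L'. length w = n} = {w \<in> L. length w = n}"
          using L(2)[OF L'] by (intro card_seteq fin L(1)) (simp_all add: k_def)
        then show ?thesis using w by blast
      qed (use w in blast)
      then show ?thesis using w by blast
    qed
    moreover have "\<Inter> D \<subseteq> L0" using DF Dne by (auto simp: F_def)
    ultimately have "\<Inter> D \<in> F" using fact by (auto simp: F_def unbounded_language_def)
    then show "\<Union> C \<in> uminus ` F" using UC by blast
  qed
  then obtain L where L: "L \<in> F" "\<forall>K\<in>uminus ` F. - L \<subseteq> K \<longrightarrow> K = - L" by (elim bexE imageE) simp
  have min: "L' = L" if L': "L' \<in> F" "L' \<subseteq> L" for L'
  proof -
    have "- L' = - L" using L(2) L' by blast
    then show ?thesis by simp
  qed
  have "\<exists>n. \<forall>w\<in>L. n \<le> length w \<longrightarrow> (\<exists>p s. w = p @ u @ s)" if u: "u \<in> L" for u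
  proof (rule ccontr)
    assume H: "\<not> ?thesis"
    define L' where "L' = {w \<in> L. \<nexists>p s. w = p @ u @ s}"
    have "factorial_language L'"
      unfolding factorial_language_def
    proof (intro allI impI)
      fix p v s assume v: "p @ v @ s \<in> L'"
      then have "v \<in> L" using L(1) factorialD unfolding F_def L'_def by blast
      moreover have "v \<noteq> p' @ u @ s'" for p' s'
      proof
        assume "v = p' @ u @ s'"
        then have "p @ v @ s = (p @ p') @ u @ (s' @ s)" by simp
        then show False using v unfolding L'_def by blast
      qed
      ultimately show "v \<in> L'" by (auto simp: L'_def)
    qed
    moreover have "unbounded_language L'"
      unfolding unbounded_language_def
    proof
      fix n show "\<exists>w\<in>L'. n \<le> length w" using H by (auto simp: L'_def)
    qed
    ultimately have "L' = L" using L(1) by (intro min) (auto simp: F_def L'_def)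
    then have "u \<in> L'" using u by simp
    then have "u \<noteq> [] @ u @ []" unfolding L'_def by blast
    then show False by simp
  qed
  then show ?thesis using L(1) by (auto simp: F_def recurrent_language_def)
qed

lemma recurrent_factorial: "recurrent_language L \<Longrightarrow> p @ u @ s \<in> L \<Longrightarrow> u \<in> L"
  by (auto simp: recurrent_language_def dest: factorialD)

text \<open>In a word of length \<open>n + k + n\<close>, the word \<open>u\<close> occurs both
  among the first and among the last \<open>n\<close> letters.\<close>

lemma recurrent_return:
  assumes L: "recurrent_language L" and u: "u \<in> L"
  shows "\<exists>w. k \<le> length w \<and> u @ w @ u \<in> L"
proof -
  obtain n where n: "\<And>w. w \<in> L \<Longrightarrow> n \<le> length w \<Longrightarrow> \<exists>p s. w = p @ u @ s"
    using L u unfolding recurrent_language_def by metis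
  obtain w where w: "w \<in> L" "length w = n + k + n"
    using L unbounded_length[of L "n + k + n"] by (auto simp: recurrent_language_def)
  define w1 w2 w3 where "w1 = take n w" and "w2 = take k (drop n w)" and "w3 = drop (n + k) w"
  have eq: "w = w1 @ w2 @ w3"
    by (simp add: w1_def w2_def w3_def add.commute flip: drop_drop)
  have "w1 \<in> L" "w3 \<in> L"
    using recurrent_factorial[OF L, of "[]" w1] recurrent_factorial[OF L, of "w1 @ w2" w3 "[]"] w(1) eq
    by auto
  moreover have "length w1 = n" "length w2 = k" "length w3 = n"
    using w(2) by (auto simp: w1_def w2_def w3_def)
  ultimately obtain p s p' s' where "w1 = p @ u @ s" "w3 = p' @ u @ s'" using n by (metis order_refl)
  then have "w = p @ (u @ (s @ w2 @ p') @ u) @ s'" using eq by simp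
  then have "u @ (s @ w2 @ p') @ u \<in> L" using w(1) recurrent_factorial[OF L] by metis
  then show ?thesis using \<open>length w2 = k\<close> by (intro exI[of _ "s @ w2 @ p'"]) auto
qed

lemma recurrent_return2:
  assumes L: "recurrent_language L" and u: "u \<in> L"
  shows "\<exists>b c. b \<noteq> [] \<and> c \<noteq> [] \<and> u @ b @ u @ c @ u \<in> L"
proof -
  obtain b where b: "1 \<le> length b" "u @ b @ u \<in> L" using recurrent_return[OF L u, of 1] by blast
  obtain c where c: "1 \<le> length c" "(u @ b @ u) @ c @ (u @ b @ u) \<in> L"
    using recurrent_return[OF L b(2), of 1] by blast
  then have "[] @ (u @ b @ u @ c @ u) @ (b @ u) \<in> L" by simp
  then have "u @ b @ u @ c @ u \<in> L" by (rule recurrent_factorial[OF L])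
  then show ?thesis using b c by (metis list.size(3) not_one_le_zero)
qed

primrec nest :: "('a \<Rightarrow> 'a \<Rightarrow> 'a) \<Rightarrow> 'a \<Rightarrow> (nat \<Rightarrow> 'a) \<Rightarrow> (nat \<Rightarrow> 'a) \<Rightarrow> nat \<Rightarrow> 'a" where
  "nest f y b c 0 = y"
| "nest f y b c (Suc n) = f (f (f (f (nest f y b c n) (b n)) (nest f y b c n)) (c n)) (nest f y b c n)"

lemma nest_cong: "(\<And>i. i < n \<Longrightarrow> b i = b' i \<and> c i = c' i) \<Longrightarrow> nest f y b c n = nest f y b' c' n"
  by (induction n) auto

lemma recurrent_nest:
  assumes L: "recurrent_language L" and u: "u \<in> L"
  shows "\<exists>b c. (\<forall>i. b i \<noteq> [] \<and> c i \<noteq> []) \<and> nest (@) u b c n \<in> L"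
proof (induction n)
  case 0
  show ?case using u by (intro exI[of _ "\<lambda>_. [undefined]"]) auto
next
  case (Suc n)
  then obtain b c where bc: "\<forall>i. b i \<noteq> [] \<and> c i \<noteq> []" "nest (@) u b c n \<in> L" by blast
  let ?u = "nest (@) u b c n"
  obtain b' c' where "b' \<noteq> []" "c' \<noteq> []" "?u @ b' @ ?u @ c' @ ?u \<in> L"
    using recurrent_return2[OF L bc(2)] by blast
  moreover have "nest (@) u (b(n := b')) (c(n := c')) n = ?u" by (rule nest_cong) auto
  ultimately have "nest (@) u (b(n := b')) (c(n := c')) (Suc n) \<in> L" by simp
  moreover have "\<forall>i. (b(n := b')) i \<noteq> [] \<and> (c(n := c')) i \<noteq> []"
    using bc(1) \<open>b' \<noteq> []\<close> \<open>c' \<noteq> []\<close> by simp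
  ultimately show ?case by blast
qed


section \<open>Geodesic words\<close>

definition ai_axioms :: "identity set" where
  "ai_axioms =
    {(Plus (Plus (Var 0) (Var 1)) (Var 2), Plus (Var 0) (Plus (Var 1) (Var 2))),
     (Plus (Var 0) (Var 1), Plus (Var 1) (Var 0)),
     (Plus (Var 0) (Var 0), Var 0),
     (Times (Times (Var 0) (Var 1)) (Var 2), Times (Var 0) (Times (Var 1) (Var 2))),
     (Times (Plus (Var 0) (Var 1)) (Var 2), Plus (Times (Var 0) (Var 2)) (Times (Var 1) (Var 2))),
     (Times (Var 0) (Plus (Var 1) (Var 2)), Plus (Times (Var 0) (Var 1)) (Times (Var 0) (Var 2)))}"

lemma ai_semiring_iff_models: "ai_semiring A \<longleftrightarrow> A \<in> models ai_axioms"
proof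
  assume "ai_semiring A"
  then interpret ai_semiring A .
  have v: "\<rho> n \<in> carrier A" if "range \<rho> \<subseteq> carrier A" for \<rho> :: "nat \<Rightarrow> 'a" and n
    using that by auto
  show "A \<in> models ai_axioms"
    unfolding models_def ai_axioms_def satisfies_def
    by (auto simp: algebra v plus_assoc plus_idem times_assoc distrib_left distrib_right
        intro: plus_comm)
next
  assume A: "A \<in> models ai_axioms"
  have sat: "eval A \<rho> s = eval A \<rho> t" if "(s, t) \<in> ai_axioms" "range \<rho> \<subseteq> carrier A" for s t \<rho>
    using A that by (fastforce simp: models_def satisfies_def)
  show "ai_semiring A"
  proof
    show "binalgebra A" using A by (simp add: models_def)
    fix x y z assume "x \<in> carrier A" "y \<in> carrier A" "z \<in> carrier A"
    then have "range (\<lambda>n::nat. if n = 0 then x else if n = 1 then y else z) \<subseteq> carrier A" by auto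
    note s = sat[OF _ this]
    show "x \<boxplus>\<^bsub>A\<^esub> y \<boxplus>\<^bsub>A\<^esub> z = x \<boxplus>\<^bsub>A\<^esub> (y \<boxplus>\<^bsub>A\<^esub> z)"
      using s[of "Plus (Plus (Var 0) (Var 1)) (Var 2)" "Plus (Var 0) (Plus (Var 1) (Var 2))"]
      by (simp add: ai_axioms_def)
    show "x \<boxdot>\<^bsub>A\<^esub> y \<boxdot>\<^bsub>A\<^esub> z = x \<boxdot>\<^bsub>A\<^esub> (y \<boxdot>\<^bsub>A\<^esub> z)"
      using s[of "Times (Times (Var 0) (Var 1)) (Var 2)" "Times (Var 0) (Times (Var 1) (Var 2))"]
      by (simp add: ai_axioms_def)
    show "(x \<boxplus>\<^bsub>A\<^esub> y) \<boxdot>\<^bsub>A\<^esub> z = x \<boxdot>\<^bsub>A\<^esub> z \<boxplus>\<^bsub>A\<^esub> y \<boxdot>\<^bsub>A\<^esub> z"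
      using s[of "Times (Plus (Var 0) (Var 1)) (Var 2)" "Plus (Times (Var 0) (Var 2)) (Times (Var 1) (Var 2))"]
      by (simp add: ai_axioms_def)
    show "x \<boxdot>\<^bsub>A\<^esub> (y \<boxplus>\<^bsub>A\<^esub> z) = x \<boxdot>\<^bsub>A\<^esub> y \<boxplus>\<^bsub>A\<^esub> x \<boxdot>\<^bsub>A\<^esub> z"
      using s[of "Times (Var 0) (Plus (Var 1) (Var 2))" "Plus (Times (Var 0) (Var 1)) (Times (Var 0) (Var 2))"]
      by (simp add: ai_axioms_def)
  next
    fix x y assume "x \<in> carrier A" "y \<in> carrier A"
    then have "range (\<lambda>n::nat. if n = 0 then x else y) \<subseteq> carrier A" by auto
    from sat[OF _ this, of "Plus (Var 0) (Var 1)" "Plus (Var 1) (Var 0)"]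
    show "x \<boxplus>\<^bsub>A\<^esub> y = y \<boxplus>\<^bsub>A\<^esub> x" by (simp add: ai_axioms_def)
  next
    fix x assume "x \<in> carrier A"
    then have "range (\<lambda>n::nat. x) \<subseteq> carrier A" by auto
    from sat[OF _ this, of "Plus (Var 0) (Var 0)" "Var 0"]
    show "x \<boxplus>\<^bsub>A\<^esub> x = x" by (simp add: ai_axioms_def)
  qed
qed

text \<open>Together with the ai-semiring axioms, \<open>E\<close> defines a finitely based, locally
  finite variety that contains the one generated by \<open>S\<close>.\<close>

lemma not_inherently_nonfinitely_based:
  assumes S: "ai_semiring S" and E: "finite E" "\<And>e. e \<in> E \<Longrightarrow> satisfies S e"
    and lf: "\<And>A::nat binalg. ai_semiring A \<Longrightarrow> (\<And>e. e \<in> E \<Longrightarrow> satisfies A e) \<Longrightarrow>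
      finitely_generated A \<Longrightarrow> finite (carrier A)"
  shows "\<not> inherently_nonfinitely_based S"
proof -
  define W :: "nat binalg set" where "W = models (ai_axioms \<union> E)"
  have "A \<in> models ai_axioms" "e \<in> E \<Longrightarrow> satisfies A e" if "A \<in> W" for A e
    using that by (auto simp: W_def models_def)
  then have "locally_finite W" using lf unfolding locally_finite_def by (metis ai_semiring_iff_models)
  moreover have "finitely_based W"
    unfolding finitely_based_def W_def
    by (rule exI[of _ "ai_axioms \<union> E"]) (simp add: E ai_axioms_def)
  moreover have "variety W" by (auto simp: variety_def W_def)
  moreover have "generated_variety S \<subseteq> W"
    using S E(2) by (auto simp: ai_semiring_iff_models generated_variety_def W_def models_def)
  ultimately show ?thesis
    unfolding inherently_nonfinitely_based_def inherently_nonfinitely_based_variety_def by blast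
qed

text \<open>Nonempty finite sums; there is no zero that could serve as the empty sum.\<close>

inductive_set sums :: "'a binalg \<Rightarrow> 'a set \<Rightarrow> 'a set" for A V where
  base: "x \<in> V \<Longrightarrow> x \<in> sums A V"
| plus: "x \<in> sums A V \<Longrightarrow> y \<in> sums A V \<Longrightarrow> x \<boxplus>\<^bsub>A\<^esub> y \<in> sums A V"

section \<open>Values of words and shortest words in an ai-semiring\<close>

context ai_semiring
begin

lemma plus_closed [simp]: "x \<in> carrier S \<Longrightarrow> y \<in> carrier S \<Longrightarrow> x \<boxplus> y \<in> carrier S"
  and times_closed [simp]: "x \<in> carrier S \<Longrightarrow> y \<in> carrier S \<Longrightarrow> x \<boxdot> y \<in> carrier S"
  using algebra by (auto simp: binalgebra_def)

lemma sums_closed: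
  assumes "V \<subseteq> carrier S" "x \<in> sums S V"
  shows "x \<in> carrier S"
  using assms(2) by induction (use assms(1) in auto)

text \<open>In a semilattice a sum either involves a new generator \<open>v\<close> or not, so
  \<open>v\<close> at most doubles the number of sums and adds one.\<close>

lemma finite_sums:
  assumes "finite V" "V \<subseteq> carrier S"
  shows "finite (sums S V)"
  using assms
proof (induction V rule: finite_induct)
  case empty
  have "x \<in> sums S {} \<Longrightarrow> False" for x by (induction rule: sums.induct) auto
  then have "sums S {} = {}" by blast
  then show ?case by simp
next
  case (insert v V)
  then have v: "v \<in> carrier S" and V: "V \<subseteq> carrier S" by auto
  note cl = sums_closed[OF V]
  have "x \<in> insert v (sums S V \<union> (\<lambda>s. v \<boxplus> s) ` sums S V)" if "x \<in> sums S (insert v V)" for x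
    using that
  proof induction
    case (base x)
    then show ?case by (auto intro: sums.base)
  next
    case (plus x y)
    have 1: "v \<boxplus> (v \<boxplus> s) = v \<boxplus> s" if "s \<in> sums S V" for s
      using cl[OF that] v by (simp add: plus_idem flip: plus_assoc)
    have 2: "s \<boxplus> v = v \<boxplus> s" if "s \<in> sums S V" for s
      using cl[OF that] v by (rule plus_comm)
    have 3: "s \<boxplus> (v \<boxplus> t) = v \<boxplus> (s \<boxplus> t)" if "s \<in> sums S V" "t \<in> sums S V" for s t
      using cl[OF that(1)] cl[OF that(2)] v 2[OF that(1)] by (simp flip: plus_assoc)
    have 4: "(v \<boxplus> s) \<boxplus> t = v \<boxplus> (s \<boxplus> t)" if "s \<in> sums S V" "t \<in> sums S V" for s t
      using cl[OF that(1)] cl[OF that(2)] v by (simp add: plus_assoc)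
    have 5: "(v \<boxplus> s) \<boxplus> v = v \<boxplus> s" if "s \<in> sums S V" for s
      using cl[OF that] v 1[OF that] 2[OF that] by (simp add: plus_assoc)
    have 6: "(v \<boxplus> s) \<boxplus> (v \<boxplus> t) = v \<boxplus> (s \<boxplus> t)" if "s \<in> sums S V" "t \<in> sums S V" for s t
      using 3[OF that] 1[OF sums.plus[OF that]] cl[OF that(1)] cl[OF that(2)] v by (simp add: plus_assoc)
    show ?case using plus.IH v
      by (auto simp: 1 2 3 4 5 6 plus_idem intro: sums.plus)
  qed
  then have "sums S (insert v V) \<subseteq> insert v (sums S V \<union> (\<lambda>s. v \<boxplus> s) ` sums S V)" by blast
  moreover have "finite (insert v (sums S V \<union> (\<lambda>s. v \<boxplus> s) ` sums S V))" using insert by simp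
  ultimately show ?case by (rule finite_subset)
qed

primrec val :: "'a list \<Rightarrow> 'a" where
  "val [] = undefined"
| "val (x # xs) = (if xs = [] then x else x \<boxdot> val xs)"

lemma val_closed [simp]: "w \<noteq> [] \<Longrightarrow> set w \<subseteq> carrier S \<Longrightarrow> val w \<in> carrier S"
  by (induction w) auto

lemma val_append:
  "u \<noteq> [] \<Longrightarrow> v \<noteq> [] \<Longrightarrow> set u \<subseteq> carrier S \<Longrightarrow> set v \<subseteq> carrier S \<Longrightarrow> val (u @ v) = val u \<boxdot> val v"
  by (induction u) (auto simp: times_assoc)

definition words :: "'a set \<Rightarrow> 'a list set" where
  "words X = {w. w \<noteq> [] \<and> set w \<subseteq> X}"

text \<open>By distributivity every element is a sum of products of generators, and a finitely
  generated semilattice is finite.\<close>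

lemma finite_carrier:
  assumes X: "X \<subseteq> carrier S" "generated S X = carrier S" and fin: "finite (val ` words X)"
  shows "finite (carrier S)"
proof -
  define V where "V = val ` words X"
  have V: "V \<subseteq> carrier S" using X by (auto simp: V_def words_def)
  note cl = sums_closed[OF V]
  have vt: "v \<boxdot> w \<in> V" if "v \<in> V" "w \<in> V" for v w
  proof -
    from that obtain p q where "p \<in> words X" "q \<in> words X" "v = val p" "w = val q" by (auto simp: V_def)
    then have "v \<boxdot> w = val (p @ q)" "p @ q \<in> words X" using X by (auto simp: words_def val_append)
    then show ?thesis by (auto simp: V_def)
  qed
  have lt: "v \<boxdot> y \<in> sums S V" if "v \<in> V" "y \<in> sums S V" for v y
    using that(2)
  proof induction
    case (base y) then show ?case using vt that(1) by (auto intro: sums.base)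
  next
    case (plus y z)
    then show ?case using that(1) V cl by (auto simp: distrib_left subset_iff intro: sums.plus)
  qed
  have tt: "x \<boxdot> y \<in> sums S V" if "x \<in> sums S V" "y \<in> sums S V" for x y
    using that(1)
  proof induction
    case (base y) then show ?case using lt that(2) by auto
  next
    case (plus x z)
    then show ?case using that(2) cl by (auto simp: distrib_right intro: sums.plus)
  qed
  have "x \<in> sums S V" if "x \<in> generated S X" for x
    using that
  proof induction
    case (base x)
    then have "[x] \<in> words X" "val [x] = x" by (auto simp: words_def)
    then have "x \<in> V" unfolding V_def by (metis imageI)
    then show ?case by (rule sums.base)
  qed (auto intro: sums.plus tt)
  then have "carrier S \<subseteq> sums S V" using X by blast
  then show ?thesis using finite_sums[OF fin] V unfolding V_def by (metis finite_subset)
qed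

text \<open>The empty word has no value. Counting it as geodesic makes the set of geodesics closed
  under factors.\<close>

definition geodesic :: "'a set \<Rightarrow> 'a list \<Rightarrow> bool" where
  "geodesic X w \<longleftrightarrow> set w \<subseteq> X \<and> (w \<noteq> [] \<longrightarrow> (\<forall>w'\<in>words X. val w' = val w \<longrightarrow> length w \<le> length w'))"

lemma geodesic_factor:
  assumes X: "X \<subseteq> carrier S" and g: "geodesic X (p @ u @ s)"
  shows "geodesic X u"
  unfolding geodesic_def
proof (intro conjI impI ballI)
  show "set u \<subseteq> X" using g by (auto simp: geodesic_def)
  fix u' assume u: "u \<noteq> []" and u': "u' \<in> words X" "val u' = val u"
  have c: "set p \<subseteq> carrier S" "set u \<subseteq> carrier S" "set s \<subseteq> carrier S" "set u' \<subseteq> carrier S" "u' \<noteq> []"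
    using g u' X by (auto simp: geodesic_def words_def)
  have "val (u' @ s) = val (u @ s)" using c u u' by (cases "s = []") (auto simp: val_append)
  then have "val (p @ u' @ s) = val (p @ u @ s)" using c u by (cases "p = []") (auto simp: val_append)
  moreover have "p @ u' @ s \<in> words X" using u' g by (auto simp: geodesic_def words_def)
  ultimately have "length (p @ u @ s) \<le> length (p @ u' @ s)" using g u by (auto simp: geodesic_def)
  then show "length u \<le> length u'" by simp
qed

text \<open>Were the lengths of geodesics bounded, the products of generators would take finitely
  many values, and \<open>finite_carrier\<close> would apply.\<close>

lemma exists_recurrent_geodesics:
  assumes X: "finite X" "X \<subseteq> carrier S" "generated S X = carrier S" and inf: "infinite (carrier S)"
  shows "\<exists>L. recurrent_language L \<and> (\<forall>w\<in>L. geodesic X w)"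
proof -
  define L0 where "L0 = {w. geodesic X w}"
  have "factorial_language L0"
    using geodesic_factor[OF X(2)] by (auto simp: factorial_language_def L0_def)
  moreover have "unbounded_language L0"
    unfolding unbounded_language_def
  proof
    fix n show "\<exists>w\<in>L0. n \<le> length w"
    proof (rule ccontr)
      assume H: "\<not> ?thesis"
      have "val ` words X \<subseteq> val ` {w. set w \<subseteq> X \<and> length w \<le> n}"
      proof
        fix v assume "v \<in> val ` words X"
        then have "\<exists>w. w \<in> words X \<and> val w = v" by blast
        then obtain w where w: "w \<in> words X" "val w = v"
          "\<And>w'. w' \<in> words X \<Longrightarrow> val w' = v \<Longrightarrow> length w \<le> length w'"
          using ex_has_least_nat[of "\<lambda>w. w \<in> words X \<and> val w = v" _ length] by metis
        then have "w \<in> L0" by (auto simp: L0_def geodesic_def words_def)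
        then have "length w \<le> n" using H by auto
        then show "v \<in> val ` {w. set w \<subseteq> X \<and> length w \<le> n}" using w by (auto simp: words_def)
      qed
      then have "finite (val ` words X)"
        using finite_lists_length_le[OF X(1)] by (metis finite_imageI finite_subset)
      then show False using finite_carrier[OF X(2,3)] inf by blast
    qed
  qed
  moreover have "L0 \<subseteq> lists X" by (auto simp: L0_def geodesic_def)
  ultimately obtain L where L: "L \<subseteq> L0" "recurrent_language L"
    using exists_recurrent_language[OF X(1)] by metis
  then have "\<forall>w\<in>L. geodesic X w" by (auto simp: L0_def)
  with L(2) show ?thesis by (intro exI conjI)
qed

end


section \<open>Deletion identities\<close>

text \<open>The intact copies of \<open>nest\<close> around the altered centre provide the
  absorption that makes the change invisible.\<close>

primrec nest_del :: "('a \<Rightarrow> 'a \<Rightarrow> 'a) \<Rightarrow> 'a \<Rightarrow> 'a \<Rightarrow> (nat \<Rightarrow> 'a) \<Rightarrow> (nat \<Rightarrow> 'a) \<Rightarrow> nat \<Rightarrow> 'a" where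
  "nest_del f y d b c 0 = d"
| "nest_del f y d b c (Suc n) = f (f (f (f (nest f y b c n) (b n)) (nest_del f y d b c n)) (c n)) (nest f y b c n)"

lemma eval_nest: "eval A \<rho> (nest Times y b c n) =
    nest (stimes A) (eval A \<rho> y) (\<lambda>i. eval A \<rho> (b i)) (\<lambda>i. eval A \<rho> (c i)) n"
  by (induction n) simp_all

lemma eval_nest_del: "eval A \<rho> (nest_del Times y d b c n) =
    nest_del (stimes A) (eval A \<rho> y) (eval A \<rho> d) (\<lambda>i. eval A \<rho> (b i)) (\<lambda>i. eval A \<rho> (c i)) n"
  by (induction n) (simp_all add: eval_nest)

definition factor5 :: "('a \<Rightarrow> 'a \<Rightarrow> 'a) \<Rightarrow> 'a \<Rightarrow> 'a \<Rightarrow> 'a \<Rightarrow> 'a \<Rightarrow> 'a" where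
  "factor5 f p x a q = f (f (f (f p x) a) x) q"

text \<open>The factor \<open>x a\<close> is deleted in the innermost \<open>p x a x q\<close>, in the middle of the pattern only.\<close>

definition deletion_identity :: "nat \<Rightarrow> identity" where
  "deletion_identity N =
    (let y = factor5 Times (Var 2) (Var 0) (Var 1) (Var 3);
         d = Times (Times (Var 2) (Var 0)) (Var 3);
         b = \<lambda>i. Var (4 + 2 * i); c = \<lambda>i. Var (5 + 2 * i)
     in (nest Times y b c N, nest_del Times y d b c N))"

lemma length_nest_del:
  "length d < length y \<Longrightarrow> length (nest_del (@) y d b c n) < length (nest (@) y b c n)"
  by (induction n) auto

context ai_semiring
begin

lemma nest_closed [simp]:
  "y \<in> carrier S \<Longrightarrow> range b \<subseteq> carrier S \<Longrightarrow> range c \<subseteq> carrier S \<Longrightarrow> nest (\<boxdot>) y b c n \<in> carrier S"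
  by (induction n) (auto simp: image_subset_iff)

lemma nest_del_closed [simp]:
  "y \<in> carrier S \<Longrightarrow> d \<in> carrier S \<Longrightarrow> range b \<subseteq> carrier S \<Longrightarrow> range c \<subseteq> carrier S \<Longrightarrow>
    nest_del (\<boxdot>) y d b c n \<in> carrier S"
  by (induction n) (auto simp: image_subset_iff)

lemma nest_words:
  "y \<in> words X \<Longrightarrow> range b \<subseteq> words X \<Longrightarrow> range c \<subseteq> words X \<Longrightarrow> nest (@) y b c n \<in> words X"
  by (induction n) (auto simp: words_def image_subset_iff)

lemma nest_del_words:
  assumes "y \<in> words X" "d \<in> words X" "range b \<subseteq> words X" "range c \<subseteq> words X"
  shows "nest_del (@) y d b c n \<in> words X"
  using assms by (induction n) (use nest_words[OF assms(1,3,4)] in \<open>auto simp: words_def image_subset_iff\<close>)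

lemma val_app: "u \<in> words (carrier S) \<Longrightarrow> v \<in> words (carrier S) \<Longrightarrow> val (u @ v) = val u \<boxdot> val v"
  by (auto simp: words_def val_append)

lemma words_append [simp]: "u \<in> words X \<Longrightarrow> v \<in> words X \<Longrightarrow> u @ v \<in> words X"
  by (auto simp: words_def)

lemma val_words [simp]: "u \<in> words (carrier S) \<Longrightarrow> val u \<in> carrier S"
  by (auto simp: words_def)

lemma val_nest:
  assumes "y \<in> words (carrier S)" "range b \<subseteq> words (carrier S)" "range c \<subseteq> words (carrier S)"
  shows "val (nest (@) y b c n) = nest (\<boxdot>) (val y) (\<lambda>i. val (b i)) (\<lambda>i. val (c i)) n"
proof (induction n)
  case (Suc n)
  have bc: "b n \<in> words (carrier S)" "c n \<in> words (carrier S)" using assms by auto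
  show ?case using bc Suc nest_words[OF assms, of n] by (simp add: val_app del: append_assoc)
qed simp

lemma val_nest_del:
  assumes "y \<in> words (carrier S)" "d \<in> words (carrier S)" "range b \<subseteq> words (carrier S)" "range c \<subseteq> words (carrier S)"
  shows "val (nest_del (@) y d b c n) = nest_del (\<boxdot>) (val y) (val d) (\<lambda>i. val (b i)) (\<lambda>i. val (c i)) n"
proof (induction n)
  case (Suc n)
  have bc: "b n \<in> words (carrier S)" "c n \<in> words (carrier S)" using assms by auto
  show ?case using bc Suc nest_words[OF assms(1,3,4), of n] nest_del_words[OF assms, of n]
    by (simp add: val_nest[OF assms(1,3,4)] val_app del: append_assoc)
qed simp

lemma recurrent_nonempty: "recurrent_language L \<Longrightarrow> (\<And>w. w \<in> L \<Longrightarrow> geodesic X w) \<Longrightarrow> \<exists>x\<in>X. [x] \<in> L"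
proof -
  assume L: "recurrent_language L" and g: "\<And>w. w \<in> L \<Longrightarrow> geodesic X w"
  obtain w where w: "w \<in> L" "length w = 1"
    using L unbounded_length[of L 1] by (auto simp: recurrent_language_def)
  then obtain x where "w = [x]" by (cases w) auto
  then show ?thesis using w g[OF w(1)] by (auto simp: geodesic_def)
qed

lemma recurrent_nest_words:
  assumes L: "recurrent_language L" and geo: "\<And>w. w \<in> L \<Longrightarrow> geodesic X w" and y: "y \<in> L" "y \<noteq> []"
  shows "\<exists>b c. range b \<subseteq> words X \<and> range c \<subseteq> words X \<and> nest (@) y b c N \<in> L"
proof -
  obtain b c where bc: "\<And>i. b i \<noteq> [] \<and> c i \<noteq> []" "nest (@) y b c N \<in> L"
    using recurrent_nest[OF L y(1)] by blast
  have yX: "y \<in> words X" using geo[OF y(1)] y(2) by (simp add: geodesic_def words_def)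
  \<comment> \<open>\<open>nest\<close> only looks at indices below \<open>N\<close>; the default
    value \<open>y\<close> turns the other entries into words over \<open>X\<close> as well.\<close>
  define b' where "b' i = (if i < N then b i else y)" for i
  define c' where "c' i = (if i < N then c i else y)" for i
  have eq: "nest (@) y b c N = nest (@) y b' c' N" by (rule nest_cong) (simp add: b'_def c'_def)
  have sub: "set (b i) \<subseteq> set (nest (@) y b c n) \<and> set (c i) \<subseteq> set (nest (@) y b c n)" if "i < n" for i n
    using that by (induction n) (auto simp: less_Suc_eq)
  have "set (nest (@) y b c N) \<subseteq> X" using geo[OF bc(2)] by (simp add: geodesic_def)
  then have "range b' \<subseteq> words X" "range c' \<subseteq> words X"
    using sub[of _ N] bc(1) yX by (auto simp: b'_def c'_def words_def)
  then show ?thesis using bc(2) unfolding eq by blast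
qed

lemma satisfies_eval:
  "satisfies S (s, t) \<Longrightarrow> range \<rho> \<subseteq> carrier S \<Longrightarrow> eval S \<rho> s = eval S \<rho> t"
  by (simp add: satisfies_def)

text \<open>An instance of the identity rewrites a geodesic of the recurrent language into a
  strictly shorter word with the same value.\<close>

lemma deletion_identity_finite:
  assumes sat: "satisfies S (deletion_identity N)" and X: "finite X" "X \<subseteq> carrier S" "generated S X = carrier S"
  shows "finite (carrier S)"
proof (rule ccontr)
  assume "infinite (carrier S)"
  then obtain L where L: "recurrent_language L" and geo: "\<And>w. w \<in> L \<Longrightarrow> geodesic X w"
    using exists_recurrent_geodesics[OF X] by blast
  note fac = recurrent_factorial[OF L]
  obtain x where x: "x \<in> X" "[x] \<in> L" using recurrent_nonempty[OF L geo] by blast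
  obtain a where a: "1 \<le> length a" "[x] @ a @ [x] \<in> L" using recurrent_return[OF L x(2), of 1] by blast
  let ?u = "[x] @ a @ [x]"
  \<comment> \<open>The surroundings of the middle copy of \<open>?u\<close> supply nonempty words
    for \<open>p\<close> and \<open>q\<close>.\<close>
  obtain r s where rs: "r \<noteq> []" "s \<noteq> []" "?u @ r @ ?u @ s @ ?u \<in> L"
    using recurrent_return2[OF L a(2)] by blast
  define p where "p = ?u @ r"
  define q where "q = s @ ?u"
  define y where "y = p @ [x] @ a @ [x] @ q"
  define d where "d = p @ [x] @ q"
  have y: "y \<in> L" using rs(3) by (simp add: y_def p_def q_def)
  have yne: "y \<noteq> []" by (simp add: y_def)
  obtain b' c' where b'X: "range b' \<subseteq> words X" "range c' \<subseteq> words X" and nL: "nest (@) y b' c' N \<in> L"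
    using recurrent_nest_words[OF L geo y, of N] yne by blast
  have wX: "words X \<subseteq> words (carrier S)" using X by (auto simp: words_def)
  have "set y \<subseteq> X" using geo[OF y] by (simp add: geodesic_def)
  then have w: "p \<in> words X" "a \<in> words X" "q \<in> words X" "y \<in> words X" "d \<in> words X" "[x] \<in> words X"
    using a rs by (auto simp: words_def y_def d_def p_def q_def)
  then have w': "p \<in> words (carrier S)" "a \<in> words (carrier S)" "q \<in> words (carrier S)"
    "y \<in> words (carrier S)" "d \<in> words (carrier S)" "[x] \<in> words (carrier S)" using wX by auto
  have bS: "range b' \<subseteq> words (carrier S)" "range c' \<subseteq> words (carrier S)" using b'X wX by auto
  define \<rho> where "\<rho> n = (if n = 0 then x else if n = 1 then val a else if n = 2 then val p else if n = 3 then val q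
     else if even n then val (b' ((n - 4) div 2)) else val (c' ((n - 5) div 2)))" for n :: nat
  have "\<rho> n \<in> carrier S" for n
  proof -
    have "val (b' i) \<in> carrier S" "val (c' i) \<in> carrier S" for i
      using bS by (auto simp: image_subset_iff)
    then show ?thesis using x X w' by (auto simp: \<rho>_def)
  qed
  then have r: "range \<rho> \<subseteq> carrier S" by auto
  have \<rho>s: "\<rho> 0 = x" "\<rho> (Suc 0) = val a" "\<rho> 2 = val p" "\<rho> 3 = val q"
    "\<And>i. \<rho> (4 + 2 * i) = val (b' i)" "\<And>i. \<rho> (5 + 2 * i) = val (c' i)"
    by (auto simp: \<rho>_def)
  have vy: "val y = factor5 (\<boxdot>) (val p) x (val a) (val q)"
    and vd: "val d = val p \<boxdot> x \<boxdot> val q"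
    using w' X x by (simp_all add: y_def d_def factor5_def val_app times_assoc subset_iff del: append.append_Cons)
  have "nest (\<boxdot>) (val y) (\<lambda>i. val (b' i)) (\<lambda>i. val (c' i)) N
      = nest_del (\<boxdot>) (val y) (val d) (\<lambda>i. val (b' i)) (\<lambda>i. val (c' i)) N"
    using sat r unfolding deletion_identity_def Let_def
    by (auto dest!: satisfies_eval simp: eval_nest eval_nest_del \<rho>s factor5_def vy vd)
  then have "val (nest_del (@) y d b' c' N) = val (nest (@) y b' c' N)"
    using w' bS by (simp add: val_nest val_nest_del)
  moreover have "nest_del (@) y d b' c' N \<in> words X" "nest (@) y b' c' N \<noteq> []"
    using nest_del_words[OF w(4,5) b'X] nest_words[OF w(4) b'X] by (auto simp: words_def)
  ultimately have "length (nest (@) y b' c' N) \<le> length (nest_del (@) y d b' c' N)"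
    using geo[OF nL] unfolding geodesic_def by blast
  moreover have "length d < length y" by (simp add: d_def y_def)
  ultimately show False using length_nest_del[of d y b' c' N] by simp
qed

end

lemma deletion_identity_not_inherently_nonfinitely_based:
  assumes "ai_semiring S" "satisfies S (deletion_identity N)"
  shows "\<not> inherently_nonfinitely_based S"
proof (rule not_inherently_nonfinitely_based[OF assms(1), of "{deletion_identity N}"])
  fix A :: "nat binalg"
  assume A: "ai_semiring A" "\<And>e. e \<in> {deletion_identity N} \<Longrightarrow> satisfies A e" "finitely_generated A"
  then interpret ai_semiring A by simp
  show "finite (carrier A)" using A deletion_identity_finite unfolding finitely_generated_def by blast
qed (use assms in auto)

section \<open>Compatible orders and the two situations in which a deletion identity holds\<close>

context ai_semiring
begin

abbreviation le (infix "\<preceq>" 50) where "x \<preceq> y \<equiv> x \<boxplus> y = y"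

text \<open>An abstract \<open>R\<close> allows each argument to be given once and used for the
  additive order and for its dual.\<close>

definition compatible_order :: "('a \<Rightarrow> 'a \<Rightarrow> bool) \<Rightarrow> bool" where
  "compatible_order R \<longleftrightarrow>
     (\<forall>x\<in>carrier S. R x x) \<and>
     (\<forall>x\<in>carrier S. \<forall>y\<in>carrier S. R x y \<longrightarrow> R y x \<longrightarrow> x = y) \<and>
     (\<forall>x\<in>carrier S. \<forall>y\<in>carrier S. \<forall>z\<in>carrier S. R x y \<longrightarrow> R y z \<longrightarrow> R x z) \<and>
     (\<forall>x\<in>carrier S. \<forall>y\<in>carrier S. \<forall>z\<in>carrier S. R x y \<longrightarrow> R (z \<boxdot> x) (z \<boxdot> y) \<and> R (x \<boxdot> z) (y \<boxdot> z))"

lemma compatible_orderD: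
  assumes "compatible_order R"
  shows "x \<in> carrier S \<Longrightarrow> R x x"
    and "R x y \<Longrightarrow> R y x \<Longrightarrow> x \<in> carrier S \<Longrightarrow> y \<in> carrier S \<Longrightarrow> x = y"
    and "R x y \<Longrightarrow> R y z \<Longrightarrow> x \<in> carrier S \<Longrightarrow> y \<in> carrier S \<Longrightarrow> z \<in> carrier S \<Longrightarrow> R x z"
    and "R x y \<Longrightarrow> x \<in> carrier S \<Longrightarrow> y \<in> carrier S \<Longrightarrow> z \<in> carrier S \<Longrightarrow> R (z \<boxdot> x) (z \<boxdot> y)"
    and "R x y \<Longrightarrow> x \<in> carrier S \<Longrightarrow> y \<in> carrier S \<Longrightarrow> z \<in> carrier S \<Longrightarrow> R (x \<boxdot> z) (y \<boxdot> z)"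
proof -
  note a = assms[unfolded compatible_order_def]
  show "x \<in> carrier S \<Longrightarrow> R x x" by (rule bspec[OF conjunct1[OF a]])
  show "R x y \<Longrightarrow> R y x \<Longrightarrow> x \<in> carrier S \<Longrightarrow> y \<in> carrier S \<Longrightarrow> x = y"
    by (rule a[THEN conjunct2, THEN conjunct1, rule_format])
  show "R x y \<Longrightarrow> R y z \<Longrightarrow> x \<in> carrier S \<Longrightarrow> y \<in> carrier S \<Longrightarrow> z \<in> carrier S \<Longrightarrow> R x z"
    by (rule a[THEN conjunct2, THEN conjunct2, THEN conjunct1, rule_format])
  show "R x y \<Longrightarrow> x \<in> carrier S \<Longrightarrow> y \<in> carrier S \<Longrightarrow> z \<in> carrier S \<Longrightarrow> R (z \<boxdot> x) (z \<boxdot> y)"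
    by (rule a[THEN conjunct2, THEN conjunct2, THEN conjunct2, rule_format, THEN conjunct1])
  show "R x y \<Longrightarrow> x \<in> carrier S \<Longrightarrow> y \<in> carrier S \<Longrightarrow> z \<in> carrier S \<Longrightarrow> R (x \<boxdot> z) (y \<boxdot> z)"
    by (rule a[THEN conjunct2, THEN conjunct2, THEN conjunct2, rule_format, THEN conjunct2])
qed

lemma compatible_le: "compatible_order (\<preceq>)"
  unfolding compatible_order_def
proof (intro conjI ballI impI)
  show "x \<preceq> x" if "x \<in> carrier S" for x using that by (rule plus_idem)
  fix x y assume xy: "x \<in> carrier S" "y \<in> carrier S" "x \<preceq> y"
  show "x = y" if "y \<preceq> x" using that xy plus_comm by metis
  fix z assume z: "z \<in> carrier S"
  show "x \<preceq> z" if "y \<preceq> z" using that xy z plus_assoc by metis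
  show "z \<boxdot> x \<preceq> z \<boxdot> y" using xy z by (simp flip: distrib_left)
  show "x \<boxdot> z \<preceq> y \<boxdot> z" using xy z by (simp flip: distrib_right)
qed

lemma compatible_ge: "compatible_order (\<lambda>x y. y \<preceq> x)"
  unfolding compatible_order_def
proof (intro conjI ballI impI)
  note Rs = compatible_orderD[OF compatible_le]
  show "x \<preceq> x" if "x \<in> carrier S" for x using that by (rule Rs(1))
  fix x y assume xy: "x \<in> carrier S" "y \<in> carrier S" "y \<preceq> x"
  show "x = y" if "x \<preceq> y" using Rs(2)[OF that xy(3)] xy(1,2) .
  fix z assume z: "z \<in> carrier S"
  show "z \<preceq> x" if "z \<preceq> y" using Rs(3)[OF that xy(3)] xy z by simp
  show "z \<boxdot> y \<preceq> z \<boxdot> x" "y \<boxdot> z \<preceq> x \<boxdot> z"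
    using Rs(4)[OF xy(3) xy(2,1) z] Rs(5)[OF xy(3) xy(2,1) z] .
qed

lemma pigeonhole:
  fixes h :: "nat \<Rightarrow> 'a"
  assumes "finite (carrier S)" "range h \<subseteq> carrier S"
  shows "\<exists>i j. i < j \<and> j \<le> card (carrier S) \<and> h i = h j"
proof -
  have "card (h ` {..card (carrier S)}) \<le> card (carrier S)" using assms by (intro card_mono) auto
  then have "\<not> inj_on h {..card (carrier S)}" by (intro notI) (simp add: card_image)
  then obtain i j where "i \<le> card (carrier S)" "j \<le> card (carrier S)" "i \<noteq> j" "h i = h j"
    by (auto simp: inj_on_def)
  then show ?thesis by (metis linorder_neqE_nat)
qed

lemma nest_del_eq_mono:
  "nest_del f y d b c i = nest f y b c i \<Longrightarrow> i \<le> n \<Longrightarrow> nest_del f y d b c n = nest f y b c n"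
  by (induction n) (auto simp: le_Suc_eq)

text \<open>A deletion that is invisible at one level remains so at all later ones, hence the level
  may depend on the assignment.\<close>

lemma satisfies_deletion_identity:
  assumes "\<And>p x a q b c. \<lbrakk>p \<in> carrier S; x \<in> carrier S; a \<in> carrier S; q \<in> carrier S;
      range b \<subseteq> carrier S; range c \<subseteq> carrier S\<rbrakk> \<Longrightarrow>
    \<exists>i\<le>N. nest_del (\<boxdot>) (factor5 (\<boxdot>) p x a q) (p \<boxdot> x \<boxdot> q) b c i = nest (\<boxdot>) (factor5 (\<boxdot>) p x a q) b c i"
  shows "satisfies S (deletion_identity N)"
  unfolding satisfies_def
proof (intro allI impI)
  fix \<rho> :: "nat \<Rightarrow> 'a" assume r: "range \<rho> \<subseteq> carrier S"
  then have v: "\<rho> n \<in> carrier S" for n by auto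
  let ?y = "factor5 (\<boxdot>) (\<rho> 2) (\<rho> 0) (\<rho> 1) (\<rho> 3)"
  let ?d = "\<rho> 2 \<boxdot> \<rho> 0 \<boxdot> \<rho> 3"
  have "\<exists>i\<le>N. nest_del (\<boxdot>) ?y ?d (\<lambda>i. \<rho> (4 + 2 * i)) (\<lambda>i. \<rho> (5 + 2 * i)) i
      = nest (\<boxdot>) ?y (\<lambda>i. \<rho> (4 + 2 * i)) (\<lambda>i. \<rho> (5 + 2 * i)) i"
    by (rule assms) (auto simp: v)
  then have "nest_del (\<boxdot>) ?y ?d (\<lambda>i. \<rho> (4 + 2 * i)) (\<lambda>i. \<rho> (5 + 2 * i)) N
      = nest (\<boxdot>) ?y (\<lambda>i. \<rho> (4 + 2 * i)) (\<lambda>i. \<rho> (5 + 2 * i)) N"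
    by (elim exE conjE) (rule nest_del_eq_mono)
  then show "eval S \<rho> (fst (deletion_identity N)) = eval S \<rho> (snd (deletion_identity N))"
    by (simp add: deletion_identity_def Let_def eval_nest eval_nest_del factor5_def)
qed

text \<open>The altered pattern \<open>D (Suc i)\<close> is squeezed between
  \<open>Y (Suc i)\<close> and \<open>Y i\<close>. The sequence \<open>Y\<close> is monotone in a
  finite set, so two consecutive terms agree.\<close>

lemma satisfies_deletion_of_decreasing:
  assumes fin: "finite (carrier S)" and R: "compatible_order R"
    and dec: "\<And>x y. x \<in> carrier S \<Longrightarrow> y \<in> carrier S \<Longrightarrow> R (x \<boxdot> y) x \<and> R (x \<boxdot> y) y"
  shows "satisfies S (deletion_identity (card (carrier S)))"
proof (rule satisfies_deletion_identity)
  fix p x a q :: 'a and b c :: "nat \<Rightarrow> 'a"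
  assume c: "p \<in> carrier S" "x \<in> carrier S" "a \<in> carrier S" "q \<in> carrier S"
    "range b \<subseteq> carrier S" "range c \<subseteq> carrier S"
  have bc: "b i \<in> carrier S" "c i \<in> carrier S" for i using c by auto
  note Rs = compatible_orderD[OF R]
  define Y where "Y = nest (\<boxdot>) (factor5 (\<boxdot>) p x a q) b c"
  define D where "D = nest_del (\<boxdot>) (factor5 (\<boxdot>) p x a q) (p \<boxdot> x \<boxdot> q) b c"
  have YD [simp]: "Y i \<in> carrier S" "D i \<in> carrier S" for i using c by (simp_all add: Y_def D_def factor5_def)
  have Y_Suc: "Y (Suc i) = Y i \<boxdot> b i \<boxdot> Y i \<boxdot> c i \<boxdot> Y i"
    and D_Suc: "D (Suc i) = Y i \<boxdot> b i \<boxdot> D i \<boxdot> c i \<boxdot> Y i" for i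
    by (simp_all add: Y_def D_def)
  have 1: "R (Y i) (D i)" for i
  proof (induction i)
    case 0
    have "R (p \<boxdot> x \<boxdot> a \<boxdot> x) (p \<boxdot> x)"
      using dec[of "p \<boxdot> x \<boxdot> a" x] dec[of "p \<boxdot> x" a] c
        Rs(3)[of "p \<boxdot> x \<boxdot> a \<boxdot> x" "p \<boxdot> x \<boxdot> a" "p \<boxdot> x"] by simp
    then show ?case using c by (simp add: Y_def D_def factor5_def Rs(5))
  next
    case (Suc i)
    then have "R (Y i \<boxdot> b i \<boxdot> Y i) (Y i \<boxdot> b i \<boxdot> D i)" using bc by (intro Rs(4)) auto
    then show ?case unfolding Y_Suc D_Suc using bc by (intro Rs(5)) auto
  qed
  have 2: "R (D (Suc i)) (Y i)" for i
    unfolding D_Suc using dec bc by simp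
  have 3: "R (Y (i + k)) (Y i)" for i k
  proof (induction k)
    case 0 show ?case by (simp add: Rs(1))
  next
    case (Suc k)
    have "R (Y (Suc (i + k))) (Y (i + k))" using Rs(3)[OF 1 2] by simp
    then show ?case using Rs(3)[OF _ Suc.IH] by simp
  qed
  obtain i j where ij: "i < j" "j \<le> card (carrier S)" "Y i = Y j"
    using pigeonhole[OF fin, of Y] YD(1) by (metis image_subsetI)
  \<comment> \<open>\<open>Y (Suc i)\<close> lies between \<open>Y j\<close> and \<open>Y i\<close>,
    which are equal.\<close>
  have "R (Y i) (Y (Suc i))" using 3[of "Suc i" "j - Suc i"] ij by simp
  then have "R (D (Suc i)) (Y (Suc i))" using Rs(3)[OF 2] by simp
  then have "D (Suc i) = Y (Suc i)" using Rs(2) 1 by simp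
  then show "\<exists>i\<le>card (carrier S). nest_del (\<boxdot>) (factor5 (\<boxdot>) p x a q) (p \<boxdot> x \<boxdot> q) b c i
      = nest (\<boxdot>) (factor5 (\<boxdot>) p x a q) b c i"
    using ij unfolding Y_def D_def by (intro exI[of _ "Suc i"]) auto
qed

lemma spow_closed [simp]: "x \<in> carrier S \<Longrightarrow> spow (\<boxdot>) x n \<in> carrier S"
  by (induction n) auto

text \<open>Whichever way \<open>k\<close> compares with its square, the powers of \<open>k\<close>
  form a monotone sequence in a finite set.\<close>

lemma aperiodic_of_total:
  assumes fin: "finite (carrier S)"
    and tot: "\<And>x y. x \<in> carrier S \<Longrightarrow> y \<in> carrier S \<Longrightarrow> x \<preceq> y \<or> y \<preceq> x"
    and k: "k \<in> carrier S"
  shows "\<exists>n. spow (\<boxdot>) k n \<boxdot> k = spow (\<boxdot>) k n"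
proof -
  have main: "\<exists>n. spow (\<boxdot>) k n \<boxdot> k = spow (\<boxdot>) k n" if R: "compatible_order R" and kk: "R k (k \<boxdot> k)" for R
  proof -
    note Rs = compatible_orderD[OF R]
    have 1: "R (spow (\<boxdot>) k n) (spow (\<boxdot>) k (Suc n))" for n
    proof (induction n)
      case (Suc n)
      then show ?case using k Rs(5)[of "spow (\<boxdot>) k n" "spow (\<boxdot>) k (Suc n)" k] by simp
    qed (use kk in simp)
    have 2: "R (spow (\<boxdot>) k n) (spow (\<boxdot>) k (n + m))" for n m
    proof (induction m)
      case 0 show ?case using k by (simp add: Rs(1))
    next
      case (Suc m)
      then show ?case using Rs(3)[OF _ 1[of "n + m"]] k by simp
    qed
    obtain i j where ij: "i < j" "spow (\<boxdot>) k i = spow (\<boxdot>) k j"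
      using pigeonhole[OF fin, of "spow (\<boxdot>) k"] k by (metis image_subsetI spow_closed)
    have "R (spow (\<boxdot>) k (Suc i)) (spow (\<boxdot>) k i)" using 2[of "Suc i" "j - Suc i"] ij by simp
    then have "spow (\<boxdot>) k (Suc i) = spow (\<boxdot>) k i" using 1 k by (intro Rs(2)) auto
    then show ?thesis by auto
  qed
  show ?thesis
    using main[OF compatible_le] main[OF compatible_ge] tot[of k "k \<boxdot> k"] k by auto
qed

text \<open>For \<open>f = v w\<close> and \<open>g = w v\<close> the element \<open>k = f g w\<close> lies in the monoid \<open>f S f\<close>, and comparing \<open>x\<close>
  with \<open>f g x\<close> yields a one-sided inverse of \<open>k\<close>. By aperiodicity \<open>k = f\<close>, that is \<open>f g = f v\<close>.\<close>

lemma chain_absorb: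
  assumes fin: "finite (carrier S)"
    and tot: "\<And>x y. x \<in> carrier S \<Longrightarrow> y \<in> carrier S \<Longrightarrow> x \<preceq> y \<or> y \<preceq> x"
    and c: "x \<in> carrier S" "a \<in> carrier S" "w' \<in> carrier S" "U \<in> carrier S" "V \<in> carrier S"
    and vw: "v = x \<boxdot> a" "w = x \<boxdot> w'" and wvw: "w \<boxdot> v \<boxdot> w = w"
    and U: "U \<boxdot> v \<boxdot> w = U" and V: "w \<boxdot> v \<boxdot> V = V"
  shows "U \<boxdot> v \<boxdot> V = U \<boxdot> V"
proof -
  define f where "f = v \<boxdot> w"
  define g where "g = w \<boxdot> v"
  define k where "k = f \<boxdot> g \<boxdot> w"
  have c' [simp]: "v \<in> carrier S" "w \<in> carrier S" "f \<in> carrier S" "g \<in> carrier S" "k \<in> carrier S"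
    using c by (auto simp: vw f_def g_def k_def)
  note c [simp]
  have wvw': "w \<boxdot> (v \<boxdot> w) = w" "\<And>y. y \<in> carrier S \<Longrightarrow> w \<boxdot> (v \<boxdot> (w \<boxdot> y)) = w \<boxdot> y"
    using wvw by (simp_all flip: times_assoc)
  have ff: "f \<boxdot> f = f" and gg: "g \<boxdot> g = g" by (simp_all add: f_def g_def times_assoc wvw')
  have fk: "f \<boxdot> k = k" and kf: "k \<boxdot> f = k"
    by (simp_all add: k_def f_def g_def times_assoc wvw')
  have vgw: "v \<boxdot> g \<boxdot> w = f" by (simp add: f_def g_def times_assoc wvw')
  have fxu: "f \<boxdot> x \<boxdot> (a \<boxdot> w) = f"
  proof -
    have "f \<boxdot> x \<boxdot> (a \<boxdot> w) = f \<boxdot> f" unfolding f_def by (simp add: vw(1) times_assoc)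
    then show ?thesis by (simp add: ff)
  qed
  have gxu: "g \<boxdot> x \<boxdot> (w' \<boxdot> v) = g"
  proof -
    have "g \<boxdot> x \<boxdot> (w' \<boxdot> v) = g \<boxdot> g" by (simp add: g_def vw(2) times_assoc c vw(1))
    then show ?thesis by (simp add: gg)
  qed
  obtain n where n: "spow (\<boxdot>) k n \<boxdot> k = spow (\<boxdot>) k n" using aperiodic_of_total[OF fin tot c'(5)] by metis
  have pk: "spow (\<boxdot>) k i \<boxdot> f = spow (\<boxdot>) k i" "f \<boxdot> spow (\<boxdot>) k i = spow (\<boxdot>) k i"
    "spow (\<boxdot>) k i \<boxdot> k = k \<boxdot> spow (\<boxdot>) k i" for i
    by (induction i) (simp_all add: fk kf times_assoc, simp_all flip: times_assoc add: fk)
  \<comment> \<open>An aperiodic unit is trivial: a one-sided inverse of \<open>k\<close> yields one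
    for every power of \<open>k\<close>, and with it the power can be cancelled from
    \<open>spow (\<boxdot>) k n \<boxdot> k = spow (\<boxdot>) k n\<close>.\<close>
  have right: "k = f" if Y: "Y \<in> carrier S" "k \<boxdot> Y = f" for Y
  proof -
    have "\<exists>Z\<in>carrier S. spow (\<boxdot>) k i \<boxdot> Z = f" for i
    proof (induction i)
      case 0 show ?case using Y by auto
    next
      case (Suc i)
      then obtain Z where Z: "Z \<in> carrier S" "spow (\<boxdot>) k i \<boxdot> Z = f" by blast
      have "spow (\<boxdot>) k (Suc i) \<boxdot> (Y \<boxdot> Z) = spow (\<boxdot>) k i \<boxdot> (k \<boxdot> Y) \<boxdot> Z"
        using Y(1) Z(1) by (simp add: times_assoc)
      also have "\<dots> = f" using Y(2) Z pk(1) by simp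
      finally show ?case using Y Z by (intro bexI[of _ "Y \<boxdot> Z"]) auto
    qed
    then obtain Z where Z: "Z \<in> carrier S" "spow (\<boxdot>) k n \<boxdot> Z = f" by blast
    have "k \<boxdot> f = f" using n pk(3)[of n] Z by (metis c'(5) spow_closed times_assoc)
    then show ?thesis by (simp add: kf)
  qed
  have left: "k = f" if Y: "Y \<in> carrier S" "Y \<boxdot> k = f" for Y
  proof -
    have "\<exists>Z\<in>carrier S. Z \<boxdot> spow (\<boxdot>) k i = f" for i
    proof (induction i)
      case 0 show ?case using Y by auto
    next
      case (Suc i)
      then obtain Z where Z: "Z \<in> carrier S" "Z \<boxdot> spow (\<boxdot>) k i = f" by blast
      have "(Y \<boxdot> Z) \<boxdot> spow (\<boxdot>) k (Suc i) = Y \<boxdot> (Z \<boxdot> spow (\<boxdot>) k i) \<boxdot> k"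
        using Y(1) Z(1) by (simp add: times_assoc)
      also have "\<dots> = f" using Y Z by (simp add: times_assoc fk)
      finally show ?case using Y Z by (intro bexI[of _ "Y \<boxdot> Z"]) auto
    qed
    then obtain Z where Z: "Z \<in> carrier S" "Z \<boxdot> spow (\<boxdot>) k n = f" by blast
    have "f \<boxdot> k = f" using n Z by (metis c'(5) spow_closed times_assoc)
    then show ?thesis by (simp add: fk)
  qed
  have case1: "k = f" if "f \<boxdot> x = f \<boxdot> g \<boxdot> x"
  proof (rule right)
    have kv: "k \<boxdot> v = f \<boxdot> g" by (simp add: k_def g_def times_assoc wvw')
    have "k \<boxdot> (v \<boxdot> x \<boxdot> (a \<boxdot> w)) = (k \<boxdot> v) \<boxdot> x \<boxdot> (a \<boxdot> w)" by (simp add: times_assoc)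
    also have "\<dots> = f \<boxdot> g \<boxdot> x \<boxdot> (a \<boxdot> w)" by (simp only: kv)
    also have "\<dots> = f" using that fxu by simp
    finally show "k \<boxdot> (v \<boxdot> x \<boxdot> (a \<boxdot> w)) = f" .
  qed simp
  have case2: "k = f" if "g = g \<boxdot> f \<boxdot> g"
  proof (rule left)
    have "(v \<boxdot> g) \<boxdot> k = v \<boxdot> (g \<boxdot> f \<boxdot> g) \<boxdot> w" by (simp add: k_def times_assoc)
    then show "(v \<boxdot> g) \<boxdot> k = f" using that vgw by simp
  qed simp
  \<comment> \<open>The two possible comparisons of \<open>f\<close> with \<open>g\<close> are
    exchanged by passing to the dual order.\<close>
  have main: "k = f" if R: "compatible_order R" and gf: "R g f"
    and cmp: "R x (f \<boxdot> g \<boxdot> x) \<or> R (f \<boxdot> g \<boxdot> x) x" for R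
  proof -
    note Rs = compatible_orderD[OF R]
    from cmp show ?thesis
    proof
      assume "R x (f \<boxdot> g \<boxdot> x)"
      then have "R (f \<boxdot> x) (f \<boxdot> (f \<boxdot> g \<boxdot> x))" by (intro Rs(4)) auto
      moreover have "f \<boxdot> (f \<boxdot> g \<boxdot> x) = f \<boxdot> g \<boxdot> x" using ff by (simp flip: times_assoc)
      moreover have "R (f \<boxdot> g \<boxdot> x) (f \<boxdot> f \<boxdot> x)" using gf by (intro Rs(4,5)) auto
      ultimately have "f \<boxdot> x = f \<boxdot> g \<boxdot> x" using ff by (intro Rs(2)) auto
      then show ?thesis by (rule case1)
    next
      assume "R (f \<boxdot> g \<boxdot> x) x"
      then have "R (g \<boxdot> (f \<boxdot> g \<boxdot> x) \<boxdot> (w' \<boxdot> v)) (g \<boxdot> x \<boxdot> (w' \<boxdot> v))" by (intro Rs(4,5)) auto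
      moreover have "g \<boxdot> (f \<boxdot> g \<boxdot> x) \<boxdot> (w' \<boxdot> v) = g \<boxdot> f \<boxdot> (g \<boxdot> x \<boxdot> (w' \<boxdot> v))"
        by (simp add: times_assoc)
      ultimately have "R (g \<boxdot> f \<boxdot> g) g" by (simp only: gxu)
      moreover have "R (g \<boxdot> g \<boxdot> g) (g \<boxdot> f \<boxdot> g)" using gf by (intro Rs(4,5)) auto
      ultimately have "g \<boxdot> f \<boxdot> g = g" using gg by (intro Rs(2)) auto
      then show ?thesis by (intro case2) simp
    qed
  qed
  have "k = f"
    using main[OF compatible_le] main[OF compatible_ge] tot[of f g] tot[of x "f \<boxdot> g \<boxdot> x"] by auto
  moreover have "f \<boxdot> g = k \<boxdot> v" by (simp add: k_def g_def times_assoc wvw')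
  ultimately have fg: "f \<boxdot> g = f \<boxdot> v" by simp
  \<comment> \<open>\<open>U\<close> absorbs \<open>f\<close> on its right and \<open>V\<close>
    absorbs \<open>g\<close> on its left, so \<open>f \<boxdot> g = f \<boxdot> v\<close> can be
    read between them.\<close>
  have "U \<boxdot> f = U" "g \<boxdot> V = V" using U V by (simp_all add: f_def g_def times_assoc)
  then have "U \<boxdot> V = U \<boxdot> (f \<boxdot> g) \<boxdot> V" "U \<boxdot> v \<boxdot> V = U \<boxdot> (f \<boxdot> v) \<boxdot> V"
    by (simp_all flip: times_assoc) (simp_all add: times_assoc)
  then show ?thesis by (simp only: fg)
qed

text \<open>The property \<open>P\<close> is trivial when the order is a chain; in the flat case it
  records that the factors are cancellative.\<close>

lemma nest_decompose:
  assumes c: "p \<in> carrier S" "x \<in> carrier S" "a \<in> carrier S" "q \<in> carrier S"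
      "range b \<subseteq> carrier S" "range c \<subseteq> carrier S"
    and P: "P p" "P q" "\<And>u v. P u \<Longrightarrow> P v \<Longrightarrow> P (u \<boxdot> v)"
      "\<And>i. i < n \<Longrightarrow> P (b i)" "\<And>i. i < n \<Longrightarrow> P (c i)" "P x" "P a"
  shows "\<exists>p'\<in>carrier S. \<exists>q'\<in>carrier S. P p' \<and> P q' \<and>
    nest (\<boxdot>) (factor5 (\<boxdot>) p x a q) b c n = p' \<boxdot> x \<boxdot> a \<boxdot> x \<boxdot> q' \<and>
    nest_del (\<boxdot>) (factor5 (\<boxdot>) p x a q) (p \<boxdot> x \<boxdot> q) b c n = p' \<boxdot> x \<boxdot> q'"
  using P(4,5)
proof (induction n)
  case 0
  then show ?case using c P(1,2) by (intro bexI[of _ p] bexI[of _ q]) (auto simp: factor5_def)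
next
  case (Suc n)
  let ?Y = "nest (\<boxdot>) (factor5 (\<boxdot>) p x a q) b c n"
  obtain p' q' where pq: "p' \<in> carrier S" "q' \<in> carrier S" "P p'" "P q'"
    "?Y = p' \<boxdot> x \<boxdot> a \<boxdot> x \<boxdot> q'"
    "nest_del (\<boxdot>) (factor5 (\<boxdot>) p x a q) (p \<boxdot> x \<boxdot> q) b c n = p' \<boxdot> x \<boxdot> q'"
    using Suc by (auto simp del: nest.simps nest_del.simps)
  have bc: "b n \<in> carrier S" "c n \<in> carrier S" using c by auto
  have Y: "?Y \<in> carrier S" "P ?Y" using c pq P by (auto simp: factor5_def)
  have Pbc: "P (b n)" "P (c n)" using Suc.prems by auto
  define p'' where "p'' = ?Y \<boxdot> b n \<boxdot> p'"
  define q'' where "q'' = q' \<boxdot> c n \<boxdot> ?Y"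
  have "P p''" "P q''" using pq(3,4) Y(2) Pbc P(3) by (simp_all add: p''_def q''_def)
  moreover have "p'' \<in> carrier S" "q'' \<in> carrier S" using pq(1,2) Y(1) bc by (simp_all add: p''_def q''_def)
  moreover have "nest (\<boxdot>) (factor5 (\<boxdot>) p x a q) b c (Suc n) = ?Y \<boxdot> b n \<boxdot> (p' \<boxdot> x \<boxdot> a \<boxdot> x \<boxdot> q') \<boxdot> c n \<boxdot> ?Y"
    by (simp flip: pq(5))
  then have "nest (\<boxdot>) (factor5 (\<boxdot>) p x a q) b c (Suc n) = p'' \<boxdot> x \<boxdot> a \<boxdot> x \<boxdot> q''"
    using pq(1,2) Y(1) bc c by (simp add: p''_def q''_def times_assoc)
  moreover have "nest_del (\<boxdot>) (factor5 (\<boxdot>) p x a q) (p \<boxdot> x \<boxdot> q) b c (Suc n)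
      = ?Y \<boxdot> b n \<boxdot> (p' \<boxdot> x \<boxdot> q') \<boxdot> c n \<boxdot> ?Y"
    by (simp flip: pq(6))
  then have "nest_del (\<boxdot>) (factor5 (\<boxdot>) p x a q) (p \<boxdot> x \<boxdot> q) b c (Suc n) = p'' \<boxdot> x \<boxdot> q''"
    using pq(1,2) Y(1) bc c by (simp add: p''_def q''_def times_assoc)
  ultimately show ?case by blast
qed

lemma nest_nest:
  assumes c: "y \<in> carrier S" "d \<in> carrier S" "range b \<subseteq> carrier S" "range c \<subseteq> carrier S"
    and P: "\<And>u v. P u \<Longrightarrow> P v \<Longrightarrow> P (u \<boxdot> v)" "\<And>i. i < j \<Longrightarrow> P (b i)" "\<And>i. i < j \<Longrightarrow> P (c i)" "P y"
    and "i < j"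
  shows "\<exists>s\<in>carrier S. \<exists>t\<in>carrier S. P s \<and> P t \<and>
    nest (\<boxdot>) y b c j = nest (\<boxdot>) y b c i \<boxdot> s \<boxdot> nest (\<boxdot>) y b c i \<boxdot> t \<boxdot> nest (\<boxdot>) y b c i \<and>
    nest_del (\<boxdot>) y d b c j = nest (\<boxdot>) y b c i \<boxdot> s \<boxdot> nest_del (\<boxdot>) y d b c i \<boxdot> t \<boxdot> nest (\<boxdot>) y b c i"
  using \<open>i < j\<close> P(2,3)
proof (induction j)
  case (Suc j)
  have bc: "b j \<in> carrier S" "c j \<in> carrier S" "P (b j)" "P (c j)" using c Suc.prems by auto
  let ?Y = "nest (\<boxdot>) y b c i" and ?D = "nest_del (\<boxdot>) y d b c i"
  have YD: "?Y \<in> carrier S" "?D \<in> carrier S" using c by auto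
  have PY: "P (nest (\<boxdot>) y b c k)" if "k \<le> j" for k
    using that by (induction k) (use P(1,4) Suc.prems in auto)
  show ?case
  proof (cases "i = j")
    case True
    then show ?thesis using bc by (intro bexI[of _ "b j"] bexI[of _ "c j"]) auto
  next
    case False
    then have ij: "i < j" using Suc.prems by simp
    obtain s t where st: "s \<in> carrier S" "t \<in> carrier S" "P s" "P t"
      and eq: "nest (\<boxdot>) y b c j = ?Y \<boxdot> s \<boxdot> ?Y \<boxdot> t \<boxdot> ?Y"
        "nest_del (\<boxdot>) y d b c j = ?Y \<boxdot> s \<boxdot> ?D \<boxdot> t \<boxdot> ?Y"
      using Suc.IH[OF ij] Suc.prems by (auto simp del: nest.simps nest_del.simps)
    \<comment> \<open>The relevant copy of level \<open>i\<close> is the middle one in the middle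
      copy of level \<open>j\<close>; \<open>s'\<close> and \<open>t'\<close> collect what separates
      it from the two outermost copies.\<close>
    define s' where "s' = s \<boxdot> ?Y \<boxdot> t \<boxdot> ?Y \<boxdot> b j \<boxdot> ?Y \<boxdot> s"
    define t' where "t' = t \<boxdot> ?Y \<boxdot> c j \<boxdot> ?Y \<boxdot> s \<boxdot> ?Y \<boxdot> t"
    have "P s'" "P t'" using st bc PY[of i] ij P(1) by (auto simp: s'_def t'_def)
    moreover have "s' \<in> carrier S" "t' \<in> carrier S" using st bc YD by (auto simp: s'_def t'_def)
    moreover have "nest (\<boxdot>) y b c (Suc j) = ?Y \<boxdot> s' \<boxdot> ?Y \<boxdot> t' \<boxdot> ?Y"
      using st bc YD by (simp add: eq s'_def t'_def times_assoc)
    moreover have "nest_del (\<boxdot>) y d b c (Suc j) = ?Y \<boxdot> s' \<boxdot> ?D \<boxdot> t' \<boxdot> ?Y"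
      using st bc YD by (simp add: eq s'_def t'_def times_assoc)
    ultimately show ?thesis by (intro bexI[of _ s'] bexI[of _ t']) simp_all
  qed
qed simp

lemma satisfies_deletion_of_total:
  assumes fin: "finite (carrier S)"
    and tot: "\<And>x y. x \<in> carrier S \<Longrightarrow> y \<in> carrier S \<Longrightarrow> x \<preceq> y \<or> y \<preceq> x"
  shows "satisfies S (deletion_identity (card (carrier S)))"
proof (rule satisfies_deletion_identity)
  fix p x a q :: 'a and b c :: "nat \<Rightarrow> 'a"
  assume c: "p \<in> carrier S" "x \<in> carrier S" "a \<in> carrier S" "q \<in> carrier S"
    "range b \<subseteq> carrier S" "range c \<subseteq> carrier S"
  define y where "y = factor5 (\<boxdot>) p x a q"
  define d where "d = p \<boxdot> x \<boxdot> q"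
  have yd: "y \<in> carrier S" "d \<in> carrier S" using c by (auto simp: y_def d_def factor5_def)
  obtain i j where ij: "i < j" "j \<le> card (carrier S)" "nest (\<boxdot>) y b c i = nest (\<boxdot>) y b c j"
    using pigeonhole[OF fin, of "nest (\<boxdot>) y b c"] yd c by (metis image_subsetI nest_closed)
  define A where "A = nest (\<boxdot>) y b c i"
  obtain p' q' where pq: "p' \<in> carrier S" "q' \<in> carrier S" "A = p' \<boxdot> x \<boxdot> a \<boxdot> x \<boxdot> q'"
    "nest_del (\<boxdot>) y d b c i = p' \<boxdot> x \<boxdot> q'"
    using nest_decompose[OF c, of "\<lambda>_. True" i] unfolding A_def y_def d_def by auto
  obtain s t where st: "s \<in> carrier S" "t \<in> carrier S" "A = A \<boxdot> s \<boxdot> A \<boxdot> t \<boxdot> A"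
    "nest_del (\<boxdot>) y d b c j = A \<boxdot> s \<boxdot> nest_del (\<boxdot>) y d b c i \<boxdot> t \<boxdot> A"
    using nest_nest[OF yd c(5,6), of "\<lambda>_. True" j i] ij unfolding A_def by auto
  have A: "A \<in> carrier S" using yd c by (simp add: A_def)
  \<comment> \<open>Writing the middle factor of \<open>A s A t A\<close> as
    \<open>p' x a x q'\<close> shows that \<open>U v V\<close> is \<open>A\<close> again, whereas
    \<open>U V\<close> is the pattern with \<open>v\<close> deleted. The element \<open>w\<close>
    continues from \<open>V\<close> into the next occurrence of \<open>s p'\<close>, which makes
    \<open>v\<close> regular with respect to \<open>w\<close>.\<close>
  define v where "v = x \<boxdot> a"
  define U where "U = A \<boxdot> (s \<boxdot> p')"
  define V where "V = (x \<boxdot> q' \<boxdot> t) \<boxdot> A"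
  define w where "w = V \<boxdot> (s \<boxdot> p')"
  have cl: "v \<in> carrier S" "U \<in> carrier S" "V \<in> carrier S" "w \<in> carrier S" "x \<boxdot> q' \<boxdot> t \<in> carrier S" "s \<boxdot> p' \<in> carrier S"
    using A c pq st by (auto simp: v_def U_def V_def w_def)
  have "U \<boxdot> v \<boxdot> V = A \<boxdot> s \<boxdot> (p' \<boxdot> x \<boxdot> a \<boxdot> x \<boxdot> q') \<boxdot> t \<boxdot> A"
    using A c pq(1,2) st(1,2) by (simp add: U_def V_def v_def times_assoc)
  then have e: "U \<boxdot> v \<boxdot> V = A" using pq(3) st(3) by simp
  have e': "U \<boxdot> (v \<boxdot> V) = A" using e cl by (simp add: times_assoc)
  have wV: "w = (x \<boxdot> q' \<boxdot> t) \<boxdot> U" using cl A by (simp add: w_def V_def U_def times_assoc)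
  have wvV: "w \<boxdot> v \<boxdot> V = V" unfolding wV using cl A e' by (simp add: times_assoc V_def[symmetric])
  have "w \<boxdot> v \<boxdot> w = (w \<boxdot> v \<boxdot> V) \<boxdot> (s \<boxdot> p')" using cl unfolding w_def by (simp add: times_assoc)
  then have wvw: "w \<boxdot> v \<boxdot> w = w" unfolding wvV by (simp add: w_def)
  have "U \<boxdot> v \<boxdot> w = (U \<boxdot> v \<boxdot> V) \<boxdot> (s \<boxdot> p')" using cl unfolding w_def by (simp add: times_assoc)
  then have Uvw: "U \<boxdot> v \<boxdot> w = U" unfolding e by (simp add: U_def)
  have "w = x \<boxdot> (q' \<boxdot> t \<boxdot> A \<boxdot> s \<boxdot> p')" using A c pq st by (simp add: w_def V_def times_assoc)
  then have "U \<boxdot> v \<boxdot> V = U \<boxdot> V"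
    using A c pq st cl wvw Uvw wvV
    by (intro chain_absorb[OF fin tot, of x a "q' \<boxdot> t \<boxdot> A \<boxdot> s \<boxdot> p'"]) (simp_all add: v_def)
  moreover have "U \<boxdot> V = nest_del (\<boxdot>) y d b c j"
    using A c pq(1,2) st(1,2) by (simp add: st(4) pq(4) U_def V_def times_assoc)
  ultimately have "nest_del (\<boxdot>) y d b c j = nest (\<boxdot>) y b c j" using e ij by (simp add: A_def)
  then show "\<exists>i\<le>card (carrier S). nest_del (\<boxdot>) (factor5 (\<boxdot>) p x a q) (p \<boxdot> x \<boxdot> q) b c i
      = nest (\<boxdot>) (factor5 (\<boxdot>) p x a q) b c i"
    using ij unfolding y_def d_def by blast
qed

end


section \<open>Flat ai-semirings\<close>

text \<open>A trivial entry at any place makes an iterated commutator trivial, and conjugation keeps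
  it trivial.\<close>

lemma (in group) chief_word_trivial:
  assumes fin: "finite (carrier G)" "card (carrier G) \<le> n"
    and ex: "\<And>x. x \<in> carrier G \<Longrightarrow> spow (\<otimes>) x (Suc e) = \<one>"
    and X: "range X \<subseteq> carrier G" and Y: "range Y \<subseteq> carrier G"
  shows "chief_word (\<otimes>) e n X Y = \<one>"
proof -
  have XG: "X i \<in> carrier G" and YG: "Y i \<in> carrier G" for i using X Y by auto
  have one: "iterated_comm (\<otimes>) e \<one> cs = \<one>" if "set cs \<subseteq> carrier G" for cs
    using that
  proof (induction cs)
    case (Cons c cs)
    then have "comm_word (\<otimes>) e \<one> c = \<one>" using ex by (simp add: comm_word_eq commutator_def)
    then show ?case using Cons by simp
  qed simp
  have zero: "iterated_comm (\<otimes>) e g cs = \<one>" if "set cs \<subseteq> carrier G" "g \<in> carrier G" "\<one> \<in> set cs" for g cs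
    using that
  proof (induction cs arbitrary: g)
    case (Cons c cs)
    show ?case
    proof (cases "c = \<one>")
      case True
      then have "comm_word (\<otimes>) e g c = \<one>" using ex Cons.prems by (simp add: comm_word_eq commutator_def)
      then show ?thesis using one Cons.prems by simp
    next
      case False
      have "comm_word (\<otimes>) e g c \<in> carrier G" using ex Cons.prems by (simp add: comm_word_eq)
      then show ?thesis using Cons False by simp
    qed
  qed simp
  have "card (X ` {..n}) \<le> n" using fin X by (meson card_mono image_subset_iff le_trans range_subsetD subsetI)
  then have "\<not> inj_on X {..n}" by (intro notI) (simp add: card_image)
  then obtain i j where ij: "i < j" "j \<le> n" "X i = X j"
    by (auto simp: inj_on_def) (metis linorder_neqE_nat)
  have inv: "spow (\<otimes>) (X i) e = inv (X i)" for i using XG ex by (simp add: spow_eq_inv)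
  define ds where "ds = quotients (\<otimes>) e X n"
  have dsG: "set ds \<subseteq> carrier G" using XG by (auto simp: ds_def quotients_def inv)
  have "(i, j) \<in> set (pairs n)" using ij by (simp add: set_pairs)
  then have "X j \<otimes> inv (X i) \<in> set ds" by (force simp: ds_def quotients_def inv)
  then have "\<one> \<in> set ds" using ij XG by simp
  then obtain d0 ds' where dd: "ds = d0 # ds'" by (cases ds) auto
  let ?cs = "map (\<lambda>(k, c). conj_word (\<otimes>) e (Y k) c) (List.enumerate 0 ds')"
  have csG: "set ?cs \<subseteq> carrier G"
  proof -
    have "ds' ! k \<in> carrier G" if "k < length ds'" for k using dsG that by (auto simp: dd)
    then show ?thesis using YG ex by (auto simp: in_set_enumerate_eq conj_word_eq)
  qed
  have "iterated_comm (\<otimes>) e d0 ?cs = \<one>"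
  proof (cases "d0 = \<one>")
    case True then show ?thesis using one csG by simp
  next
    case False
    then have "\<one> \<in> set ds'" using \<open>\<one> \<in> set ds\<close> dd by simp
    then obtain k where k: "k < length ds'" "ds' ! k = \<one>" by (auto simp: in_set_conv_nth)
    then have "?cs ! k = \<one>" using YG ex by (simp add: nth_enumerate_eq conj_word_eq)
    then have "\<one> \<in> set ?cs" using k by (metis length_enumerate length_map nth_mem)
    then show ?thesis using zero csG dsG dd by simp
  qed
  then show ?thesis by (simp add: chief_word_def dd flip: ds_def)
qed

text \<open>By the pigeonhole principle some positive exponent of at most \<open>n\<close>
  annihilates \<open>x\<close>, and it divides \<open>fact n\<close>. So one exponent
  \<open>e + 2\<close> serves all groups of order at most \<open>n\<close>.\<close>

lemma (in group) spow_exponent: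
  assumes fin: "finite (carrier G)" "card (carrier G) \<le> n" and e: "fact n dvd Suc (Suc e)"
    and x: "x \<in> carrier G"
  shows "spow (\<otimes>) x (Suc e) = \<one>"
proof -
  have "(\<lambda>i::nat. x [^] i) ` {..card (carrier G)} \<subseteq> carrier G" using x by auto
  then have "card ((\<lambda>i::nat. x [^] i) ` {..card (carrier G)}) \<le> card (carrier G)" by (rule card_mono[OF fin(1)])
  then have "\<not> inj_on (\<lambda>i::nat. x [^] i) {..card (carrier G)}" by (intro notI) (simp add: card_image)
  then obtain i j where ij: "i < j" "j \<le> card (carrier G)" "x [^] (i::nat) = x [^] (j::nat)"
    by (auto simp: inj_on_def) (metis linorder_neqE_nat)
  have "x [^] i \<otimes> x [^] (j - i) = x [^] i \<otimes> \<one>" using x ij nat_pow_mult[of x i "j - i"] by simp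
  then have d: "x [^] (j - i) = \<one>" using x by (simp del: r_one)
  have "j - i dvd fact n" using ij fin(2) by (intro dvd_fact) auto
  then have "j - i dvd Suc (Suc e)" using e by (rule dvd_trans)
  then obtain k where k: "Suc (Suc e) = (j - i) * k" by (elim dvdE)
  have "x [^] ((j - i) * k) = \<one>" using x d by (simp flip: nat_pow_pow)
  then show ?thesis using x by (simp add: spow_eq_pow flip: k del: nat_pow_Suc)
qed

text \<open>Lets a group law that is written as a term be evaluated in a semigroup, in a group and
  in the words over an alphabet alike.\<close>

primrec word_value :: "('a \<Rightarrow> 'a \<Rightarrow> 'a) \<Rightarrow> (nat \<Rightarrow> 'a) \<Rightarrow> tm \<Rightarrow> 'a" where
  "word_value f \<rho> (Var n) = \<rho> n"
| "word_value f \<rho> (Plus s t) = f (word_value f \<rho> s) (word_value f \<rho> t)"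
| "word_value f \<rho> (Times s t) = f (word_value f \<rho> s) (word_value f \<rho> t)"

primrec vars :: "tm \<Rightarrow> nat set" where
  "vars (Var n) = {n}"
| "vars (Plus s t) = vars s \<union> vars t"
| "vars (Times s t) = vars s \<union> vars t"

lemma finite_vars: "finite (vars t)"
  by (induction t) auto

lemma word_value_cong: "(\<And>v. v \<in> vars t \<Longrightarrow> \<rho> v = \<rho>' v) \<Longrightarrow> word_value f \<rho> t = word_value f \<rho>' t"
  by (induction t) auto

lemma eval_word_value: "eval A \<rho> (word_value Times X t) = word_value (stimes A) (\<lambda>i. eval A \<rho> (X i)) t"
  by (induction t) simp_all

lemma word_value_spow: "word_value f \<rho> (spow Times t n) = spow f (word_value f \<rho> t) n"
  by (induction n) simp_all

lemma word_value_iterated_comm: "word_value f \<rho> (iterated_comm Times e g cs) = iterated_comm f e (word_value f \<rho> g) (map (word_value f \<rho>) cs)"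
  by (induction cs arbitrary: g) (simp_all add: comm_word_def word_value_spow)

lemma word_value_chief_word:
  assumes "0 < n"
  shows "word_value f \<rho> (chief_word Times e n X Y) = chief_word f e n (\<lambda>i. word_value f \<rho> (X i)) (\<lambda>i. word_value f \<rho> (Y i))"
proof -
  have d: "quotients f e (\<lambda>i. word_value f \<rho> (X i)) n = map (word_value f \<rho>) (quotients Times e X n)"
    by (auto simp: quotients_def word_value_spow)
  have "(0, 1) \<in> set (pairs n)" using assms by (force simp: pairs_def simp del: upt_Suc)
  then have "quotients Times e X n \<noteq> []" by (auto simp: quotients_def)
  then have h: "hd (map (word_value f \<rho>) (quotients Times e X n)) = word_value f \<rho> (hd (quotients Times e X n))"
    by (simp add: hd_map)
  have m: "map (\<lambda>(k, c). conj_word f e (word_value f \<rho> (Y k)) c) (List.enumerate a (map (word_value f \<rho>) ds))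
      = map (word_value f \<rho>) (map (\<lambda>(k, c). conj_word Times e (Y k) c) (List.enumerate a ds))" for a ds
    by (induction ds arbitrary: a) (simp_all add: conj_word_def word_value_spow)
  show ?thesis unfolding chief_word_def d word_value_iterated_comm h m[symmetric] map_tl by simp
qed

lemma word_value_closed:
  "(\<And>x y. x \<in> M \<Longrightarrow> y \<in> M \<Longrightarrow> f x y \<in> M) \<Longrightarrow> range \<rho> \<subseteq> M \<Longrightarrow> word_value f \<rho> t \<in> M"
  by (induction t) auto

text \<open>The form in which height at most two enters: addition carries no information beyond
  equality of its arguments.\<close>

locale flat_semiring = ai_semiring +
  fixes T :: 'a
  assumes T [simp]: "T \<in> carrier S"
    and plus_T: "x \<in> carrier S \<Longrightarrow> x \<boxplus> T = T"
    and flat: "x \<in> carrier S \<Longrightarrow> y \<in> carrier S \<Longrightarrow> x \<noteq> y \<Longrightarrow> x \<boxplus> y = T"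
    and fin: "finite (carrier S)"
begin

definition right_const :: "'a \<Rightarrow> bool" where
  "right_const z \<longleftrightarrow> (\<forall>y\<in>carrier S. y \<boxdot> z = T \<boxdot> z)"

definition left_const :: "'a \<Rightarrow> bool" where
  "left_const z \<longleftrightarrow> (\<forall>y\<in>carrier S. z \<boxdot> y = z \<boxdot> T)"

definition canc :: "'a \<Rightarrow> bool" where
  "canc z \<longleftrightarrow> z \<in> carrier S \<and> T \<boxdot> z = T \<and> z \<boxdot> T = T \<and>
     (\<forall>x\<in>carrier S. \<forall>y\<in>carrier S. x \<boxdot> z = y \<boxdot> z \<longrightarrow> x \<boxdot> z \<noteq> T \<longrightarrow> x = y) \<and>
     (\<forall>x\<in>carrier S. \<forall>y\<in>carrier S. z \<boxdot> x = z \<boxdot> y \<longrightarrow> z \<boxdot> x \<noteq> T \<longrightarrow> x = y)"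

lemma right_constD: "right_const z \<Longrightarrow> y \<in> carrier S \<Longrightarrow> y \<boxdot> z = T \<boxdot> z"
  unfolding right_const_def by (rule bspec)

lemma left_constD: "left_const z \<Longrightarrow> y \<in> carrier S \<Longrightarrow> z \<boxdot> y = z \<boxdot> T"
  unfolding left_const_def by (rule bspec)

text \<open>Translation by \<open>z\<close> preserves sums. If it does not fix \<open>T\<close>,
  each \<open>y z\<close> has the sum \<open>T z\<close>, different from \<open>T\<close>, with
  \<open>T z\<close>, so it equals \<open>T z\<close>. If it fixes \<open>T\<close>, distinct
  elements with a common image have the sum \<open>T\<close>, so that image is
  \<open>T\<close>.\<close>

lemma right_cases:
  assumes z: "z \<in> carrier S" and n: "\<not> right_const z"
  shows "T \<boxdot> z = T"
    and "\<lbrakk>x \<in> carrier S; y \<in> carrier S; x \<boxdot> z = y \<boxdot> z; x \<boxdot> z \<noteq> T\<rbrakk> \<Longrightarrow> x = y"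
proof -
  show Tz: "T \<boxdot> z = T"
  proof (rule ccontr)
    assume nT: "T \<boxdot> z \<noteq> T"
    have "y \<boxdot> z = T \<boxdot> z" if y: "y \<in> carrier S" for y
    proof -
      have "y \<boxdot> z \<boxplus> T \<boxdot> z = T \<boxdot> z" using y z plus_T[OF y] distrib_right[of y T z] by simp
      then show ?thesis using flat[of "y \<boxdot> z" "T \<boxdot> z"] y z nT by auto
    qed
    then show False using n unfolding right_const_def by blast
  qed
  assume xy: "x \<in> carrier S" "y \<in> carrier S" "x \<boxdot> z = y \<boxdot> z" "x \<boxdot> z \<noteq> T"
  show "x = y"
  proof (rule ccontr)
    assume "x \<noteq> y"
    then have "T \<boxdot> z = x \<boxdot> z \<boxplus> y \<boxdot> z" using xy z flat[of x y] distrib_right[of x y z] by simp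
    then show False using xy z Tz by (simp add: plus_idem)
  qed
qed

lemma left_cases:
  assumes z: "z \<in> carrier S" and n: "\<not> left_const z"
  shows "z \<boxdot> T = T"
    and "\<lbrakk>x \<in> carrier S; y \<in> carrier S; z \<boxdot> x = z \<boxdot> y; z \<boxdot> x \<noteq> T\<rbrakk> \<Longrightarrow> x = y"
proof -
  show Tz: "z \<boxdot> T = T"
  proof (rule ccontr)
    assume nT: "z \<boxdot> T \<noteq> T"
    have "z \<boxdot> y = z \<boxdot> T" if y: "y \<in> carrier S" for y
    proof -
      have "z \<boxdot> y \<boxplus> z \<boxdot> T = z \<boxdot> T" using y z plus_T[OF y] distrib_left[of z y T] by simp
      then show ?thesis using flat[of "z \<boxdot> y" "z \<boxdot> T"] y z nT by auto
    qed
    then show False using n unfolding left_const_def by blast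
  qed
  assume xy: "x \<in> carrier S" "y \<in> carrier S" "z \<boxdot> x = z \<boxdot> y" "z \<boxdot> x \<noteq> T"
  show "x = y"
  proof (rule ccontr)
    assume "x \<noteq> y"
    then have "z \<boxdot> T = z \<boxdot> x \<boxplus> z \<boxdot> y" using xy z flat[of x y] distrib_left[of z x y] by simp
    then show False using xy z Tz by (simp add: plus_idem)
  qed
qed

lemma cancI: "z \<in> carrier S \<Longrightarrow> \<not> right_const z \<Longrightarrow> \<not> left_const z \<Longrightarrow> canc z"
  unfolding canc_def
proof (intro conjI ballI impI)
  assume z: "z \<in> carrier S" "\<not> right_const z" "\<not> left_const z"
  note r = right_cases[OF z(1,2)] and l = left_cases[OF z(1,3)]
  show "z \<in> carrier S" "T \<boxdot> z = T" "z \<boxdot> T = T" by (fact z r l)+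
  fix x y assume "x \<in> carrier S" "y \<in> carrier S"
  then show "x \<boxdot> z = y \<boxdot> z \<Longrightarrow> x \<boxdot> z \<noteq> T \<Longrightarrow> x = y" "z \<boxdot> x = z \<boxdot> y \<Longrightarrow> z \<boxdot> x \<noteq> T \<Longrightarrow> x = y"
    using r(2)[of x y] l(2)[of x y] by simp_all
qed

lemma cancD:
  assumes "canc z"
  shows "z \<in> carrier S" "T \<boxdot> z = T" "z \<boxdot> T = T"
    and "x \<boxdot> z = y \<boxdot> z \<Longrightarrow> x \<boxdot> z \<noteq> T \<Longrightarrow> x \<in> carrier S \<Longrightarrow> y \<in> carrier S \<Longrightarrow> x = y"
    and "z \<boxdot> x = z \<boxdot> y \<Longrightarrow> z \<boxdot> x \<noteq> T \<Longrightarrow> x \<in> carrier S \<Longrightarrow> y \<in> carrier S \<Longrightarrow> x = y"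
proof -
  note a = assms[unfolded canc_def]
  note a5 = a[THEN conjunct2, THEN conjunct2, THEN conjunct2]
  show "z \<in> carrier S" "T \<boxdot> z = T" "z \<boxdot> T = T" using a by blast+
  show "x \<boxdot> z = y \<boxdot> z \<Longrightarrow> x \<boxdot> z \<noteq> T \<Longrightarrow> x \<in> carrier S \<Longrightarrow> y \<in> carrier S \<Longrightarrow> x = y"
    by (rule a5[THEN conjunct1, rule_format])
  show "z \<boxdot> x = z \<boxdot> y \<Longrightarrow> z \<boxdot> x \<noteq> T \<Longrightarrow> x \<in> carrier S \<Longrightarrow> y \<in> carrier S \<Longrightarrow> x = y"
    by (rule a5[THEN conjunct2, rule_format])
qed

lemma canc_mult:
  assumes "canc z" "canc w"
  shows "canc (z \<boxdot> w)"
  unfolding canc_def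
proof (intro conjI ballI impI)
  note z = cancD[OF assms(1)] and w = cancD[OF assms(2)]
  show "z \<boxdot> w \<in> carrier S" using z(1) w(1) by simp
  show "T \<boxdot> (z \<boxdot> w) = T" using z(1,2) w(1,2) by (simp flip: times_assoc)
  show "z \<boxdot> w \<boxdot> T = T" using z(1,3) w(1,3) by (simp add: times_assoc)
  fix x y assume c: "x \<in> carrier S" "y \<in> carrier S"
  show "x = y" if e: "x \<boxdot> (z \<boxdot> w) = y \<boxdot> (z \<boxdot> w)" and n: "x \<boxdot> (z \<boxdot> w) \<noteq> T"
  proof -
    have e': "(x \<boxdot> z) \<boxdot> w = (y \<boxdot> z) \<boxdot> w" "(x \<boxdot> z) \<boxdot> w \<noteq> T"
      using e n c z(1) w(1) by (simp_all add: times_assoc)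
    then have "x \<boxdot> z = y \<boxdot> z" using w(4)[OF e'] c z(1) by simp
    moreover have "x \<boxdot> z \<noteq> T" using e'(2) w(2) by auto
    ultimately show ?thesis using z(4)[of x y] c by simp
  qed
  show "x = y" if e: "z \<boxdot> w \<boxdot> x = z \<boxdot> w \<boxdot> y" and n: "z \<boxdot> w \<boxdot> x \<noteq> T"
  proof -
    have e': "z \<boxdot> (w \<boxdot> x) = z \<boxdot> (w \<boxdot> y)" "z \<boxdot> (w \<boxdot> x) \<noteq> T"
      using e n c z(1) w(1) by (simp_all add: times_assoc)
    then have "w \<boxdot> x = w \<boxdot> y" using z(5)[OF e'] c w(1) by simp
    moreover have "w \<boxdot> x \<noteq> T" using e'(2) z(3) by auto
    ultimately show ?thesis using w(5)[of x y] c by simp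
  qed
qed

lemma right_const_mult:
  assumes c: "z \<in> carrier S" "w \<in> carrier S" and "right_const z \<or> right_const w"
  shows "right_const (z \<boxdot> w)"
  unfolding right_const_def
proof
  fix y assume y: "y \<in> carrier S"
  have 1: "y \<boxdot> (z \<boxdot> w) = (y \<boxdot> z) \<boxdot> w" "T \<boxdot> (z \<boxdot> w) = (T \<boxdot> z) \<boxdot> w" using c y by (simp_all add: times_assoc)
  show "y \<boxdot> (z \<boxdot> w) = T \<boxdot> (z \<boxdot> w)"
    using assms(3)
  proof
    assume w: "right_const w"
    show ?thesis unfolding 1 using right_constD[OF w, of "y \<boxdot> z"] right_constD[OF w, of "T \<boxdot> z"] c y by simp
  next
    assume "right_const z"
    then show ?thesis unfolding 1 using right_constD[of z y] y by simp
  qed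
qed

lemma left_const_mult:
  assumes c: "z \<in> carrier S" "w \<in> carrier S" and "left_const z \<or> left_const w"
  shows "left_const (z \<boxdot> w)"
  unfolding left_const_def
proof
  fix y assume y: "y \<in> carrier S"
  have 1: "(z \<boxdot> w) \<boxdot> y = z \<boxdot> (w \<boxdot> y)" "(z \<boxdot> w) \<boxdot> T = z \<boxdot> (w \<boxdot> T)" using c y by (simp_all add: times_assoc)
  show "(z \<boxdot> w) \<boxdot> y = (z \<boxdot> w) \<boxdot> T"
    using assms(3)
  proof
    assume z: "left_const z"
    show ?thesis unfolding 1 using left_constD[OF z, of "w \<boxdot> y"] left_constD[OF z, of "w \<boxdot> T"] c y by simp
  next
    assume "left_const w"
    then show ?thesis unfolding 1 using left_constD[of w y] y by simp
  qed
qed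

lemma canc_of_mult:
  assumes "z \<in> carrier S" "w \<in> carrier S" "\<not> right_const (z \<boxdot> w)" "\<not> left_const (z \<boxdot> w)"
  shows "\<not> right_const z" "\<not> left_const z" "\<not> right_const w" "\<not> left_const w"
proof -
  note r = right_const_mult[OF assms(1,2)] and l = left_const_mult[OF assms(1,2)]
  show "\<not> right_const z" "\<not> right_const w" using r assms(3) by fast+
  show "\<not> left_const z" "\<not> left_const w" using l assms(4) by fast+
qed

text \<open>A cancellative \<open>z\<close> fixes \<open>T\<close> on both sides, so it disappears
  next to \<open>T\<close>. If neither \<open>T P\<close> nor \<open>Q T\<close> is
  \<open>T\<close>, then \<open>P\<close> and \<open>Q\<close> act as constants and
  \<open>T P = Q T\<close> is a multiplicative zero.\<close>

lemma absorb_between_T: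
  assumes x: "canc x" "canc x'" and c: "P \<in> carrier S" "Q \<in> carrier S"
  shows "T \<boxdot> P \<boxdot> x \<boxdot> Q \<boxdot> T = T \<boxdot> P \<boxdot> x' \<boxdot> Q \<boxdot> T"
proof -
  have main: "T \<boxdot> P \<boxdot> z \<boxdot> Q \<boxdot> T = (if Q \<boxdot> T = T then T \<boxdot> P \<boxdot> T else if T \<boxdot> P = T then T \<boxdot> Q \<boxdot> T else Q \<boxdot> T)"
    if z: "canc z" for z
  proof -
    note z = cancD[OF z]
    have e: "T \<boxdot> P \<boxdot> z \<boxdot> Q \<boxdot> T = (T \<boxdot> P) \<boxdot> (z \<boxdot> (Q \<boxdot> T))" using c z(1) by (simp add: times_assoc)
    consider "Q \<boxdot> T = T" | "Q \<boxdot> T \<noteq> T" "T \<boxdot> P = T" | "Q \<boxdot> T \<noteq> T" "T \<boxdot> P \<noteq> T" by blast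
    then show ?thesis
    proof cases
      case 1 then show ?thesis using e z(3) by simp
    next
      case 2
      then have "T \<boxdot> P \<boxdot> z \<boxdot> Q \<boxdot> T = T \<boxdot> z \<boxdot> (Q \<boxdot> T)" using c z(1) by (simp add: times_assoc)
      then show ?thesis using 2 z(2) c by (simp add: times_assoc)
    next
      case 3
      have "left_const Q" using left_cases(1)[OF c(2)] 3 by metis
      then have lc: "Q \<boxdot> T \<boxdot> y = Q \<boxdot> T" if "y \<in> carrier S" for y
        using that c left_constD[of Q "T \<boxdot> y"] by (simp add: times_assoc)
      have "right_const P" using right_cases(1)[OF c(1)] 3 by metis
      then have rc: "y \<boxdot> (T \<boxdot> P) = T \<boxdot> P" if "y \<in> carrier S" for y
        using that c right_constD[of P "y \<boxdot> T"] by (simp add: times_assoc)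
      have eq: "T \<boxdot> P = Q \<boxdot> T" using rc[of "Q \<boxdot> T"] lc[of "T \<boxdot> P"] c by simp
      have "(T \<boxdot> P) \<boxdot> (z \<boxdot> (Q \<boxdot> T)) = Q \<boxdot> T" unfolding eq using lc c z(1) by simp
      then show ?thesis using 3 e by simp
    qed
  qed
  show ?thesis using main[OF x(1)] main[OF x(2)] by simp
qed

text \<open>A \<open>C\<close> that acts as a constant on one side swallows all the rest; for
  \<open>C = T\<close>, cancellative middles can be exchanged by \<open>absorb_between_T\<close>.
  Only in the remaining case do the middles have to agree.\<close>

lemma framed_eq:
  assumes C: "C \<in> carrier S" and PQ: "P \<in> carrier S" "Q \<in> carrier S" "x \<in> carrier S" "x' \<in> carrier S"
    and *: "\<not> right_const C \<Longrightarrow> \<not> left_const C \<Longrightarrow> canc x \<and> canc x' \<and> (C \<noteq> T \<longrightarrow> x = x')"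
  shows "C \<boxdot> P \<boxdot> x \<boxdot> Q \<boxdot> C = C \<boxdot> P \<boxdot> x' \<boxdot> Q \<boxdot> C"
proof -
  consider "right_const C" | "left_const C" | "\<not> right_const C" "\<not> left_const C" by blast
  then show ?thesis
  proof cases
    case 1
    then have "(C \<boxdot> P \<boxdot> x \<boxdot> Q) \<boxdot> C = T \<boxdot> C" "(C \<boxdot> P \<boxdot> x' \<boxdot> Q) \<boxdot> C = T \<boxdot> C"
      using C PQ by (intro right_constD; simp)+
    then show ?thesis by simp
  next
    case 2
    then have "C \<boxdot> (P \<boxdot> x \<boxdot> Q \<boxdot> C) = C \<boxdot> T" "C \<boxdot> (P \<boxdot> x' \<boxdot> Q \<boxdot> C) = C \<boxdot> T"
      using C PQ by (intro left_constD; simp)+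
    then show ?thesis using C PQ by (simp add: times_assoc)
  next
    case 3
    then show ?thesis using * absorb_between_T[OF _ _ PQ(1,2)] by (cases "C = T") auto
  qed
qed

end

primrec iter_prod :: "('a \<Rightarrow> 'a \<Rightarrow> 'a) \<Rightarrow> (nat \<Rightarrow> 'a) \<Rightarrow> nat \<Rightarrow> 'a" where
  "iter_prod f u 0 = u 0"
| "iter_prod f u (Suc n) = f (iter_prod f u n) (u (Suc n))"

text \<open>Framing by a word \<open>C\<close> that contains the relevant letters makes an identity hold trivially whenever
  one of these letters acts as a constant, so that only cancellative letters matter.\<close>

definition frame :: "('a \<Rightarrow> 'a \<Rightarrow> 'a) \<Rightarrow> 'a \<Rightarrow> 'a \<Rightarrow> 'a \<Rightarrow> 'a \<Rightarrow> 'a" where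
  "frame f C P x Q = f (f (f (f C P) x) Q) C"

text \<open>Between frames, \<open>x a\<close> is to act on \<open>x\<close> like a group element
  whose power with exponent \<open>e + 2\<close> is trivial. The frame is nested so that it repeats
  a value, and its core \<open>p x a x q\<close> exhibits the factor \<open>x a x\<close> to which
  cancellation leads.\<close>

definition insertion_identity :: "nat \<Rightarrow> nat \<Rightarrow> identity" where
  "insertion_identity e N =
    (let C = nest Times (factor5 Times (Var 2) (Var 0) (Var 1) (Var 3)) (\<lambda>i. Var (6 + 2 * i)) (\<lambda>i. Var (7 + 2 * i)) N
     in (frame Times C (Var 4) (Var 0) (Var 5),
         frame Times C (Var 4) (Times (spow Times (Times (Var 0) (Var 1)) (Suc e)) (Var 0)) (Var 5)))"

text \<open>The factors \<open>(x a\<^sub>i x b\<^sub>i)\<^sup>2\<^sup>m\<close> of the frame, with \<open>m = e + 2\<close>, force the elements \<open>x a\<^sub>i\<close> into one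
  multiplicative subgroup unless the frame takes the value \<open>T\<close> or a constant.\<close>

definition certificate :: "('a \<Rightarrow> 'a \<Rightarrow> 'a) \<Rightarrow> nat \<Rightarrow> 'a \<Rightarrow> (nat \<Rightarrow> 'a) \<Rightarrow> (nat \<Rightarrow> 'a) \<Rightarrow> nat \<Rightarrow> 'a" where
  "certificate f e x a b q = iter_prod f (\<lambda>i. spow f (f (f x (a i)) (f x (b i))) (2 * e + 3)) q"

text \<open>In the absence of a constant for the neutral element, the group law \<open>w = 1\<close>
  for the elements \<open>x a i\<close> is expressed by its action on \<open>x\<close>, which that
  neutral element fixes.\<close>

definition law_identity :: "nat \<Rightarrow> nat \<Rightarrow> tm \<Rightarrow> identity" where
  "law_identity e q w =
    (let C = certificate Times e (Var 0) (\<lambda>i. Var (3 + 2 * i)) (\<lambda>i. Var (4 + 2 * i)) q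
     in (frame Times C (Var 1) (Var 0) (Var 2),
         frame Times C (Var 1) (Times (word_value Times (\<lambda>i. Times (Var 0) (Var (3 + 2 * i))) w) (Var 0)) (Var 2)))"

lemma eval_spow: "eval A \<rho> (spow Times t n) = spow (stimes A) (eval A \<rho> t) n"
  by (induction n) simp_all

lemma eval_iter_prod: "eval A \<rho> (iter_prod Times u n) = iter_prod (stimes A) (\<lambda>i. eval A \<rho> (u i)) n"
  by (induction n) simp_all

lemma eval_certificate: "eval A \<rho> (certificate Times e x a b q) =
    certificate (stimes A) e (eval A \<rho> x) (\<lambda>i. eval A \<rho> (a i)) (\<lambda>i. eval A \<rho> (b i)) q"
  by (simp add: certificate_def eval_iter_prod eval_spow)

lemma eval_frame: "eval A \<rho> (frame Times C P x Q) =
    frame (stimes A) (eval A \<rho> C) (eval A \<rho> P) (eval A \<rho> x) (eval A \<rho> Q)"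
  by (simp add: frame_def)

section \<open>Powers and maximal multiplicative subgroups\<close>

context ai_semiring
begin

lemma spow_add:
  assumes "x \<in> carrier S"
  shows "spow (\<boxdot>) x m \<boxdot> spow (\<boxdot>) x n = spow (\<boxdot>) x (Suc (m + n))"
  using assms by (induction n) (simp_all flip: times_assoc)

text \<open>The powers of \<open>x\<close> repeat within the first
  \<open>card (carrier S) + 1\<close> terms, with a period that divides the factorial.\<close>

lemma spow_periodic:
  assumes fin: "finite (carrier S)" and x: "x \<in> carrier S" and e: "fact (card (carrier S)) dvd Suc (Suc e)"
    and l: "card (carrier S) \<le> l"
  shows "spow (\<boxdot>) x (l + Suc (Suc e)) = spow (\<boxdot>) x l"
proof -
  obtain i j where ij: "i < j" "j \<le> card (carrier S)" "spow (\<boxdot>) x i = spow (\<boxdot>) x j"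
    using pigeonhole[OF fin, of "spow (\<boxdot>) x"] x by (metis image_subsetI spow_closed)
  have 1: "spow (\<boxdot>) x (i + k + (j - i)) = spow (\<boxdot>) x (i + k)" for k
  proof (cases k)
    case (Suc k')
    have "spow (\<boxdot>) x (i + k) = spow (\<boxdot>) x i \<boxdot> spow (\<boxdot>) x k'"
      "spow (\<boxdot>) x (i + k + (j - i)) = spow (\<boxdot>) x j \<boxdot> spow (\<boxdot>) x k'"
      using spow_add[OF x, of i k'] spow_add[OF x, of j k'] ij(1) by (simp_all add: Suc add.commute del: spow.simps)
    then show ?thesis using ij(3) by simp
  qed (use ij in simp)
  have 2: "spow (\<boxdot>) x (l + (j - i) * r) = spow (\<boxdot>) x l" for r
  proof (induction r)
    case (Suc r)
    have "l + (j - i) * Suc r = i + (l - i + (j - i) * r) + (j - i)" using l ij by simp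
    then have "spow (\<boxdot>) x (l + (j - i) * Suc r) = spow (\<boxdot>) x (i + (l - i + (j - i) * r) + (j - i))"
      by (simp only:)
    also have "\<dots> = spow (\<boxdot>) x (l + (j - i) * r)" unfolding 1 using l ij by simp
    finally show ?case using Suc by simp
  qed simp
  have "j - i dvd fact (card (carrier S))" using ij by (intro dvd_fact) auto
  then have "j - i dvd Suc (Suc e)" using e by (rule dvd_trans)
  then obtain r where "Suc (Suc e) = (j - i) * r" by (elim dvdE)
  then show ?thesis using 2[of r] by simp
qed

text \<open>For an idempotent \<open>f\<close>, this is the group of units of the monoid f S f, the
  maximal multiplicative subgroup with identity \<open>f\<close>.\<close>

definition unit_group :: "'a \<Rightarrow> 'a monoid" where
  "unit_group f = \<lparr>carrier = {g \<in> carrier S. f \<boxdot> g = g \<and> g \<boxdot> f = g \<and>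
      (\<exists>g'\<in>carrier S. f \<boxdot> g' = g' \<and> g' \<boxdot> f = g' \<and> g \<boxdot> g' = f \<and> g' \<boxdot> g = f)}, monoid.mult = (\<boxdot>), one = f\<rparr>"

lemma unit_group_sel [simp]: "monoid.mult (unit_group f) = (\<boxdot>)" "one (unit_group f) = f"
  by (simp_all add: unit_group_def)

lemma unit_groupI:
  "\<lbrakk>g \<in> carrier S; g' \<in> carrier S; f \<boxdot> g = g; g \<boxdot> f = g; f \<boxdot> g' = g'; g' \<boxdot> f = g'; g \<boxdot> g' = f; g' \<boxdot> g = f\<rbrakk>
    \<Longrightarrow> g \<in> carrier (unit_group f)"
  unfolding unit_group_def by auto

lemma unit_groupE:
  assumes "g \<in> carrier (unit_group f)"
  obtains g' where "g \<in> carrier S" "g' \<in> carrier S" "f \<boxdot> g = g" "g \<boxdot> f = g" "f \<boxdot> g' = g'" "g' \<boxdot> f = g'"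
    "g \<boxdot> g' = f" "g' \<boxdot> g = f"
  using assms unfolding unit_group_def by auto

lemma group_unit_group:
  assumes f: "f \<in> carrier S" "f \<boxdot> f = f"
  shows "group (unit_group f)"
proof (rule groupI)
  show "\<one>\<^bsub>unit_group f\<^esub> \<in> carrier (unit_group f)" using f by (auto intro: unit_groupI)
  fix g assume g: "g \<in> carrier (unit_group f)"
  obtain g' where g': "g \<in> carrier S" "g' \<in> carrier S" "f \<boxdot> g = g" "g \<boxdot> f = g" "f \<boxdot> g' = g'" "g' \<boxdot> f = g'"
    "g \<boxdot> g' = f" "g' \<boxdot> g = f" using g by (rule unit_groupE)
  show "\<one>\<^bsub>unit_group f\<^esub> \<otimes>\<^bsub>unit_group f\<^esub> g = g" using g' by simp
  show "\<exists>y\<in>carrier (unit_group f). y \<otimes>\<^bsub>unit_group f\<^esub> g = \<one>\<^bsub>unit_group f\<^esub>"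
    using g' by (intro bexI[of _ g'] unit_groupI[of g' g]) simp_all
  fix h assume h: "h \<in> carrier (unit_group f)"
  obtain h' where h': "h \<in> carrier S" "h' \<in> carrier S" "f \<boxdot> h = h" "h \<boxdot> f = h" "f \<boxdot> h' = h'" "h' \<boxdot> f = h'"
    "h \<boxdot> h' = f" "h' \<boxdot> h = f" using h by (rule unit_groupE)
  show "g \<otimes>\<^bsub>unit_group f\<^esub> h \<in> carrier (unit_group f)"
    unfolding unit_group_sel
  proof (rule unit_groupI)
    show "g \<boxdot> h \<in> carrier S" "h' \<boxdot> g' \<in> carrier S" using g' h' by simp_all
    show "f \<boxdot> (g \<boxdot> h) = g \<boxdot> h" "f \<boxdot> (h' \<boxdot> g') = h' \<boxdot> g'" using g' h' f by (simp_all flip: times_assoc)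
    show "g \<boxdot> h \<boxdot> f = g \<boxdot> h" "h' \<boxdot> g' \<boxdot> f = h' \<boxdot> g'" using g' h' f by (simp_all add: times_assoc)
    have "g \<boxdot> h \<boxdot> (h' \<boxdot> g') = g \<boxdot> (h \<boxdot> h') \<boxdot> g'" using g'(1,2) h'(1,2) by (simp add: times_assoc)
    also have "\<dots> = f" using g' h' by simp
    finally show "g \<boxdot> h \<boxdot> (h' \<boxdot> g') = f" .
    have "h' \<boxdot> g' \<boxdot> (g \<boxdot> h) = h' \<boxdot> (g' \<boxdot> g) \<boxdot> h" using g'(1,2) h'(1,2) by (simp add: times_assoc)
    also have "\<dots> = f" using g' h' by simp
    finally show "h' \<boxdot> g' \<boxdot> (g \<boxdot> h) = f" .
  qed
  fix k assume k: "k \<in> carrier (unit_group f)"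
  then have "k \<in> carrier S" by (rule unit_groupE)
  then show "g \<otimes>\<^bsub>unit_group f\<^esub> h \<otimes>\<^bsub>unit_group f\<^esub> k = g \<otimes>\<^bsub>unit_group f\<^esub> (h \<otimes>\<^bsub>unit_group f\<^esub> k)"
    using g' h' by (simp add: times_assoc)
qed

lemma unit_group_subset: "carrier (unit_group f) \<subseteq> carrier S"
  by (auto simp: unit_group_def)

end

section \<open>The framed identities hold in every finite flat ai-semiring\<close>

context flat_semiring
begin

text \<open>Equations that hold after right multiplication by \<open>x\<close> can be cancelled to
  equations between \<open>g\<close>, \<open>g'\<close> and their products. The values involved
  avoid \<open>T\<close> because cancellative elements fix \<open>T\<close> while
  \<open>x \<noteq> T\<close>.\<close>

lemma unit_of_cancel:
  assumes g: "canc g" "canc g'" and x: "canc x" "x \<noteq> T" and 1: "g \<boxdot> g' \<boxdot> x = x" and 2: "g' \<boxdot> g \<boxdot> x = x"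
  shows "g \<in> carrier (unit_group (g \<boxdot> g'))" "(g \<boxdot> g') \<boxdot> (g \<boxdot> g') = g \<boxdot> g'"
proof -
  have c: "g \<in> carrier S" "g' \<in> carrier S" "x \<in> carrier S" using cancD(1) g x by auto
  note can = cancD(4)[OF x(1)]
  define f where "f = g \<boxdot> g'"
  have f: "f \<in> carrier S" "f \<boxdot> x = x" using c 1 by (simp_all add: f_def)
  have comm: "g' \<boxdot> g = f" using can[of "g' \<boxdot> g" f] f 2 x c by simp
  have gx: "g \<boxdot> x \<noteq> T" using 2 c cancD(3)[OF g(2)] x(2) by (metis times_assoc)
  have g'x: "g' \<boxdot> x \<noteq> T" using 1 c cancD(3)[OF g(1)] x(2) by (metis times_assoc)
  have "f \<boxdot> g \<boxdot> x = g \<boxdot> (g' \<boxdot> g \<boxdot> x)" using c by (simp add: f_def times_assoc)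
  then have fg: "f \<boxdot> g = g" using can[of "f \<boxdot> g" g] gx c f 2 by simp
  have "f \<boxdot> g' \<boxdot> x = g' \<boxdot> (g \<boxdot> g' \<boxdot> x)" unfolding comm[symmetric] using c by (simp add: times_assoc)
  then have fg': "f \<boxdot> g' = g'" using can[of "f \<boxdot> g'" g'] g'x c f 1 by simp
  have "g \<boxdot> f = g \<boxdot> g' \<boxdot> g" using c unfolding comm[symmetric] by (simp add: times_assoc)
  then have gf: "g \<boxdot> f = g" using fg by (simp flip: f_def)
  have "g' \<boxdot> f = g' \<boxdot> g \<boxdot> g'" using c unfolding f_def by (simp add: times_assoc)
  then have g'f: "g' \<boxdot> f = g'" using fg' by (simp add: comm)
  show "g \<in> carrier (unit_group (g \<boxdot> g'))"
    unfolding f_def[symmetric] using c f fg gf fg' g'f comm by (intro unit_groupI[of g g']) (simp_all add: f_def)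
  show "(g \<boxdot> g') \<boxdot> (g \<boxdot> g') = g \<boxdot> g'"
    unfolding f_def[symmetric] using fg c by (simp add: f_def flip: times_assoc)
qed

text \<open>Kept beside \<open>canc\<close> because \<open>nonconst\<close> passes from a product to
  its factors, whereas \<open>canc\<close> passes from factors to the product.\<close>

definition nonconst :: "'a \<Rightarrow> bool" where
  "nonconst z \<longleftrightarrow> z \<in> carrier S \<and> \<not> right_const z \<and> \<not> left_const z"

lemma nonconst_canc: "nonconst z \<Longrightarrow> canc z"
  by (simp add: nonconst_def cancI)

lemma nonconst_mult:
  "nonconst (z \<boxdot> w) \<Longrightarrow> z \<in> carrier S \<Longrightarrow> w \<in> carrier S \<Longrightarrow> nonconst z \<and> nonconst w"
  using canc_of_mult[of z w] by (simp add: nonconst_def)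

lemma nonconst_nest:
  assumes c: "y \<in> carrier S" "range b \<subseteq> carrier S" "range c \<subseteq> carrier S" and "nonconst (nest (\<boxdot>) y b c n)"
  shows "nonconst y \<and> (\<forall>i<n. nonconst (b i) \<and> nonconst (c i))"
  using assms(4)
proof (induction n)
  case (Suc n)
  have bc: "b n \<in> carrier S" "c n \<in> carrier S" using c by auto
  let ?Y = "nest (\<boxdot>) y b c n"
  have Y: "?Y \<in> carrier S" using c by simp
  have 1: "nonconst (?Y \<boxdot> b n \<boxdot> ?Y \<boxdot> c n)" using Suc.prems nonconst_mult[of "?Y \<boxdot> b n \<boxdot> ?Y \<boxdot> c n" ?Y] Y bc by simp
  have 2: "nonconst (?Y \<boxdot> b n \<boxdot> ?Y)" "nonconst (c n)" using 1 nonconst_mult[of "?Y \<boxdot> b n \<boxdot> ?Y" "c n"] Y bc by simp_all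
  have 3: "nonconst (?Y \<boxdot> b n)" using 2 nonconst_mult[of "?Y \<boxdot> b n" ?Y] Y bc by simp
  have 4: "nonconst ?Y" "nonconst (b n)" using 3 nonconst_mult[of ?Y "b n"] Y bc by simp_all
  show ?case using Suc.IH 2 4 by (auto simp: less_Suc_eq)
qed simp

lemma spow_unit:
  assumes e: "fact (card (carrier S)) dvd Suc (Suc e)" and f: "f \<in> carrier S" "f \<boxdot> f = f"
    and g: "g \<in> carrier (unit_group f)"
  shows "spow (\<boxdot>) g (Suc e) = f"
proof -
  interpret group "unit_group f" using f by (rule group_unit_group)
  have "finite (carrier (unit_group f))" "card (carrier (unit_group f)) \<le> card (carrier S)"
    using unit_group_subset fin by (auto intro: finite_subset card_mono)
  from spow_exponent[OF this e g] show ?thesis by simp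
qed

lemma canc_spow: "canc x \<Longrightarrow> canc (spow (\<boxdot>) x n)"
  by (induction n) (auto intro: canc_mult)

text \<open>All letters of a nonconstant pattern are cancellative. If its value is not
  \<open>T\<close>, a repeated level is regular, and cancelling its outer parts shows that
  \<open>x a\<close> lies in a multiplicative subgroup whose identity fixes
  \<open>x\<close>.\<close>

lemma insertion_key:
  assumes e: "fact (card (carrier S)) dvd Suc (Suc e)"
    and c: "p \<in> carrier S" "x \<in> carrier S" "a \<in> carrier S" "q \<in> carrier S" "range b \<subseteq> carrier S" "range c \<subseteq> carrier S"
    and nc: "nonconst (nest (\<boxdot>) (factor5 (\<boxdot>) p x a q) b c (card (carrier S)))"
  shows "canc x \<and> canc (spow (\<boxdot>) (x \<boxdot> a) (Suc e) \<boxdot> x) \<and>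
    (nest (\<boxdot>) (factor5 (\<boxdot>) p x a q) b c (card (carrier S)) \<noteq> T \<longrightarrow> x = spow (\<boxdot>) (x \<boxdot> a) (Suc e) \<boxdot> x)"
proof -
  define y where "y = factor5 (\<boxdot>) p x a q"
  have yS: "y \<in> carrier S" using c by (simp add: y_def factor5_def)
  have "nonconst y" and bc: "\<And>i. i < card (carrier S) \<Longrightarrow> nonconst (b i)" "\<And>i. i < card (carrier S) \<Longrightarrow> nonconst (c i)"
    using nonconst_nest[OF yS c(5,6)] nc unfolding y_def by auto
  then have "nonconst (p \<boxdot> x \<boxdot> a \<boxdot> x)" "nonconst q"
    using nonconst_mult[of "p \<boxdot> x \<boxdot> a \<boxdot> x" q] c by (auto simp: y_def factor5_def)
  then have "nonconst (p \<boxdot> x \<boxdot> a)" using nonconst_mult[of "p \<boxdot> x \<boxdot> a" x] c by simp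
  then have "nonconst (p \<boxdot> x)" "nonconst a" using nonconst_mult[of "p \<boxdot> x" a] c by simp_all
  then have "nonconst p" "nonconst x" using nonconst_mult[of p x] c by simp_all
  then have can: "canc p" "canc x" "canc a" "canc q" "canc y"
    using \<open>nonconst a\<close> \<open>nonconst q\<close> \<open>nonconst y\<close> nonconst_canc by auto
  have canbc: "canc (b i)" "canc (c i)" if "i < card (carrier S)" for i using bc that nonconst_canc by auto
  have "x = spow (\<boxdot>) (x \<boxdot> a) (Suc e) \<boxdot> x" if nT: "nest (\<boxdot>) y b c (card (carrier S)) \<noteq> T"
  proof -
    obtain i j where ij: "i < j" "j \<le> card (carrier S)" "nest (\<boxdot>) y b c i = nest (\<boxdot>) y b c j"
      using pigeonhole[OF fin, of "nest (\<boxdot>) y b c"] yS c by (metis image_subsetI nest_closed)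
    define A where "A = nest (\<boxdot>) y b c i"
    obtain p' q' where pq: "p' \<in> carrier S" "q' \<in> carrier S" "canc p'" "canc q'" "A = p' \<boxdot> x \<boxdot> a \<boxdot> x \<boxdot> q'"
      using nest_decompose[OF c, of canc i] can canbc canc_mult ij unfolding A_def y_def by auto
    have AS: "A \<in> carrier S" using yS c by (simp add: A_def)
    have cA: "canc A" using pq can by (auto intro: canc_mult)
    obtain s t where st: "s \<in> carrier S" "t \<in> carrier S" "canc s" "canc t" "A = A \<boxdot> s \<boxdot> A \<boxdot> t \<boxdot> A"
      using nest_nest[OF yS yS c(5,6), of canc j i] can canbc canc_mult ij unfolding A_def by auto
    \<comment> \<open>Cancellative factors fix \<open>T\<close>, so the value \<open>T\<close> at
      level \<open>i\<close> would propagate to the last level.\<close>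
    have "A \<noteq> T"
    proof
      assume AT: "A = T"
      have iN: "i < card (carrier S)" using ij by simp
      obtain s t where st: "s \<in> carrier S" "t \<in> carrier S" "canc s" "canc t"
        "nest (\<boxdot>) y b c (card (carrier S)) = A \<boxdot> s \<boxdot> A \<boxdot> t \<boxdot> A"
        using nest_nest[OF yS yS c(5,6), of canc "card (carrier S)" i] can canbc canc_mult iN unfolding A_def by auto
      then show False using nT cancD(2)[OF cA] cancD(2)[OF st(3)] cancD(2)[OF st(4)] AT by simp
    qed
    define s0 where "s0 = s \<boxdot> A \<boxdot> t"
    have s0: "s0 \<in> carrier S" "canc s0" "A \<boxdot> s0 \<boxdot> A = A"
      using st AS cA by (auto simp: s0_def times_assoc intro: canc_mult)
    define g where "g = x \<boxdot> a"
    \<comment> \<open>\<open>g'\<close> reads \<open>A\<close> from its second \<open>x\<close> to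
      the end, then \<open>s0\<close>, then \<open>A\<close> again up to the first \<open>x\<close>.
      Thus \<open>p' g g' g x q'\<close> is \<open>A s0 A\<close>, that is \<open>A\<close>.\<close>
    define g' where "g' = x \<boxdot> q' \<boxdot> s0 \<boxdot> p'"
    have gS: "g \<in> carrier S" "g' \<in> carrier S" using c pq s0 by (auto simp: g_def g'_def)
    have cg: "canc g" "canc g'" using can pq s0 by (auto simp: g_def g'_def intro: canc_mult)
    have A1: "A = p' \<boxdot> (g \<boxdot> (x \<boxdot> q'))" using c pq by (simp add: g_def times_assoc)
    have "g \<boxdot> (x \<boxdot> q') \<noteq> T" using A1 \<open>A \<noteq> T\<close> cancD(3)[OF pq(3)] by auto
    have "p' \<boxdot> (g \<boxdot> g' \<boxdot> (g \<boxdot> (x \<boxdot> q'))) = A \<boxdot> s0 \<boxdot> A"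
      using c pq(1,2) s0(1) gS by (simp add: A1 g'_def times_assoc)
    then have B: "g \<boxdot> g' \<boxdot> (g \<boxdot> (x \<boxdot> q')) = g \<boxdot> (x \<boxdot> q')"
      using cancD(5)[OF pq(3), of "g \<boxdot> g' \<boxdot> (g \<boxdot> (x \<boxdot> q'))" "g \<boxdot> (x \<boxdot> q')"] s0(3) A1 \<open>A \<noteq> T\<close> c pq(1,2) gS by simp
    have B1: "(g \<boxdot> g' \<boxdot> x) \<boxdot> (a \<boxdot> (x \<boxdot> q')) = x \<boxdot> (a \<boxdot> (x \<boxdot> q'))"
      using B c pq(1,2) gS by (simp add: g_def times_assoc)
    have can1: "canc (a \<boxdot> (x \<boxdot> q'))" using can pq by (auto intro: canc_mult)
    have "x \<boxdot> (a \<boxdot> (x \<boxdot> q')) \<noteq> T" using \<open>g \<boxdot> (x \<boxdot> q') \<noteq> T\<close> c pq by (simp add: g_def times_assoc)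
    then have 1: "g \<boxdot> g' \<boxdot> x = x" using cancD(4)[OF can1 B1] B1 c gS by simp
    have gx: "g \<boxdot> x \<noteq> T"
      using \<open>g \<boxdot> (x \<boxdot> q') \<noteq> T\<close> c pq(2) gS cancD(2)[OF pq(4)] by (metis times_assoc)
    have B2: "(g \<boxdot> (g' \<boxdot> g \<boxdot> x)) \<boxdot> q' = (g \<boxdot> x) \<boxdot> q'" using B c pq(2) gS by (simp add: times_assoc)
    have "(g \<boxdot> x) \<boxdot> q' \<noteq> T" using \<open>g \<boxdot> (x \<boxdot> q') \<noteq> T\<close> c pq(2) gS by (simp add: times_assoc)
    then have "g \<boxdot> (g' \<boxdot> g \<boxdot> x) = g \<boxdot> x" using cancD(4)[OF pq(4) B2] B2 c gS by simp
    then have 2: "g' \<boxdot> g \<boxdot> x = x" using cancD(5)[OF cg(1), of "g' \<boxdot> g \<boxdot> x" x] gx c gS by simp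
    have xT: "x \<noteq> T" using gx cancD(3)[OF cg(1)] by auto
    have u: "g \<in> carrier (unit_group (g \<boxdot> g'))" "(g \<boxdot> g') \<boxdot> (g \<boxdot> g') = g \<boxdot> g'"
      using unit_of_cancel[OF cg can(2) xT 1 2] .
    have "spow (\<boxdot>) g (Suc e) = g \<boxdot> g'" by (rule spow_unit[OF e _ u(2,1)]) (use gS in simp)
    then show ?thesis using 1 by (simp add: g_def del: spow.simps)
  qed
  moreover have "canc (spow (\<boxdot>) (x \<boxdot> a) (Suc e) \<boxdot> x)" by (intro canc_mult canc_spow can)
  ultimately show ?thesis using can(2) unfolding y_def by blast
qed

lemma satisfies_insertion_identity:
  assumes e: "fact (card (carrier S)) dvd Suc (Suc e)"
  shows "satisfies S (insertion_identity e (card (carrier S)))"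
  unfolding satisfies_def
proof (intro allI impI)
  fix \<rho> :: "nat \<Rightarrow> 'a" assume r: "range \<rho> \<subseteq> carrier S"
  then have v: "\<rho> n \<in> carrier S" for n by auto
  let ?C = "nest (\<boxdot>) (factor5 (\<boxdot>) (\<rho> 2) (\<rho> 0) (\<rho> 1) (\<rho> 3)) (\<lambda>i. \<rho> (6 + 2 * i)) (\<lambda>i. \<rho> (7 + 2 * i)) (card (carrier S))"
  have rb: "range (\<lambda>i. \<rho> (6 + 2 * i)) \<subseteq> carrier S" "range (\<lambda>i. \<rho> (7 + 2 * i)) \<subseteq> carrier S" using v by auto
  have C: "?C \<in> carrier S" using v rb by (simp add: factor5_def)
  have "frame (\<boxdot>) ?C (\<rho> 4) (\<rho> 0) (\<rho> 5) = frame (\<boxdot>) ?C (\<rho> 4) (spow (\<boxdot>) (\<rho> 0 \<boxdot> \<rho> 1) (Suc e) \<boxdot> \<rho> 0) (\<rho> 5)"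
    unfolding frame_def
  proof (rule framed_eq[OF C])
    assume "\<not> right_const ?C" "\<not> left_const ?C"
    then have "nonconst ?C" using C by (simp add: nonconst_def)
    then show "canc (\<rho> 0) \<and> canc (spow (\<boxdot>) (\<rho> 0 \<boxdot> \<rho> 1) (Suc e) \<boxdot> \<rho> 0) \<and>
        (?C \<noteq> T \<longrightarrow> \<rho> 0 = spow (\<boxdot>) (\<rho> 0 \<boxdot> \<rho> 1) (Suc e) \<boxdot> \<rho> 0)"
      by (rule insertion_key[OF e v v v v rb])
  qed (use v in simp_all)
  then show "eval S \<rho> (fst (insertion_identity e (card (carrier S)))) = eval S \<rho> (snd (insertion_identity e (card (carrier S))))"
    by (simp add: insertion_identity_def Let_def eval_frame eval_nest eval_spow factor5_def del: spow.simps)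
qed

lemma nonconst_spow: "nonconst (spow (\<boxdot>) x n) \<Longrightarrow> x \<in> carrier S \<Longrightarrow> nonconst x"
  using nonconst_mult[of _ x] by (cases n) auto

lemma canc_iter_prod: "(\<And>i. i \<le> n \<Longrightarrow> canc (u i)) \<Longrightarrow> canc (iter_prod (\<boxdot>) u n)"
  by (induction n) (auto intro: canc_mult)

lemma canc_prod_factor_ne_T:
  assumes "\<And>i. i \<le> n \<Longrightarrow> canc (u i)" "iter_prod (\<boxdot>) u n \<noteq> T" "i \<le> n"
  shows "u i \<noteq> T"
  using assms
proof (induction n)
  case (Suc n)
  have u: "canc (u (Suc n))" "canc (iter_prod (\<boxdot>) u n)" using Suc.prems(1) by (auto intro: canc_iter_prod)
  show ?case
  proof (cases "i \<le> n")
    case True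
    moreover have "iter_prod (\<boxdot>) u n \<noteq> T" using Suc.prems(2) cancD(2)[OF u(1)] by auto
    ultimately show ?thesis using Suc.IH Suc.prems(1) by simp
  next
    case False
    then have "i = Suc n" using Suc.prems(3) by simp
    then show ?thesis using Suc.prems(2) cancD(3)[OF u(2)] by auto
  qed
qed simp

text \<open>The certificate plays the role that nesting plays for the insertion identity: a value
  other than \<open>T\<close> puts all \<open>x a i\<close> into one multiplicative subgroup, which
  has at most \<open>card (carrier S)\<close> elements and so obeys the law.\<close>

lemma law_key:
  assumes e: "fact (card (carrier S)) dvd Suc (Suc e)" "card (carrier S) \<le> e"
    and law: "\<And>G \<rho>. group (G :: 'a monoid) \<Longrightarrow> finite (carrier G) \<Longrightarrow> card (carrier G) \<le> card (carrier S) \<Longrightarrow>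
      range \<rho> \<subseteq> carrier G \<Longrightarrow> word_value (monoid.mult G) \<rho> w = one G"
    and w: "vars w \<subseteq> {..q}"
    and c: "x \<in> carrier S" "range a \<subseteq> carrier S" "range b \<subseteq> carrier S"
    and nc: "nonconst (certificate (\<boxdot>) e x a b q)"
  shows "canc x \<and> canc (word_value (\<boxdot>) (\<lambda>i. x \<boxdot> a i) w \<boxdot> x) \<and>
    (certificate (\<boxdot>) e x a b q \<noteq> T \<longrightarrow> x = word_value (\<boxdot>) (\<lambda>i. x \<boxdot> a i) w \<boxdot> x)"
proof -
  have ab: "a i \<in> carrier S" "b i \<in> carrier S" for i using c by auto
  define u where "u i = x \<boxdot> a i \<boxdot> (x \<boxdot> b i)" for i
  define U where "U i = spow (\<boxdot>) (u i) (2 * e + 3)" for i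
  have uS: "u i \<in> carrier S" "U i \<in> carrier S" for i using c ab by (simp_all add: u_def U_def del: spow.simps)
  have cert: "certificate (\<boxdot>) e x a b q = iter_prod (\<boxdot>) U q" unfolding certificate_def U_def u_def ..
  have prS: "iter_prod (\<boxdot>) U n \<in> carrier S" for n by (induction n) (simp_all add: uS)
  have ncU: "nonconst (iter_prod (\<boxdot>) U n) \<Longrightarrow> i \<le> n \<Longrightarrow> nonconst (U i)" for n i
  proof (induction n)
    case (Suc n)
    then have "nonconst (iter_prod (\<boxdot>) U n)" "nonconst (U (Suc n))"
      using nonconst_mult[of "iter_prod (\<boxdot>) U n" "U (Suc n)"] prS uS by auto
    then show ?case using Suc by (auto simp: le_Suc_eq)
  qed simp
  have can: "canc x" "canc (a i)" "canc (b i)" if "i \<le> q" for i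
  proof -
    have "nonconst (u i)" using ncU[of q i] nc that nonconst_spow[OF _ uS(1)] unfolding cert U_def by blast
    then have "nonconst (x \<boxdot> a i)" "nonconst (x \<boxdot> b i)"
      using nonconst_mult[of "x \<boxdot> a i" "x \<boxdot> b i"] c ab by (simp_all add: u_def)
    then have "nonconst x" "nonconst (a i)" "nonconst (b i)"
      using nonconst_mult[of x "a i"] nonconst_mult[of x "b i"] c ab by simp_all
    then show "canc x" "canc (a i)" "canc (b i)" by (simp_all add: nonconst_canc)
  qed
  have cx: "canc x" using can[of 0] by simp
  \<comment> \<open>Indices above \<open>q\<close>, which do not occur in \<open>w\<close>, are sent
    to \<open>0\<close>, so that the whole assignment takes its values in the group.\<close>
  define \<rho> where "\<rho> i = x \<boxdot> a (if i \<le> q then i else 0)" for i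
  have gw: "word_value (\<boxdot>) (\<lambda>i. x \<boxdot> a i) w = word_value (\<boxdot>) \<rho> w"
    by (rule word_value_cong) (use w in \<open>auto simp: \<rho>_def\<close>)
  have \<rho>c: "canc (\<rho> i)" for i using can by (auto simp: \<rho>_def intro: canc_mult)
  have "word_value (\<boxdot>) \<rho> w \<in> Collect canc"
    by (rule word_value_closed) (auto intro: canc_mult \<rho>c)
  then have cgw: "canc (word_value (\<boxdot>) \<rho> w \<boxdot> x)" using cx by (auto intro: canc_mult)
  have "x = word_value (\<boxdot>) \<rho> w \<boxdot> x" if nT: "iter_prod (\<boxdot>) U q \<noteq> T"
  proof -
    have cU: "canc (u i)" "canc (U i)" if "i \<le> q" for i
      using can[OF that] unfolding U_def u_def by (auto intro!: canc_mult canc_spow simp del: spow.simps)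
    have unit: "\<exists>f\<in>carrier S. f \<boxdot> f = f \<and> f \<boxdot> x = x \<and> x \<noteq> T \<and> x \<boxdot> a i \<in> carrier (unit_group f)" if i: "i \<le> q" for i
    proof -
      have UT: "U i \<noteq> T" using canc_prod_factor_ne_T[of q U i] cU nT i by blast
      define E where "E = spow (\<boxdot>) (u i) (Suc e)"
      have ES: "E \<in> carrier S" and cE: "canc E" using uS cU[OF i] canc_spow by (simp_all add: E_def del: spow.simps)
      have EE: "E \<boxdot> E = U i" using spow_add[OF uS(1), of i "Suc e" "Suc e"] by (simp add: E_def U_def numeral_eq_Suc del: spow.simps)
      \<comment> \<open>The bound on \<open>e\<close> puts the power with exponent
        \<open>e + 2\<close> past the preperiod, and \<open>e + 2\<close> is a multiple of the
        period; hence \<open>E\<close> is idempotent.\<close>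
      have "U i = E" using spow_periodic[OF fin uS(1) e(1), of "Suc e" i] e(2)
        by (simp add: E_def U_def numeral_eq_Suc del: spow.simps)
      define z where "z = a i \<boxdot> (x \<boxdot> b i) \<boxdot> spow (\<boxdot>) (u i) e"
      have zS: "z \<in> carrier S" using c ab uS by (simp add: z_def)
      have uE: "u i \<boxdot> spow (\<boxdot>) (u i) e = E"
        using spow_add[OF uS(1), of i 0 e] by (simp add: E_def)
      have Exz: "E = x \<boxdot> z" using c ab uS by (simp add: uE[symmetric] z_def u_def[of i] times_assoc)
      have cz: "canc z" using can[OF i] cU[OF i] canc_spow by (auto simp: z_def intro!: canc_mult)
      have "E \<boxdot> x \<boxdot> z \<noteq> T" using EE UT ES c zS by (simp add: Exz times_assoc)
      then have "E \<boxdot> x \<noteq> T" using cancD(2)[OF cz] by auto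
      moreover have "E \<boxdot> (E \<boxdot> x) = E \<boxdot> x" using EE \<open>U i = E\<close> ES c by (simp flip: times_assoc)
      ultimately have Ex: "E \<boxdot> x = x" using cancD(5)[OF cE, of "E \<boxdot> x" x] ES c by simp
      define g where "g = x \<boxdot> a i"
      \<comment> \<open>\<open>spow (\<boxdot>) (u i) e\<close> has exponent \<open>e + 1\<close>,
        so \<open>g'\<close> completes \<open>g\<close> to the idempotent \<open>E\<close>, the
        power of \<open>u i\<close> with exponent \<open>e + 2\<close>.\<close>
      define g' where "g' = x \<boxdot> b i \<boxdot> spow (\<boxdot>) (u i) e"
      have gS: "g \<in> carrier S" "g' \<in> carrier S" using c ab uS by (simp_all add: g_def g'_def)
      have cg: "canc g" "canc g'" using can[OF i] cU[OF i] canc_spow by (auto simp: g_def g'_def intro!: canc_mult)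
      have gg': "g \<boxdot> g' = E" using c ab uS by (simp add: uE[symmetric] g_def g'_def u_def[of i] times_assoc)
      have 1: "g \<boxdot> g' \<boxdot> x = x" using gg' Ex by simp
      have "g \<boxdot> x \<boxdot> (b i \<boxdot> spow (\<boxdot>) (u i) e) = E" using gg' gS c ab uS by (simp add: g'_def times_assoc)
      moreover have "canc (b i \<boxdot> spow (\<boxdot>) (u i) e)" using can[OF i] cU[OF i] canc_spow by (auto intro!: canc_mult)
      ultimately have gx: "g \<boxdot> x \<noteq> T" using UT \<open>U i = E\<close> cancD(2) by metis
      have "g \<boxdot> (g' \<boxdot> g \<boxdot> x) = (g \<boxdot> g' \<boxdot> x) \<boxdot> a i \<boxdot> x" using gS c ab by (simp add: g_def times_assoc)
      then have "g \<boxdot> (g' \<boxdot> g \<boxdot> x) = g \<boxdot> x" unfolding 1 by (simp add: g_def)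
      then have 2: "g' \<boxdot> g \<boxdot> x = x" using cancD(5)[OF cg(1), of "g' \<boxdot> g \<boxdot> x" x] gx gS c by simp
      have xT: "x \<noteq> T" using gx cancD(3)[OF cg(1)] by auto
      show ?thesis using unit_of_cancel[OF cg cx xT 1 2] 1 xT gS by (intro bexI[of _ "g \<boxdot> g'"]) (simp_all add: g_def)
    qed
    obtain f where f: "f \<in> carrier S" "f \<boxdot> f = f" "f \<boxdot> x = x" "x \<noteq> T" using unit[of 0] by blast
    have "\<rho> i \<in> carrier (unit_group f)" for i
    proof -
      define k where "k = (if i \<le> q then i else 0)"
      have "k \<le> q" by (simp add: k_def)
      then obtain f' where f': "f' \<in> carrier S" "f' \<boxdot> x = x" "x \<boxdot> a k \<in> carrier (unit_group f')" using unit by blast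
      \<comment> \<open>The idempotents found for the various indices all fix \<open>x\<close>;
        cancelling \<open>x\<close> identifies them, so that a single group contains all the
        elements.\<close>
      have "f' = f" using cancD(4)[OF cx, of f' f] f f' by simp
      then show ?thesis using f' by (simp add: \<rho>_def k_def)
    qed
    then have "range \<rho> \<subseteq> carrier (unit_group f)" by auto
    then have "word_value (\<boxdot>) \<rho> w = f"
      using law[OF group_unit_group[OF f(1,2)]] unit_group_subset[of f] fin
      by (auto intro: finite_subset card_mono)
    then show ?thesis using f by simp
  qed
  then show ?thesis using cx cgw unfolding gw cert by blast
qed

lemma satisfies_law_identity:
  assumes e: "fact (card (carrier S)) dvd Suc (Suc e)" "card (carrier S) \<le> e"
    and law: "\<And>G \<rho>. group (G :: 'a monoid) \<Longrightarrow> finite (carrier G) \<Longrightarrow> card (carrier G) \<le> card (carrier S) \<Longrightarrow>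
      range \<rho> \<subseteq> carrier G \<Longrightarrow> word_value (monoid.mult G) \<rho> w = one G"
    and w: "vars w \<subseteq> {..q}"
  shows "satisfies S (law_identity e q w)"
  unfolding satisfies_def
proof (intro allI impI)
  fix \<rho> :: "nat \<Rightarrow> 'a" assume r: "range \<rho> \<subseteq> carrier S"
  then have v: "\<rho> n \<in> carrier S" for n by auto
  have rb: "range (\<lambda>i. \<rho> (3 + 2 * i)) \<subseteq> carrier S" "range (\<lambda>i. \<rho> (4 + 2 * i)) \<subseteq> carrier S" using v by auto
  let ?C = "certificate (\<boxdot>) e (\<rho> 0) (\<lambda>i. \<rho> (3 + 2 * i)) (\<lambda>i. \<rho> (4 + 2 * i)) q"
  let ?g = "word_value (\<boxdot>) (\<lambda>i. \<rho> 0 \<boxdot> \<rho> (3 + 2 * i)) w"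
  have C: "?C \<in> carrier S" unfolding certificate_def
    by (induction q) (simp_all add: v del: spow.simps)
  have g: "?g \<in> carrier S" by (rule word_value_closed) (auto simp: v)
  have "frame (\<boxdot>) ?C (\<rho> 1) (\<rho> 0) (\<rho> 2) = frame (\<boxdot>) ?C (\<rho> 1) (?g \<boxdot> \<rho> 0) (\<rho> 2)"
    unfolding frame_def
  proof (rule framed_eq[OF C])
    assume "\<not> right_const ?C" "\<not> left_const ?C"
    then have nc: "nonconst ?C" using C by (simp add: nonconst_def)
    show "canc (\<rho> 0) \<and> canc (?g \<boxdot> \<rho> 0) \<and> (?C \<noteq> T \<longrightarrow> \<rho> 0 = ?g \<boxdot> \<rho> 0)"
      by (rule law_key[OF e _ w v rb nc]) (rule law)
  qed (use v g in simp_all)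
  then show "eval S \<rho> (fst (law_identity e q w)) = eval S \<rho> (snd (law_identity e q w))"
    by (simp add: law_identity_def Let_def eval_frame eval_certificate eval_word_value del: spow.simps)
qed

end


section \<open>Return words\<close>

lemma set_spow_append: "set (spow (@) u n) = set u"
  by (induction n) auto

lemma spow_append_ne [simp]: "u \<noteq> [] \<Longrightarrow> spow (@) u n \<noteq> []"
  by (induction n) auto

definition star :: "'a list set \<Rightarrow> 'a list set" where
  "star R = concat ` lists R"

lemma star_Nil [simp]: "[] \<in> star R"
  unfolding star_def by (rule image_eqI[of _ _ "[]"]) auto

lemma star_base: "r \<in> R \<Longrightarrow> r \<in> star R"
  unfolding star_def by (rule image_eqI[of _ _ "[r]"]) auto

lemma star_append [simp]: "s \<in> star R \<Longrightarrow> t \<in> star R \<Longrightarrow> s @ t \<in> star R"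
proof -
  assume "s \<in> star R" "t \<in> star R"
  then obtain ss ts where "ss \<in> lists R" "s = concat ss" "ts \<in> lists R" "t = concat ts"
    unfolding star_def by (elim imageE)
  then have "s @ t = concat (ss @ ts)" "ss @ ts \<in> lists R" by auto
  then show ?thesis unfolding star_def by (rule image_eqI)
qed

lemma star_spow [simp]: "s \<in> star R \<Longrightarrow> spow (@) s n \<in> star R"
  by (induction n) auto

lemma star_iter_prod: "(\<And>i. u i \<in> star R) \<Longrightarrow> iter_prod (@) u n \<in> star R"
  by (induction n) auto

lemma star_induct [consumes 1, case_names Nil append]:
  assumes "t \<in> star R" "P []" "\<And>r t. r \<in> R \<Longrightarrow> t \<in> star R \<Longrightarrow> P t \<Longrightarrow> P (r @ t)"
  shows "P t"
proof -
  obtain ts where ts: "ts \<in> lists R" "t = concat ts" using assms(1) by (auto simp: star_def)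
  have "P (concat ts) \<and> concat ts \<in> star R" using ts(1)
  proof induction
    case (Cons r rs)
    then show ?case using assms(3) star_append[OF star_base[OF Cons(1)]] by simp
  qed (use assms(2) in simp)
  then show ?thesis using ts by simp
qed

context ai_semiring
begin

lemma val_frame:
  assumes "C \<in> words (carrier S)" "P \<in> words (carrier S)" "z \<in> words (carrier S)" "Q \<in> words (carrier S)"
  shows "val (C @ P @ z @ Q @ C) = frame (\<boxdot>) (val C) (val P) (val z) (val Q)"
  using assms by (simp add: frame_def val_app times_assoc)

lemma val_spow: "u \<in> words (carrier S) \<Longrightarrow> val (spow (@) u n) = spow (\<boxdot>) (val u) n"
proof (induction n)
  case (Suc n)
  then have "spow (@) u n \<in> words (carrier S)" by (simp add: words_def set_spow_append)
  then show ?case using Suc by (simp add: val_app)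
qed simp

lemma spow_words: "u \<in> words X \<Longrightarrow> spow (@) u n \<in> words X"
  by (simp add: words_def set_spow_append)

lemma words_iter_prod: "(\<And>i. u i \<in> words X) \<Longrightarrow> iter_prod (@) u n \<in> words X"
  by (induction n) auto

lemma val_iter_prod: "(\<And>i. u i \<in> words (carrier S)) \<Longrightarrow> val (iter_prod (@) u n) = iter_prod (\<boxdot>) (\<lambda>i. val (u i)) n"
  by (induction n) (simp_all add: val_app words_iter_prod)

lemma words_word_value: "(\<And>i. u i \<in> words X) \<Longrightarrow> word_value (@) u w \<in> words X"
  by (induction w) auto

lemma val_word_value: "(\<And>i. u i \<in> words (carrier S)) \<Longrightarrow> val (word_value (@) u w) = word_value (\<boxdot>) (\<lambda>i. val (u i)) w"
  by (induction w) (simp_all add: val_app words_word_value)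

end

text \<open>\<open>insertion\<close> is what the insertion identity yields for one fixed frame
  \<open>C\<close>. Since the words of \<open>R\<close> begin with \<open>x\<close>, an
  \<open>x\<close> follows each position between two of them, provided an \<open>x\<close> is also
  put at the end.\<close>

locale return_words = ai_semiring +
  fixes x :: 'a and R :: "'a list set" and C P Q :: "'a list" and e :: nat
  assumes R: "finite R" "R \<noteq> {}" "R \<subseteq> words (carrier S)" "\<And>r. r \<in> R \<Longrightarrow> \<exists>a. a \<noteq> [] \<and> r = x # a"
    and x: "x \<in> carrier S"
    and CPQ: "C \<in> words (carrier S)" "P \<in> words (carrier S)" "Q \<in> words (carrier S)"
    and insertion: "\<And>r p q. r \<in> R \<Longrightarrow> p \<in> words (carrier S) \<Longrightarrow> q \<in> words (carrier S) \<Longrightarrow>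
      val (C @ p @ [x] @ q @ C) = val (C @ p @ (spow (@) r (Suc e) @ [x]) @ q @ C)"
begin

text \<open>The letter \<open>x\<close> after \<open>t\<close> is the one before which
  \<open>insertion\<close> acts at the end of \<open>t\<close>.\<close>

definition \<Phi> :: "'a list \<Rightarrow> 'a" where
  "\<Phi> t = val (C @ P @ t @ [x] @ Q @ C)"

text \<open>\<open>\<kappa> t\<close> records the values of the product \<open>t\<close> of return words in all contexts, so \<open>G\<close> below
  is the syntactic monoid of these products.\<close>

definition \<kappa> :: "'a list \<Rightarrow> 'a list \<times> 'a list \<Rightarrow> 'a" where
  "\<kappa> t = (\<lambda>(p, s). if p \<in> star R \<and> s \<in> star R then \<Phi> (p @ t @ s) else undefined)"

lemma \<kappa>_eqI: "(\<And>p s. p \<in> star R \<Longrightarrow> s \<in> star R \<Longrightarrow> \<Phi> (p @ t @ s) = \<Phi> (p @ t' @ s)) \<Longrightarrow> \<kappa> t = \<kappa> t'"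
  by (auto simp: \<kappa>_def fun_eq_iff)

lemma \<kappa>_eqD:
  assumes "\<kappa> t = \<kappa> t'" "p \<in> star R" "s \<in> star R"
  shows "\<Phi> (p @ t @ s) = \<Phi> (p @ t' @ s)"
  using fun_cong[OF assms(1), of "(p, s)"] assms(2,3) by (simp add: \<kappa>_def)

lemma \<kappa>_append:
  assumes "\<kappa> s = \<kappa> s'" "\<kappa> t = \<kappa> t'" "s' \<in> star R" "t \<in> star R"
  shows "\<kappa> (s @ t) = \<kappa> (s' @ t')"
proof (rule \<kappa>_eqI)
  fix p q assume pq: "p \<in> star R" "q \<in> star R"
  have "\<Phi> (p @ (s @ t) @ q) = \<Phi> (p @ s' @ (t @ q))" using \<kappa>_eqD[OF assms(1) pq(1), of "t @ q"] assms(4) pq by simp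
  also have "\<dots> = \<Phi> (p @ (s' @ t') @ q)" using \<kappa>_eqD[OF assms(2) _ pq(2), of "p @ s'"] assms(3) pq by simp
  finally show "\<Phi> (p @ (s @ t) @ q) = \<Phi> (p @ (s' @ t') @ q)" .
qed

lemma star_shape:
  assumes "t \<in> star R" "t \<noteq> []"
  shows "\<exists>a. a \<noteq> [] \<and> t = x # a"
  using assms
proof (induction rule: star_induct)
  case (append r t)
  from R(4)[OF append(1)] obtain a where "a \<noteq> []" "r = x # a" by auto
  then show ?case by (intro exI[of _ "a @ t"]) simp
qed simp

lemma set_star:
  assumes "t \<in> star R"
  shows "set t \<subseteq> carrier S"
  using assms
proof (induction rule: star_induct)
  case (append r t)
  have "set r \<subseteq> carrier S" using R(3) append(1) by (auto simp: words_def)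
  then show ?case using append by simp
qed simp

lemma \<kappa>_exponent:
  assumes r: "r \<in> R"
  shows "\<kappa> (spow (@) r (Suc e)) = \<kappa> []"
proof (rule \<kappa>_eqI)
  fix p s assume ps: "p \<in> star R" "s \<in> star R"
  \<comment> \<open>Whether \<open>s\<close> is empty or begins a further return word, the next
    letter is \<open>x\<close>.\<close>
  obtain q where q: "s @ [x] @ Q = x # q" "q \<in> words (carrier S)"
  proof (cases "s = []")
    case True
    then show ?thesis using that[of Q] CPQ by simp
  next
    case False
    then obtain a where "a \<noteq> []" "s = x # a" using star_shape ps by blast
    then show ?thesis using that[of "a @ [x] @ Q"] CPQ(3) x set_star[OF ps(2)] by (simp add: words_def)
  qed
  have p: "P @ p \<in> words (carrier S)" using CPQ(2) set_star[OF ps(1)] by (simp add: words_def)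
  have "val (C @ (P @ p) @ [x] @ q @ C) = val (C @ (P @ p) @ (spow (@) r (Suc e) @ [x]) @ q @ C)"
    by (rule insertion[OF r p q(2)])
  moreover have "[x] @ q @ C = s @ [x] @ Q @ C" using q(1) by (metis Cons_eq_appendI append_assoc self_append_conv2)
  ultimately show "\<Phi> (p @ spow (@) r (Suc e) @ s) = \<Phi> (p @ [] @ s)"
    unfolding \<Phi>_def by (simp del: spow.simps append_Cons)
qed

definition G :: "('a list \<times> 'a list \<Rightarrow> 'a) monoid" where
  "G = \<lparr>carrier = \<kappa> ` star R,
        monoid.mult = (\<lambda>g h. \<kappa> (inv_into (star R) \<kappa> g @ inv_into (star R) \<kappa> h)), one = \<kappa> []\<rparr>"

lemma carrier_G: "carrier G = \<kappa> ` star R" and one_G: "one G = \<kappa> []"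
  by (simp_all add: G_def)

text \<open>By \<open>\<kappa>_append\<close>, equality of \<open>\<kappa>\<close> is a congruence,
  so the chosen representatives do not matter.\<close>

lemma mult_G:
  assumes "s \<in> star R" "t \<in> star R"
  shows "monoid.mult G (\<kappa> s) (\<kappa> t) = \<kappa> (s @ t)"
proof -
  have "inv_into (star R) \<kappa> (\<kappa> u) \<in> star R" "\<kappa> (inv_into (star R) \<kappa> (\<kappa> u)) = \<kappa> u" if "u \<in> star R" for u
    using that by (simp_all add: inv_into_into f_inv_into_f)
  then have "\<kappa> (inv_into (star R) \<kappa> (\<kappa> s) @ inv_into (star R) \<kappa> (\<kappa> t)) = \<kappa> (s @ t)"
    using assms by (intro \<kappa>_append)
  then show ?thesis by (simp add: G_def)
qed

text \<open>The power of a return word with exponent \<open>e + 1\<close> is its inverse; for a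
  product the inverses are multiplied in reverse order.\<close>

lemma inverse_word:
  assumes "t \<in> star R"
  shows "\<exists>s\<in>star R. \<kappa> (s @ t) = \<kappa> []"
  using assms
proof (induction rule: star_induct)
  case Nil
  show ?case by (rule bexI[of _ "[]"]) auto
next
  case (append r t)
  then obtain s where s: "s \<in> star R" "\<kappa> (s @ t) = \<kappa> []" by blast
  have "\<kappa> (s @ spow (@) r (Suc e) @ t) = \<kappa> (s @ [] @ t)"
  proof (rule \<kappa>_append[OF refl])
    show "\<kappa> (spow (@) r (Suc e) @ t) = \<kappa> ([] @ t)"
      by (rule \<kappa>_append[OF \<kappa>_exponent[OF append(1)] refl star_Nil append(2)])
    show "s \<in> star R" by (rule s(1))
    show "spow (@) r (Suc e) @ t \<in> star R" by (intro star_append star_spow star_base append(1,2))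
  qed
  then have "\<kappa> ((s @ spow (@) r e) @ (r @ t)) = \<kappa> []" using s by simp
  then show ?case using s(1) star_base[OF append(1)] by (intro bexI[of _ "s @ spow (@) r e"]) simp_all
qed

lemma group_G: "group G"
proof (rule groupI)
  show "one G \<in> carrier G" by (auto simp: carrier_G one_G)
  fix g assume "g \<in> carrier G"
  then obtain s where s: "s \<in> star R" "g = \<kappa> s" by (auto simp: carrier_G)
  show "monoid.mult G (one G) g = g" using s mult_G[of "[]" s] by (simp add: one_G)
  obtain s' where "s' \<in> star R" "\<kappa> (s' @ s) = \<kappa> []" using inverse_word s by blast
  then show "\<exists>h\<in>carrier G. monoid.mult G h g = one G" using s by (auto simp: carrier_G one_G mult_G)
  fix h assume "h \<in> carrier G"
  then obtain t where t: "t \<in> star R" "h = \<kappa> t" by (auto simp: carrier_G)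
  show "monoid.mult G g h \<in> carrier G" using s t by (auto simp: carrier_G mult_G)
  fix k assume "k \<in> carrier G"
  then obtain u where u: "u \<in> star R" "k = \<kappa> u" by (auto simp: carrier_G)
  show "monoid.mult G (monoid.mult G g h) k = monoid.mult G g (monoid.mult G h k)"
    using s t u by (simp add: mult_G)
qed

lemma generate_G: "generate G (\<kappa> ` R) = carrier G"
proof -
  interpret group G by (rule group_G)
  have RG: "\<kappa> ` R \<subseteq> carrier G" unfolding carrier_G by (intro image_mono subsetI star_base)
  have "\<kappa> t \<in> generate G (\<kappa> ` R)" if "t \<in> star R" for t
    using that
  proof (induction rule: star_induct)
    case Nil
    show ?case using generate.one[of G] by (simp add: one_G)
  next
    case (append r t)
    then have "monoid.mult G (\<kappa> r) (\<kappa> t) \<in> generate G (\<kappa> ` R)"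
      by (intro generate.eng[OF generate.incl]) auto
    then show ?case using append(2) star_base[OF append(1)] by (simp add: mult_G)
  qed
  then show ?thesis using generate_incl[OF RG] by (auto simp: carrier_G)
qed

text \<open>A power with trivial class in front makes the representative nonempty, so that even the
  identity of \<open>G\<close> can be substituted into a law.\<close>

lemma nonempty_representative:
  assumes "t \<in> star R"
  shows "\<exists>a. a \<noteq> [] \<and> set a \<subseteq> carrier S \<and> x # a \<in> star R \<and> \<kappa> (x # a) = \<kappa> t"
proof -
  obtain r where r: "r \<in> R" using R by blast
  define t' where "t' = spow (@) r (Suc e) @ t"
  have t': "t' \<in> star R" using star_base[OF r] assms by (simp add: t'_def del: spow.simps)
  have "t' \<noteq> []" using R(4)[OF r] by (auto simp: t'_def)
  then obtain a where a: "a \<noteq> []" "t' = x # a" using star_shape t' by blast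
  have "\<kappa> t' = \<kappa> ([] @ t)" unfolding t'_def
    by (rule \<kappa>_append[OF \<kappa>_exponent[OF r] refl _ assms]) simp
  then show ?thesis using a t' set_star[OF t'] by auto
qed

lemma \<kappa>_word_value: "(\<And>i. u i \<in> star R) \<Longrightarrow> word_value (@) u w \<in> star R \<and> \<kappa> (word_value (@) u w) = word_value (monoid.mult G) (\<lambda>i. \<kappa> (u i)) w"
proof (induction w)
  case (Plus s t) then show ?case using mult_G[of "word_value (@) u s" "word_value (@) u t"] by simp
next
  case (Times s t) then show ?case using mult_G[of "word_value (@) u s" "word_value (@) u t"] by simp
qed simp

lemma \<kappa>_spow_trivial:
  assumes "u \<in> star R" "\<kappa> u = \<kappa> []"
  shows "\<kappa> (spow (@) u n) = \<kappa> []"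
proof (induction n)
  case (Suc n)
  show ?case using \<kappa>_append[OF Suc assms(2) star_Nil assms(1)] by simp
qed (use assms in simp)

lemma \<kappa>_iter_prod_trivial:
  assumes "\<And>i. u i \<in> star R \<and> \<kappa> (u i) = \<kappa> []"
  shows "\<kappa> (iter_prod (@) u n) = \<kappa> []"
proof (induction n)
  case (Suc n)
  have u: "u (Suc n) \<in> star R" "\<kappa> (u (Suc n)) = \<kappa> []" using assms by auto
  show ?case using \<kappa>_append[OF Suc u(2) star_Nil u(1)] by simp
qed (use assms in simp)

text \<open>With \<open>x b i\<close> inverse to \<open>x a i\<close>, the certificate
  \<open>B\<close> is trivial in \<open>G\<close>. Copies of \<open>B\<close> can therefore be
  created on both sides of any context, and between them the identity applies.\<close>

lemma law_G:
  assumes sat: "satisfies S (law_identity e q w)" and \<rho>: "range \<rho> \<subseteq> carrier G"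
  shows "word_value (monoid.mult G) \<rho> w = one G"
proof -
  interpret group G by (rule group_G)
  have "\<exists>a. a \<noteq> [] \<and> set a \<subseteq> carrier S \<and> x # a \<in> star R \<and> \<kappa> (x # a) = \<rho> i" for i
  proof -
    have "\<rho> i \<in> carrier G" using \<rho> by auto
    then show ?thesis using nonempty_representative by (auto simp: carrier_G)
  qed
  then obtain a where a: "\<And>i. a i \<noteq> [] \<and> set (a i) \<subseteq> carrier S \<and> x # a i \<in> star R \<and> \<kappa> (x # a i) = \<rho> i"
    by metis
  have "\<exists>b. b \<noteq> [] \<and> set b \<subseteq> carrier S \<and> x # b \<in> star R \<and> \<kappa> (x # b) = inv\<^bsub>G\<^esub> (\<rho> i)" for i
  proof -
    have "inv\<^bsub>G\<^esub> (\<rho> i) \<in> carrier G" using \<rho> by auto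
    then show ?thesis using nonempty_representative by (auto simp: carrier_G)
  qed
  then obtain b where b: "\<And>i. b i \<noteq> [] \<and> set (b i) \<subseteq> carrier S \<and> x # b i \<in> star R \<and> \<kappa> (x # b i) = inv\<^bsub>G\<^esub> (\<rho> i)"
    by metis
  have xw: "[x] \<in> words (carrier S)" using x by (simp add: words_def)
  have aw: "a i \<in> words (carrier S)" and bw: "b i \<in> words (carrier S)" for i using a b by (auto simp: words_def)
  define B where "B = certificate (@) e [x] a b q"
  have u: "([x] @ a i) @ ([x] @ b i) \<in> star R \<and> \<kappa> (([x] @ a i) @ ([x] @ b i)) = \<kappa> []" for i
  proof -
    have "\<rho> i \<in> carrier G" using \<rho> by auto
    then have "monoid.mult G (\<kappa> (x # a i)) (\<kappa> (x # b i)) = \<kappa> []" using a b by (simp flip: one_G)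
    then show ?thesis using a[of i] b[of i] mult_G[of "x # a i" "x # b i"]
        star_append[of "x # a i" R "x # b i"] by simp
  qed
  have Bs: "B \<in> star R" and B1: "\<kappa> B = \<kappa> []"
    unfolding B_def certificate_def using u by (auto intro!: star_iter_prod \<kappa>_iter_prod_trivial \<kappa>_spow_trivial simp del: append_Cons spow.simps)
  have Bw: "B \<in> words (carrier S)"
    unfolding B_def certificate_def by (intro words_iter_prod spow_words words_append xw aw bw)
  have vB: "val B = certificate (\<boxdot>) e x (\<lambda>i. val (a i)) (\<lambda>i. val (b i)) q"
    unfolding B_def certificate_def using xw aw bw
    by (subst val_iter_prod) (auto intro!: spow_words simp: val_spow val_app simp del: append_Cons spow.simps append_assoc)
  have xa: "[x] @ a i \<in> words (carrier S)" for i using xw aw by (rule words_append)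
  define W where "W = word_value (@) (\<lambda>i. [x] @ a i) w"
  have Ww: "W \<in> words (carrier S)" unfolding W_def using xa by (rule words_word_value)
  have vW: "val W = word_value (\<boxdot>) (\<lambda>i. x \<boxdot> val (a i)) w"
    unfolding W_def using val_word_value[of "\<lambda>i. [x] @ a i", OF xa] xw aw by (simp add: val_app del: append_Cons)
  have law: "val (B @ p @ [x] @ s @ B) = val (B @ p @ (W @ [x]) @ s @ B)"
    if ps: "p \<in> words (carrier S)" "s \<in> words (carrier S)" for p s
  proof -
    define \<sigma> where "\<sigma> n = (if n = 0 then x else if n = 1 then val p else if n = 2 then val s
      else if odd n then val (a ((n - 3) div 2)) else val (b ((n - 4) div 2)))" for n :: nat
    have "\<sigma> n \<in> carrier S" for n using x ps aw bw by (auto simp: \<sigma>_def)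
    then have r: "range \<sigma> \<subseteq> carrier S" by auto
    have \<sigma>s: "\<sigma> 0 = x" "\<sigma> (Suc 0) = val p" "\<sigma> 2 = val s"
      "\<And>i. \<sigma> (3 + 2 * i) = val (a i)" "\<And>i. \<sigma> (4 + 2 * i) = val (b i)"
      by (auto simp: \<sigma>_def)
    have "frame (\<boxdot>) (val B) (val p) x (val s) = frame (\<boxdot>) (val B) (val p) (val W \<boxdot> x) (val s)"
      using sat r unfolding law_identity_def Let_def
      by (auto dest!: satisfies_eval simp: eval_frame eval_certificate eval_word_value \<sigma>s vB vW simp del: spow.simps)
    then show ?thesis
      unfolding val_frame[OF Bw ps(1) xw ps(2)] val_frame[OF Bw ps(1) words_append[OF Ww xw] ps(2)] val_app[OF Ww xw]
      by simp
  qed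
  have "\<kappa> W = \<kappa> []"
  proof (rule \<kappa>_eqI)
    fix p s assume ps: "p \<in> star R" "s \<in> star R"
    have "s @ B \<in> star R" "s @ B \<noteq> []" using ps Bs Bw by (auto simp: words_def)
    from star_shape[OF this] obtain s' where s': "s' \<noteq> []" "s @ B = [x] @ s'" by auto
    have s'w: "s' \<in> words (carrier S)" using s' set_star[OF \<open>s @ B \<in> star R\<close>] by (simp add: words_def)
    have spow: "B @ p \<in> words (carrier S)" using Bw set_star[OF ps(1)] by (simp add: words_def)
    have WS: "W \<in> star R" unfolding W_def by (rule conjunct1[OF \<kappa>_word_value]) (use a in simp)
    \<comment> \<open>Two copies per side: the outer ones are the frame, the inner ones make
      \<open>B @ p\<close> and \<open>s'\<close> nonempty. The inner copy on the right also provides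
      the letter \<open>x\<close> when \<open>s\<close> is empty.\<close>
    have BB: "\<kappa> (B @ B) = \<kappa> ([] @ [])" using B1 Bs by (intro \<kappa>_append) auto
    have frame: "\<Phi> (p @ t @ s) = \<Phi> ((B @ B @ p) @ t @ (s @ B @ B))" if t: "t \<in> star R" for t
    proof -
      have "\<kappa> ((B @ B) @ (p @ t @ s) @ (B @ B)) = \<kappa> (([] @ []) @ (p @ t @ s) @ ([] @ []))"
        by (rule \<kappa>_append[OF BB \<kappa>_append[OF refl BB]]) (use ps t Bs in simp_all)
      from \<kappa>_eqD[OF this star_Nil star_Nil] show ?thesis by simp
    qed
    define V where "V = [x] @ Q @ C"
    have cl: "set (C @ P) \<subseteq> carrier S" "C @ P \<noteq> []" "set V \<subseteq> carrier S" "V \<noteq> []"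
      using CPQ x by (auto simp: words_def V_def)
    have split: "val ((C @ P) @ M @ V) = val (C @ P) \<boxdot> (val M \<boxdot> val V)" if "M \<in> words (carrier S)" for M
      using that cl by (simp add: val_append words_def del: append_assoc)
    have eq: "(B @ B @ p) @ t @ (s @ B @ B) = B @ (B @ p) @ (t @ [x]) @ s' @ B" for t
      using s'(2) by (metis append_assoc)
    have M: "B @ (B @ p) @ (t @ [x]) @ s' @ B \<in> words (carrier S)" if "set t \<subseteq> carrier S" for t
      using Bw spow s'w x that by (simp add: words_def)
    have \<Phi>: "\<Phi> ((B @ B @ p) @ t @ (s @ B @ B)) = val (C @ P) \<boxdot> (val (B @ (B @ p) @ (t @ [x]) @ s' @ B) \<boxdot> val V)"
      if "set t \<subseteq> carrier S" for t
      using split[OF M[OF that]] unfolding eq \<Phi>_def V_def by simp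
    have "\<Phi> (p @ W @ s) = \<Phi> ((B @ B @ p) @ W @ (s @ B @ B))" by (rule frame[OF WS])
    also have "\<dots> = val (C @ P) \<boxdot> (val (B @ (B @ p) @ (W @ [x]) @ s' @ B) \<boxdot> val V)"
      using Ww by (intro \<Phi>) (simp add: words_def)
    also have "\<dots> = val (C @ P) \<boxdot> (val (B @ (B @ p) @ ([] @ [x]) @ s' @ B) \<boxdot> val V)"
      using law[OF spow s'w] by simp
    also have "\<dots> = \<Phi> ((B @ B @ p) @ [] @ (s @ B @ B))" by (rule \<Phi>[symmetric]) simp
    also have "\<dots> = \<Phi> (p @ [] @ s)" by (rule frame[symmetric]) simp
    finally show "\<Phi> (p @ W @ s) = \<Phi> (p @ [] @ s)" .
  qed
  moreover have "\<kappa> W = word_value (monoid.mult G) (\<lambda>i. \<kappa> ([x] @ a i)) w"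
    unfolding W_def by (rule conjunct2[OF \<kappa>_word_value]) (use a in simp)
  moreover have "(\<lambda>i. \<kappa> ([x] @ a i)) = \<rho>" using a by auto
  ultimately show ?thesis by (simp add: one_G)
qed

text \<open>\<open>\<Phi> t\<close> is \<open>\<kappa> t\<close> in the empty context, so it
  suffices that \<open>G\<close> is finite; \<open>law_G\<close> gives it both laws required by
  \<open>finite_of_chief_law\<close>.\<close>

lemma finite_\<Phi>:
  assumes n: "0 < n"
    and exponent: "satisfies S (law_identity e q (spow Times (Var 0) (Suc e)))"
    and chief_word: "satisfies S (law_identity e q' (chief_word Times e n (\<lambda>i. Var (2 * i)) (\<lambda>i. Var (2 * i + 1))))"
  shows "finite (\<Phi> ` star R)"
proof -
  interpret group G by (rule group_G)
  have "finite (carrier G)"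
  proof (rule finite_of_chief_law[OF _ _ generate_G n])
    show "finite (\<kappa> ` R)" using R(1) by simp
    show "\<kappa> ` R \<subseteq> carrier G" unfolding carrier_G by (intro image_mono subsetI star_base)
    show "spow (monoid.mult G) g (Suc e) = one G" if "g \<in> carrier G" for g
    proof -
      have "range (\<lambda>_::nat. g) \<subseteq> carrier G" using that by auto
      from law_G[OF exponent this] show ?thesis by (simp only: word_value_spow word_value.simps)
    qed
    fix Y Z :: "nat \<Rightarrow> _" assume YZ: "range Y \<subseteq> carrier G" "range Z \<subseteq> carrier G"
    have "range (\<lambda>i. if even i then Y (i div 2) else Z (i div 2)) \<subseteq> carrier G" using YZ by auto
    from law_G[OF chief_word this] show "chief_word (monoid.mult G) e n Y Z = one G" using n by (simp add: word_value_chief_word)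
  qed
  then have "finite ((\<lambda>k. k ([], [])) ` (\<kappa> ` star R))" by (simp add: carrier_G)
  moreover have "(\<lambda>k. k ([], [])) ` (\<kappa> ` star R) = \<Phi> ` star R" by (auto simp: \<kappa>_def image_image)
  ultimately show ?thesis by simp
qed

end

lemma recurrent_factors_bound:
  assumes L: "recurrent_language L" and R: "finite R" "R \<subseteq> L"
  shows "\<exists>n. \<forall>w\<in>L. n \<le> length w \<longrightarrow> (\<forall>r\<in>R. \<exists>p s. w = p @ r @ s)"
proof -
  have "\<forall>r\<in>R. \<exists>n. \<forall>w\<in>L. n \<le> length w \<longrightarrow> (\<exists>p s. w = p @ r @ s)"
    using L R(2) by (auto simp: recurrent_language_def)
  then obtain n where n: "\<And>r w. r \<in> R \<Longrightarrow> w \<in> L \<Longrightarrow> n r \<le> length w \<Longrightarrow> \<exists>p s. w = p @ r @ s"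
    by metis
  have "n r \<le> (\<Sum>r\<in>R. n r)" if "r \<in> R" for r using that R(1) by (rule member_le_sum[OF _ le0])
  then show ?thesis using n by (intro exI[of _ "\<Sum>r\<in>R. n r"]) (meson le_trans)
qed

text \<open>A block need not be a first return and may contain \<open>x\<close> again; the length
  bound keeps the set finite. It has at least two letters so that the part after \<open>x\<close>
  can be substituted for a variable.\<close>

definition blocks :: "'a list set \<Rightarrow> 'a \<Rightarrow> nat \<Rightarrow> 'a list set" where
  "blocks L x n = {r. r @ [x] \<in> L \<and> (\<exists>a. a \<noteq> [] \<and> r = x # a) \<and> length r \<le> n}"

lemma mem_star_blocks:
  assumes L: "recurrent_language L"
    and n: "\<And>w. w \<in> L \<Longrightarrow> n \<le> length w \<Longrightarrow> \<exists>p s. w = p @ [x] @ s"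
  shows "a \<noteq> [] \<Longrightarrow> (x # a) @ [x] \<in> L \<Longrightarrow> x # a \<in> star (blocks L x (n + 3))"
proof (induction a rule: length_induct)
  case (1 a)
  note fac = recurrent_factorial[OF L]
  show ?case
  proof (cases "length (x # a) \<le> n + 3")
    case True
    then show ?thesis using 1(2,3) by (intro star_base) (auto simp: blocks_def)
  next
    case False
    obtain y a1 where a1: "a = y # a1" using 1(2) by (cases a) auto
    \<comment> \<open>The window \<open>m\<close> is long enough to contain \<open>x\<close>.
      Skipping \<open>y\<close> gives the block that is split off a second letter, and the bound
      \<open>n + 3\<close> leaves a nonempty rest after the window.\<close>
    define m where "m = take n a1"
    define r where "r = drop n a1"
    have eq: "a = [y] @ m @ r" by (simp add: a1 m_def r_def)
    have lm: "length m = n" "length r \<ge> 2" using False by (simp_all add: a1 m_def r_def)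
    have "[x, y] @ m @ (r @ [x]) \<in> L" using 1(3) eq by simp
    then have "m \<in> L" by (rule fac)
    then obtain p s where ps: "m = p @ [x] @ s" using n lm(1) by blast
    have e2: "(x # a) @ [x] = [] @ ((x # y # p) @ [x]) @ (s @ r @ [x])"
      "(x # a) @ [x] = (x # y # p) @ ((x # s @ r) @ [x]) @ []" using eq ps by simp_all
    have "(x # y # p) @ [x] \<in> L" using 1(3) unfolding e2(1) by (rule fac)
    moreover have "length (x # y # p) \<le> n + 3" using ps lm by simp
    ultimately have b: "x # y # p \<in> star (blocks L x (n + 3))" by (intro star_base) (auto simp: blocks_def)
    have "(x # s @ r) @ [x] \<in> L" using 1(3) unfolding e2(2) by (rule fac)
    moreover have "s @ r \<noteq> []" "length (s @ r) < length a" using lm ps eq by auto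
    ultimately have "x # s @ r \<in> star (blocks L x (n + 3))" using 1(1) by blast
    then have "(x # y # p) @ (x # s @ r) \<in> star (blocks L x (n + 3))" using b by (rule star_append[rotated])
    then show ?thesis using eq ps by simp
  qed
qed

section \<open>Local finiteness from the insertion identity and the two group laws\<close>

context ai_semiring
begin

lemma insertion_identity_apply:
  assumes sat: "satisfies S (insertion_identity e N)"
    and w: "[x] \<in> words (carrier S)" "a \<in> words (carrier S)" "h \<in> words (carrier S)" "h' \<in> words (carrier S)"
      "p \<in> words (carrier S)" "q \<in> words (carrier S)" "range b \<subseteq> words (carrier S)" "range c \<subseteq> words (carrier S)"
    and C: "C = nest (@) (h @ ([x] @ a) @ [x] @ h') b c N"
  shows "val (C @ p @ [x] @ q @ C) = val (C @ p @ (spow (@) ([x] @ a) (Suc e) @ [x]) @ q @ C)"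
proof -
  have yw: "h @ ([x] @ a) @ [x] @ h' \<in> words (carrier S)" using w by (intro words_append)
  have Cw: "C \<in> words (carrier S)" unfolding C using yw w(7,8) by (rule nest_words)
  have x: "x \<in> carrier S" using w(1) by (simp add: words_def)
  have xaw: "[x] @ a \<in> words (carrier S)" using w by (intro words_append)
  have zw: "spow (@) ([x] @ a) (Suc e) @ [x] \<in> words (carrier S)" using w by (intro words_append spow_words)
  have vz: "val (spow (@) ([x] @ a) (Suc e) @ [x]) = spow (\<boxdot>) (x \<boxdot> val a) (Suc e) \<boxdot> x"
  proof -
    have "val (spow (@) ([x] @ a) (Suc e) @ [x]) = val (spow (@) ([x] @ a) (Suc e)) \<boxdot> val [x]"
      by (rule val_app) (intro spow_words xaw w)+
    also have "val (spow (@) ([x] @ a) (Suc e)) = spow (\<boxdot>) (val ([x] @ a)) (Suc e)" by (rule val_spow[OF xaw])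
    also have "val ([x] @ a) = val [x] \<boxdot> val a" using w by (intro val_app)
    finally show ?thesis by simp
  qed
  have vy: "val (h @ ([x] @ a) @ [x] @ h') = factor5 (\<boxdot>) (val h) x (val a) (val h')"
    using w x by (simp add: factor5_def val_app times_assoc del: append_Cons append_assoc)
  have vC: "val C = nest (\<boxdot>) (factor5 (\<boxdot>) (val h) x (val a) (val h')) (\<lambda>i. val (b i)) (\<lambda>i. val (c i)) N"
    unfolding C using val_nest[OF yw w(7,8)] by (simp only: vy)
  define \<sigma> where "\<sigma> n = (if n = 0 then x else if n = 1 then val a else if n = 2 then val h else if n = 3 then val h'
    else if n = 4 then val p else if n = 5 then val q
    else if even n then val (b ((n - 6) div 2)) else val (c ((n - 7) div 2)))" for n :: nat
  have bc: "val (b i) \<in> carrier S" "val (c i) \<in> carrier S" for i using w(7,8) by (auto simp: image_subset_iff)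
  have "\<sigma> n \<in> carrier S" for n using x w bc by (auto simp: \<sigma>_def)
  then have r: "range \<sigma> \<subseteq> carrier S" by auto
  have \<sigma>s: "\<sigma> 0 = x" "\<sigma> (Suc 0) = val a" "\<sigma> 2 = val h" "\<sigma> 3 = val h'" "\<sigma> 4 = val p" "\<sigma> 5 = val q"
    "\<And>i. \<sigma> (6 + 2 * i) = val (b i)" "\<And>i. \<sigma> (7 + 2 * i) = val (c i)"
    by (auto simp: \<sigma>_def)
  have "frame (\<boxdot>) (val C) (val p) x (val q) = frame (\<boxdot>) (val C) (val p) (spow (\<boxdot>) (x \<boxdot> val a) (Suc e) \<boxdot> x) (val q)"
    using sat r unfolding insertion_identity_def Let_def vC
    by (auto dest!: satisfies_eval simp: eval_frame eval_nest eval_spow factor5_def \<sigma>s simp del: spow.simps)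
  then show ?thesis
    unfolding val_frame[OF Cw w(5,1,6)] val_frame[OF Cw w(5) zw w(6)] vz by simp
qed

text \<open>All geodesics with the same value have the same length.\<close>

lemma geodesic_lengths_finite:
  assumes "finite V"
  shows "finite {length w | w. geodesic X w \<and> w \<noteq> [] \<and> val w \<in> V}"
proof (rule finite_subset)
  define m where "m v = (LEAST k. \<exists>w\<in>words X. val w = v \<and> length w = k)" for v
  show "{length w | w. geodesic X w \<and> w \<noteq> [] \<and> val w \<in> V} \<subseteq> m ` V"
  proof
    fix l assume "l \<in> {length w | w. geodesic X w \<and> w \<noteq> [] \<and> val w \<in> V}"
    then obtain w where w: "l = length w" "geodesic X w" "w \<noteq> []" "val w \<in> V" by blast
    then have "w \<in> words X" by (simp add: geodesic_def words_def)
    then have "m (val w) = length w" unfolding m_def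
      using w by (intro Least_equality) (auto simp: geodesic_def)
    then show "l \<in> m ` V" using w by (metis imageI)
  qed
qed (use assms in simp)

text \<open>The language contains geodesics \<open>C P t x Q C\<close> of unbounded length with
  \<open>t\<close> a product of return words, but their values \<open>\<Phi> t\<close> form a finite
  set.\<close>

lemma flat_identities_finite:
  assumes ins: "satisfies S (insertion_identity e N)" and n: "0 < n"
    and exponent: "satisfies S (law_identity e q (spow Times (Var 0) (Suc e)))"
    and chief_word: "satisfies S (law_identity e q' (chief_word Times e n (\<lambda>i. Var (2 * i)) (\<lambda>i. Var (2 * i + 1))))"
    and X: "finite X" "X \<subseteq> carrier S" "generated S X = carrier S"
  shows "finite (carrier S)"
proof (rule ccontr)
  assume "infinite (carrier S)"
  then obtain L where L: "recurrent_language L" and geo: "\<And>w. w \<in> L \<Longrightarrow> geodesic X w"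
    using exists_recurrent_geodesics[OF X] by blast
  note fac = recurrent_factorial[OF L]
  have LX: "set w \<subseteq> X" if "w \<in> L" for w using geo[OF that] by (simp add: geodesic_def)
  have LS: "w \<in> words (carrier S)" if "w \<in> L" "w \<noteq> []" for w using LX[OF that(1)] that X by (auto simp: words_def)
  obtain x where x: "x \<in> X" "[x] \<in> L" using recurrent_nonempty[OF L geo] by blast
  have xS: "x \<in> carrier S" and xw: "[x] \<in> words (carrier S)" using x X by (auto simp: words_def)
  obtain n0 where n0: "\<And>w. w \<in> L \<Longrightarrow> n0 \<le> length w \<Longrightarrow> \<exists>p s. w = p @ [x] @ s"
    using recurrent_factors_bound[OF L, of "{[x]}"] x by auto
  define R where "R = blocks L x (n0 + 3)"
  have Rx: "r @ [x] \<in> L" if "r \<in> R" for r using that by (simp add: R_def blocks_def)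
  have RL: "r \<in> L" if "r \<in> R" for r using fac[of "[]" r "[x]"] Rx[OF that] by simp
  have finR: "finite R"
    by (rule finite_subset[OF _ finite_lists_length_le[OF X(1), of "n0 + 3"]])
      (use LX[OF RL] in \<open>auto simp: R_def blocks_def\<close>)
  have "finite ((\<lambda>r. r @ [x]) ` R)" "(\<lambda>r. r @ [x]) ` R \<subseteq> L" using finR Rx by auto
  from recurrent_factors_bound[OF L this] obtain n1 where
    n1': "\<forall>w\<in>L. n1 \<le> length w \<longrightarrow> (\<forall>r\<in>(\<lambda>r. r @ [x]) ` R. \<exists>p s. w = p @ r @ s)" by (elim exE)
  have n1: "\<exists>p s. w = p @ (r @ [x]) @ s" if "w \<in> L" "n1 \<le> length w" "r \<in> R" for w r
    using n1'[rule_format, OF that(1,2) imageI[OF that(3)]] .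
  \<comment> \<open>Any \<open>n1\<close> consecutive letters contain each \<open>r x\<close>; the
    two extra letters make both neighbours of \<open>r x\<close> nonempty. So one word
    \<open>y\<close>, and one frame \<open>C\<close> over it, serves all return words.\<close>
  obtain y where y: "y \<in> L" "length y = n1 + 2" using unbounded_length[of L "n1 + 2"] L by (auto simp: recurrent_language_def)
  have yR: "\<exists>h h'. h \<noteq> [] \<and> h' \<noteq> [] \<and> y = h @ r @ [x] @ h'" if r: "r \<in> R" for r
  proof -
    obtain f m where fm: "y = f # m" "length m = n1 + 1" using y(2) by (cases y) auto
    then obtain m' l where ml: "m = m' @ [l]" "length m' = n1" by (cases m rule: rev_cases) auto
    have "[f] @ m' @ [l] \<in> L" using y fm ml by simp
    then have "m' \<in> L" by (rule fac)
    then obtain p s where "m' = p @ (r @ [x]) @ s" using n1[of m' r] ml r by auto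
    then show ?thesis using fm ml by (intro exI[of _ "f # p"] exI[of _ "s @ [l]"]) simp
  qed
  have yne: "y \<noteq> []" using y by auto
  obtain b c where bc: "range b \<subseteq> words X" "range c \<subseteq> words X" and CL: "nest (@) y b c N \<in> L"
    using recurrent_nest_words[OF L geo y(1) yne, of N] by blast
  have "words X \<subseteq> words (carrier S)" using X by (auto simp: words_def)
  then have bcS: "range b \<subseteq> words (carrier S)" "range c \<subseteq> words (carrier S)" using bc by auto
  define C where "C = nest (@) y b c N"
  have CL: "C \<in> L" using CL by (simp add: C_def)
  have yX: "y \<in> words X" using LX y yne by (auto simp: words_def)
  have CX: "C \<in> words X" unfolding C_def using yX bc by (rule nest_words)
  have Cw: "C \<in> words (carrier S)" using CX X by (auto simp: words_def)
  have "x \<in> set y"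
  proof -
    obtain a where a: "1 \<le> length a" "[x] @ a @ [x] \<in> L" using recurrent_return[OF L x(2), of 1] by blast
    then have ne: "a \<noteq> []" by auto
    have "x # a \<in> star R" unfolding R_def using mem_star_blocks[OF L n0 ne] a by simp
    then have "R \<noteq> {}" by (auto simp: star_def)
    then obtain r where "r \<in> R" by blast
    from yR[OF this] show ?thesis by auto
  qed
  moreover have "set y \<subseteq> set C" unfolding C_def by (induction N) auto
  ultimately obtain c1 c2 where c12: "C = c1 @ [x] @ c2" by (metis append_Cons append_Nil split_list subsetD)
  obtain w0 where w0: "1 \<le> length w0" "C @ w0 @ C \<in> L" using recurrent_return[OF L CL, of 1] by blast
  have w0S: "set w0 \<subseteq> carrier S" using LX[OF w0(2)] X by auto
  \<comment> \<open>\<open>P\<close> and \<open>Q\<close> run between an outer copy of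
    \<open>C\<close> and a fixed \<open>x\<close> inside an inner copy, so the word from one such
    \<open>x\<close> to the next is a product of return words.\<close>
  define P where "P = w0 @ c1"
  define Q where "Q = c2 @ w0"
  have PQ: "P \<in> words (carrier S)" "Q \<in> words (carrier S)"
    using w0 w0S Cw by (auto simp: P_def Q_def words_def c12)
  have Rshape: "\<exists>a. a \<noteq> [] \<and> r = x # a" if "r \<in> R" for r using that by (simp add: R_def blocks_def)
  have tR: "\<exists>t\<in>star R. k \<le> length t \<and> C @ P @ t @ [x] @ Q @ C \<in> L" for k
  proof -
    obtain w where w: "Suc k \<le> length w" "(C @ w0 @ C) @ w @ (C @ w0 @ C) \<in> L"
      using recurrent_return[OF L w0(2), of "Suc k"] by blast
    define t where "t = x # (c2 @ w @ c1)"
    have eq: "(C @ w0 @ C) @ w @ (C @ w0 @ C) = C @ P @ t @ [x] @ Q @ C"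
      by (simp add: c12 P_def Q_def t_def)
    have "(C @ P) @ (t @ [x]) @ (Q @ C) \<in> L" using w(2) unfolding eq by simp
    then have "t @ [x] \<in> L" by (rule fac)
    moreover have "c2 @ w @ c1 \<noteq> []" using w by auto
    ultimately have "t \<in> star R" unfolding R_def t_def using mem_star_blocks[OF L n0] by blast
    moreover have "k \<le> length t" using w by (simp add: t_def)
    ultimately show ?thesis using w(2) unfolding eq by blast
  qed
  have Rne: "R \<noteq> {}"
  proof
    assume "R = {}"
    then have "star R = {[]}" by (auto simp: star_def)
    then show False using tR[of 1] by auto
  qed
  interpret return_words S x R C P Q e
  proof unfold_locales
    show "finite R" "R \<noteq> {}" by (fact finR Rne)+
    show "R \<subseteq> words (carrier S)"
    proof
      fix r assume r: "r \<in> R"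
      then have "r \<noteq> []" using Rshape by auto
      then show "r \<in> words (carrier S)" using LS[OF RL[OF r]] by simp
    qed
    show "\<exists>a. a \<noteq> [] \<and> r = x # a" if "r \<in> R" for r by (rule Rshape[OF that])
    show "x \<in> carrier S" "C \<in> words (carrier S)" "P \<in> words (carrier S)" "Q \<in> words (carrier S)" by (fact xS Cw PQ)+
    fix r p q assume r: "r \<in> R" and pq: "p \<in> words (carrier S)" "q \<in> words (carrier S)"
    obtain a where a: "a \<noteq> []" "r = x # a" using Rshape[OF r] by blast
    obtain h h' where h: "h \<noteq> []" "h' \<noteq> []" "y = h @ r @ [x] @ h'" using yR[OF r] by blast
    have yS: "set y \<subseteq> carrier S" using LX[OF y(1)] X by auto
    have "a \<in> words (carrier S)" "h \<in> words (carrier S)" "h' \<in> words (carrier S)"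
      using a h yS by (auto simp: words_def)
    from insertion_identity_apply[OF ins xw this pq bcS, of C]
    show "val (C @ p @ [x] @ q @ C) = val (C @ p @ (spow (@) r (Suc e) @ [x]) @ q @ C)"
      using h(3) a(2) by (simp add: C_def)
  qed
  define V where "V = \<Phi> ` star R"
  have "finite V" unfolding V_def by (rule finite_\<Phi>[OF n exponent chief_word])
  then have "finite {length w | w. geodesic X w \<and> w \<noteq> [] \<and> val w \<in> V}" by (rule geodesic_lengths_finite)
  then obtain M where M: "\<And>w. geodesic X w \<Longrightarrow> w \<noteq> [] \<Longrightarrow> val w \<in> V \<Longrightarrow> length w \<le> M"
    unfolding finite_nat_set_iff_bounded_le by blast
  obtain t where t: "t \<in> star R" "Suc M \<le> length t" "C @ P @ t @ [x] @ Q @ C \<in> L" using tR by blast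
  have "val (C @ P @ t @ [x] @ Q @ C) \<in> V" using t(1) by (auto simp: V_def \<Phi>_def)
  then have "length (C @ P @ t @ [x] @ Q @ C) \<le> M" using geo[OF t(3)] by (intro M) auto
  then show False using t(2) by simp
qed

end

lemma (in flat_semiring) not_inherently_nonfinitely_based_of_flat: "\<not> inherently_nonfinitely_based S"
proof -
  define n where "n = card (carrier S)"
  \<comment> \<open>\<open>(n + 2)!\<close> is a multiple of \<open>n!\<close> and at least
    \<open>n + 2\<close>, so subtracting \<open>2\<close> still leaves
    \<open>e \<ge> n\<close>.\<close>
  define e where "e = fact (n + 2) - (2::nat)"
  have "n + 2 \<le> fact (n + 2)" by (rule fact_ge_self)
  then have e: "Suc (Suc e) = fact (n + 2)" "n \<le> e" by (auto simp: e_def)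
  have dvd: "fact (card (carrier S)) dvd Suc (Suc e)" unfolding e n_def by (rule fact_dvd) simp
  have "carrier S \<noteq> {}" using T by blast
  then have n: "0 < n" using fin by (simp add: n_def card_gt_0_iff)
  define w1 where "w1 = spow Times (Var 0) (Suc e)"
  define w2 where "w2 = chief_word Times e n (\<lambda>i. Var (2 * i)) (\<lambda>i. Var (2 * i + 1))"
  have bound: "\<exists>q. vars w \<subseteq> {..q}" for w using finite_vars[of w] by (metis finite_nat_iff_bounded_le)
  obtain q1 q2 where q: "vars w1 \<subseteq> {..q1}" "vars w2 \<subseteq> {..q2}" using bound by metis
  define E where "E = {insertion_identity e n, law_identity e q1 w1, law_identity e q2 w2}"
  have ex: "spow (monoid.mult H) g (Suc e) = one H"
    if "group (H :: 'a monoid)" "finite (carrier H)" "card (carrier H) \<le> card (carrier S)" "g \<in> carrier H" for H g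
    using group.spow_exponent[OF that(1,2,3) dvd that(4)] .
  have s1: "satisfies S (law_identity e q1 w1)"
  proof (rule satisfies_law_identity[OF dvd _ _ q(1)])
    show "card (carrier S) \<le> e" using e by (simp add: n_def)
    fix H :: "'a monoid" and \<rho> :: "nat \<Rightarrow> 'a" assume H: "group H" "finite (carrier H)" "card (carrier H) \<le> card (carrier S)" "range \<rho> \<subseteq> carrier H"
    then have "\<rho> 0 \<in> carrier H" by auto
    then show "word_value (monoid.mult H) \<rho> w1 = one H" using ex[OF H(1-3)] by (simp only: w1_def word_value_spow word_value.simps)
  qed
  have s2: "satisfies S (law_identity e q2 w2)"
  proof (rule satisfies_law_identity[OF dvd _ _ q(2)])
    show "card (carrier S) \<le> e" using e by (simp add: n_def)
    fix H :: "'a monoid" and \<rho> :: "nat \<Rightarrow> 'a" assume H: "group H" "finite (carrier H)" "card (carrier H) \<le> card (carrier S)" "range \<rho> \<subseteq> carrier H"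
    have "chief_word (monoid.mult H) e n (\<lambda>i. \<rho> (2 * i)) (\<lambda>i. \<rho> (2 * i + 1)) = one H"
      by (rule group.chief_word_trivial[OF H(1,2) _ ex[OF H(1-3)]]) (use H in \<open>auto simp: n_def\<close>)
    then show "word_value (monoid.mult H) \<rho> w2 = one H" using n by (simp add: w2_def word_value_chief_word)
  qed
  show ?thesis
  proof (rule not_inherently_nonfinitely_based)
    show "ai_semiring S" by (rule ai_semiring_axioms)
    show "finite E" by (simp add: E_def)
    show "satisfies S d" if "d \<in> E" for d
      using that s1 s2 satisfies_insertion_identity[OF dvd] by (auto simp: E_def n_def)
    fix A :: "nat binalg" assume A: "ai_semiring A" "\<And>d. d \<in> E \<Longrightarrow> satisfies A d" "finitely_generated A"
    then obtain X where X: "finite X" "X \<subseteq> carrier A" "generated A X = carrier A" by (auto simp: finitely_generated_def)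
    interpret A: ai_semiring A by (rule A(1))
    show "finite (carrier A)"
      using A.flat_identities_finite[of e n n q1 q2 X] A(2) X n by (simp add: E_def w1_def w2_def)
  qed
qed


section \<open>The additive order\<close>

context ai_semiring
begin

lemma plus_left_comm:
  assumes "x \<in> carrier S" "y \<in> carrier S" "z \<in> carrier S"
  shows "x \<boxplus> (y \<boxplus> z) = y \<boxplus> (x \<boxplus> z)"
  using plus_assoc[of x y z] plus_assoc[of y x z] plus_comm[of x y] assms by simp

lemma total_sum_greatest:
  assumes fin: "finite (carrier S)"
  shows "total_sum S \<in> carrier S" "\<And>x. x \<in> carrier S \<Longrightarrow> x \<preceq> total_sum S"
proof -
  define s where "s = (SOME s. s \<in> carrier S)"
  have "carrier S \<noteq> {}" using algebra by (simp add: binalgebra_def)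
  then have s: "s \<in> carrier S" unfolding s_def by (rule some_in_eq[THEN iffD2])
  \<comment> \<open>\<open>fold\<close> needs left-commutativity on the whole type.\<close>
  define f where "f x z = (if x \<in> carrier S \<and> z \<in> carrier S then x \<boxplus> z else z)" for x z
  interpret comp_fun_commute_on UNIV f
  proof
    show "f y \<circ> f x = f x \<circ> f y" for x y by (rule ext) (auto simp: f_def intro: plus_left_comm)
  qed
  have step: "Finite_Set.fold f s A \<in> carrier S \<and> (\<forall>x\<in>A. x \<preceq> Finite_Set.fold f s A)"
    if "A \<subseteq> carrier S" for A
    using finite_subset[OF that fin] that
  proof (induction A rule: finite_induct)
    case (insert a A)
    let ?F = "Finite_Set.fold f s A"
    have F: "?F \<in> carrier S" "\<forall>x\<in>A. x \<preceq> ?F" and a: "a \<in> carrier S" and A: "A \<subseteq> carrier S" using insert by auto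
    have eq: "Finite_Set.fold f s (insert a A) = a \<boxplus> ?F"
      using insert F a by (simp add: f_def)
    have "a \<preceq> a \<boxplus> ?F" using a F by (simp add: plus_idem flip: plus_assoc)
    moreover have "x \<preceq> a \<boxplus> ?F" if "x \<in> A" for x
    proof -
      have xS: "x \<in> carrier S" using that A by blast
      have "x \<boxplus> (a \<boxplus> ?F) = a \<boxplus> (x \<boxplus> ?F)" using xS a F(1) by (rule plus_left_comm)
      then show ?thesis using F(2) that by simp
    qed
    ultimately show ?case unfolding eq using a F by auto
  qed (use s in simp)
  have "total_sum S = Finite_Set.fold f s (carrier S)"
    unfolding total_sum_def s_def[symmetric]
    by (rule fold_closed_eq[where B = "carrier S"]) (use s in \<open>auto simp: f_def\<close>)
  then show "total_sum S \<in> carrier S" "\<And>x. x \<in> carrier S \<Longrightarrow> x \<preceq> total_sum S"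
    using step[of "carrier S"] by auto
qed

text \<open>A sum other than \<open>T\<close> has nothing strictly below it, since a chain of three
  would arise; but of two distinct summands at least one is strictly below the sum.\<close>

lemma flat_semiring_of_height:
  assumes fin: "finite (carrier S)" and h: "height (additive_order S) < 3"
  shows "flat_semiring S (total_sum S)"
proof
  note top = total_sum_greatest[OF fin]
  show "total_sum S \<in> carrier S" "\<And>x. x \<in> carrier S \<Longrightarrow> x \<preceq> total_sum S" by (fact top)+
  show "finite (carrier S)" by (rule fin)
  fix x y assume xy: "x \<in> carrier S" "y \<in> carrier S" "x \<noteq> y"
  have small: "card C < 3" if "order_chain (additive_order S) C" for C
  proof -
    have "finite {card C | C. order_chain (additive_order S) C}"
      by (rule finite_subset[of _ "card ` Pow (carrier S)"])
        (use fin in \<open>auto simp: order_chain_def additive_order_def\<close>)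
    then have "card C \<le> height (additive_order S)" unfolding height_def using that by (intro Max_ge) auto
    then show ?thesis using h by simp
  qed
  have two: "z = x \<boxplus> y \<or> x \<boxplus> y = total_sum S" if z: "z \<in> carrier S" "z \<preceq> x \<boxplus> y" for z
  proof (rule ccontr)
    assume H: "\<not> ?thesis"
    let ?w = "x \<boxplus> y" and ?T = "total_sum S"
    have "?w \<in> carrier S" using xy by simp
    then have "order_chain (additive_order S) {z, ?w, ?T}"
      using z top by (auto simp: order_chain_def additive_order_def plus_idem)
    moreover have "z \<noteq> ?T" using H z(2) top(2)[OF \<open>?w \<in> carrier S\<close>] plus_comm top(1) \<open>?w \<in> carrier S\<close> by metis
    then have "card {z, ?w, ?T} = 3" using H by auto
    ultimately show False using small by fastforce
  qed
  have "x \<preceq> x \<boxplus> y" "y \<preceq> x \<boxplus> y"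
    using xy plus_comm[of x y] by (simp_all add: plus_idem flip: plus_assoc) (simp add: plus_assoc plus_idem)
  then show "x \<boxplus> y = total_sum S" using two[of x] two[of y] xy by auto
qed

lemma total_of_width:
  assumes fin: "finite (carrier S)" and w: "width (additive_order S) < 2"
    and xy: "x \<in> carrier S" "y \<in> carrier S"
  shows "x \<preceq> y \<or> y \<preceq> x"
proof (rule ccontr)
  assume H: "\<not> ?thesis"
  then have "x \<noteq> y" using plus_idem xy by auto
  then have "card {x, y} = 2" by simp
  moreover have "order_antichain (additive_order S) {x, y}"
    using H xy by (auto simp: order_antichain_def additive_order_def)
  moreover have "finite {card C | C. order_antichain (additive_order S) C}"
    by (rule finite_subset[of _ "card ` Pow (carrier S)"])
      (use fin in \<open>auto simp: order_antichain_def additive_order_def\<close>)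
  ultimately have "2 \<le> width (additive_order S)" unfolding width_def by (intro Max_ge) auto
  then show False using w by simp
qed

text \<open>If \<open>a \<le> b\<close> then \<open>g = a\<^sup>-\<^sup>1 b\<close> satisfies \<open>1 \<le> g \<le> g\<^sup>2 \<le> \<dots>\<close>, and the powers of \<open>g\<close> return to \<open>1\<close>.\<close>

lemma subgroup_antichain:
  assumes fin: "finite (carrier S)" and G: "mult_subgroup S G"
  shows "order_antichain (additive_order S) G"
proof -
  obtain u where GS: "G \<subseteq> carrier S" and gr: "group \<lparr>carrier = G, monoid.mult = (\<boxdot>), one = u\<rparr>"
    using G by (auto simp: mult_subgroup_def)
  define H where "H = \<lparr>carrier = G, monoid.mult = (\<boxdot>), one = u\<rparr>"
  interpret H: group H unfolding H_def by (rule gr)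
  have sel [simp]: "carrier H = G" "monoid.mult H = (\<boxdot>)" "one H = u" by (simp_all add: H_def)
  note Rs = compatible_orderD[OF compatible_le]
  have "a = b" if ab: "a \<in> G" "b \<in> G" "a \<preceq> b" for a b
  proof -
    define a' where "a' = inv\<^bsub>H\<^esub> a"
    have a': "a' \<in> G" "a' \<boxdot> a = u" "a \<boxdot> a' = u" using ab H.inv_closed H.l_inv H.r_inv by (simp_all add: a'_def)
    define g where "g = a' \<boxdot> b"
    have gG: "g \<in> G" using H.m_closed[of a' b] a' ab by (simp add: g_def)
    have uG: "u \<in> G" using H.one_closed by simp
    have S: "u \<in> carrier S" "g \<in> carrier S" using gG uG GS by auto
    have ug: "u \<preceq> g" using Rs(4)[OF ab(3), of a'] a' ab GS by (auto simp: g_def)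
    have up: "u \<preceq> spow (\<boxdot>) g n" for n
    proof (induction n)
      case (Suc n)
      have "u \<boxdot> u \<preceq> spow (\<boxdot>) g n \<boxdot> u" using Rs(5)[OF Suc] S by simp
      moreover have "spow (\<boxdot>) g n \<boxdot> u \<preceq> spow (\<boxdot>) g n \<boxdot> g" using Rs(4)[OF ug] S by simp
      moreover have "u \<boxdot> u = u" using H.l_one[of u] uG by simp
      ultimately show ?case using Rs(3)[of u "spow (\<boxdot>) g n \<boxdot> u" "spow (\<boxdot>) g n \<boxdot> g"] S by simp
    qed (use ug in simp)
    have "finite (carrier H)" using GS fin finite_subset by auto
    have "spow (monoid.mult H) g (Suc (fact (card (carrier H) + 2) - 2)) = one H"
    proof (rule H.spow_exponent[OF \<open>finite (carrier H)\<close> order_refl])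
      have "card (carrier H) + 2 \<le> fact (card (carrier H) + 2)" by (rule fact_ge_self)
      then have "Suc (Suc (fact (card (carrier H) + 2) - 2)) = fact (card (carrier H) + 2)" by linarith
      then show "fact (card (carrier H)) dvd Suc (Suc (fact (card (carrier H) + 2) - 2))"
        by (simp only:) (rule fact_dvd, simp)
    qed (use gG in simp)
    then obtain k where k: "spow (\<boxdot>) g (Suc k) = u" by (auto simp del: spow.simps)
    have "g \<preceq> u"
    proof -
      have "u \<boxdot> g \<preceq> spow (\<boxdot>) g k \<boxdot> g" using Rs(5)[OF up] S by simp
      moreover have "u \<boxdot> g = g" using H.l_one[of g] gG by simp
      ultimately show ?thesis using k by simp
    qed
    then have "g = u" using Rs(2)[OF _ ug] S by simp
    then have "a \<boxdot> (a' \<boxdot> b) = a \<boxdot> u" by (simp add: g_def)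
    then show ?thesis using H.r_one[of a] H.l_one[of b] a' ab GS times_assoc[of a a' b] by auto
  qed
  then show ?thesis using GS by (auto simp: order_antichain_def additive_order_def)
qed

text \<open>An identity on the upper side of \<open>R\<close> makes multiplication decreasing:
  \<open>x y\<close> lies below \<open>x u = x\<close> and below \<open>u y = y\<close>. Taking the
  additive order or its dual for \<open>R\<close> covers both extremes.\<close>

lemma identity_extremal:
  assumes fin: "finite (carrier S)" and u: "mult_identity S u"
    and R: "compatible_order R" "\<And>x. x \<in> carrier S \<Longrightarrow> R x u"
  shows "\<not> inherently_nonfinitely_based S"
proof (rule deletion_identity_not_inherently_nonfinitely_based[OF ai_semiring_axioms])
  have uS: "u \<in> carrier S" "\<And>x. x \<in> carrier S \<Longrightarrow> u \<boxdot> x = x \<and> x \<boxdot> u = x" using u by (auto simp: mult_identity_def)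
  show "satisfies S (deletion_identity (card (carrier S)))"
  proof (rule satisfies_deletion_of_decreasing[OF fin R(1)])
    fix x y assume "x \<in> carrier S" "y \<in> carrier S"
    then show "R (x \<boxdot> y) x \<and> R (x \<boxdot> y) y"
      using compatible_orderD(4)[OF R(1) R(2)[of y], of x] compatible_orderD(5)[OF R(1) R(2)[of x], of y] uS by auto
  qed
qed

end

theorem corollary2p23:
  fixes S :: "'a binalg" and T :: 'a
  assumes "ai_semiring S"
    and "finite (carrier S)"
    and "inherently_nonfinitely_based S"
    and "T = total_sum S"
  shows "greatest (additive_order S) T (carrier S)
    \<and> width (additive_order S) \<ge> 2
    \<and> height (additive_order S) \<ge> 3
    \<and> (\<forall>e. mult_identity S e \<longrightarrow> e \<noteq> T \<and> \<not> least (additive_order S) e (carrier S))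
    \<and> (\<forall>G. mult_subgroup S G \<longrightarrow> order_antichain (additive_order S) G)"
proof (intro conjI allI impI)
  interpret ai_semiring S by (rule assms(1))
  note top = total_sum_greatest[OF assms(2)]
  show "greatest (additive_order S) T (carrier S)"
    using top by (auto simp: greatest_def additive_order_def assms(4))
  show "width (additive_order S) \<ge> 2"
  proof (rule ccontr)
    assume "\<not> ?thesis"
    then have w: "width (additive_order S) < 2" by simp
    have "satisfies S (deletion_identity (card (carrier S)))"
      by (rule satisfies_deletion_of_total[OF assms(2) total_of_width[OF assms(2) w]])
    then show False
      using deletion_identity_not_inherently_nonfinitely_based[OF assms(1)] assms(3) by blast
  qed
  show "height (additive_order S) \<ge> 3"
  proof (rule ccontr)
    assume "\<not> ?thesis"
    then interpret flat_semiring S "total_sum S" by (intro flat_semiring_of_height[OF assms(2)]) simp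
    show False using not_inherently_nonfinitely_based_of_flat assms(3) by blast
  qed
  show "order_antichain (additive_order S) G" if "mult_subgroup S G" for G
    by (rule subgroup_antichain[OF assms(2) that])
  fix e assume e: "mult_identity S e"
  show "e \<noteq> T"
    using identity_extremal[OF assms(2) e compatible_le] top(2) assms(3,4) by blast
  show "\<not> least (additive_order S) e (carrier S)"
  proof
    assume "least (additive_order S) e (carrier S)"
    then have "e \<preceq> x" if "x \<in> carrier S" for x using that by (auto simp: least_def additive_order_def)
    then show False using identity_extremal[OF assms(2) e compatible_ge] assms(3) by blast
  qed
qed

end
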